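(* Let $N \cong \mathbb{Z}^n$ be a lattice, let $\Sigma$ be a complete fan in $N_{\mathbb{R}} = N \otimes_{\mathbb{Z}} \mathbb{R}$, let $\Sigma(1)$ be the set of primitive generators in $N$ of the 1-dimensional cones of $\Sigma$, and let $X = X(\Sigma)$ be the corresponding toric variety. The following are equivalent: (1) $\Sigma(1)$ is unimodular. (2) $X$ is diagonally split at $q$ for all integers $q \geq 2$. (3) $X$ is diagonally split at some even integer $q \geq 2$. (4) $X$ is diagonally split at $q = 2$.
   Context: Unimodular: $\Sigma(1)$ is unimodular if every maximal linearly independent subset of $\Sigma(1)$ generates the lattice $N$. Diagonal splittings: let $X$ be a toric variety (over a field) given by a complete fan $\Sigma$. For an integer $q\ge 2$, multiplication by $q$ on $N_{\mathbb{R}}$ preserves $\Sigma$ and induces a morphism $F\colon X\to X$. A splitting of $X$ at $q$ is an $\mathcal{O}_X$-module map $\pi\colon F_*\mathcal{O}_X\to\mathcal{O}_X$ whose composition with the natural map $\mathcal{O}_X\to F_*\mathcal{O}_X$ is the identity. It is compatible with a subvariety $Z\subset X$ with ideal sheaf $I_Z$ if $\pi(F_*I_Z)\subset I_Z$. The toric variety $X$ is diagonally split at $q$ if there is a splitting at $q$ of the toric variety $X\times X$ compatible with the diagonal $\Delta\subset X\times X$. Recalled known characterization (from earlier work of Payne): with $M=\operatorname{Hom}(N,\mathbb{Z})$ and $M_{\mathbb{R}}=M\otimes_{\mathbb{Z}}\mathbb{R}$, $X$ is diagonally split at $q\ge 2$ if and only if the open polytope $\mathbb{F}_\Sigma=\{u\in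 M_{\mathbb{R}} : |\langle u,v\rangle|<1 \text{ for all } v\in\Sigma(1)\}$ contains a representative of every class in $\frac{1}{q}M/M$. *)

theory Defs
  imports
    "HOL-Analysis.Finite_Function_Topology"
    "HOL-Analysis.Polytope"
    "HOL-Computational_Algebra.Fraction_Field"
    "HOL-Algebra.Ideal"
begin

section \<open>Lattices and fans\<close>

text \<open>
  The lattices \<open>N\<close> and \<open>M = Hom(N, \<int>)\<close> of rank \<open>n\<close> (with \<open>n = 0\<close> allowed) are both
  \<open>\<int>\<^sup>n\<close>, realised as the finitely supported functions \<open>nat \<Rightarrow> \<int>\<close> with support in \<open>{..<n}\<close>;
  an element of \<open>M\<close> acts on \<open>N\<close> through the standard pairing. Likewise for \<open>N \<otimes> \<real>\<close>. Keeping the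
  rank a natural number lets \<open>X\<close> and \<open>X \<times> X\<close> be instances of the same construction, and the
  library's linear order on \<open>nat \<Rightarrow>\<^sub>0 int\<close> makes Laurent polynomials an integral domain.
\<close>

type_synonym lat = "nat \<Rightarrow>\<^sub>0 int"
type_synonym rvec = "nat \<Rightarrow>\<^sub>0 real"

definition int_lattice :: "nat \<Rightarrow> lat set" where
  "int_lattice n = {v. Poly_Mapping.keys v \<subseteq> {..<n}}"

definition real_space :: "nat \<Rightarrow> rvec set" where
  "real_space n = {x. Poly_Mapping.keys x \<subseteq> {..<n}}"

definition of_lat :: "lat \<Rightarrow> rvec" where
  "of_lat v = Poly_Mapping.map real_of_int v"

definition pairing :: "lat \<Rightarrow> rvec \<Rightarrow> real" where
  "pairing u x =
    (\<Sum>i\<in>Poly_Mapping.keys u. real_of_int (Poly_Mapping.lookup u i) * Poly_Mapping.lookup x i)"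

definition strongly_convex_rational_cone :: "nat \<Rightarrow> rvec set \<Rightarrow> bool" where
  "strongly_convex_rational_cone n \<sigma> \<longleftrightarrow>
    (\<exists>S. finite S \<and> S \<subseteq> int_lattice n \<and> \<sigma> = convex_cone hull (of_lat ` S)) \<and>
    (\<forall>x. x \<in> \<sigma> \<and> - x \<in> \<sigma> \<longrightarrow> x = 0)"

text \<open>The relation \<open>face_of\<close> also admits the empty set, which is not a face of a cone.\<close>

definition fan :: "nat \<Rightarrow> rvec set set \<Rightarrow> bool" where
  "fan n \<Sigma> \<longleftrightarrow>
    finite \<Sigma> \<and> \<Sigma> \<noteq> {} \<and>
    (\<forall>\<sigma>\<in>\<Sigma>. strongly_convex_rational_cone n \<sigma>) \<and>
    (\<forall>\<sigma>\<in>\<Sigma>. \<forall>\<tau>. \<tau> face_of \<sigma> \<and> \<tau> \<noteq> {} \<longrightarrow> \<tau> \<in> \<Sigma>) \<and>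
    (\<forall>\<sigma>\<in>\<Sigma>. \<forall>\<tau>\<in>\<Sigma>. (\<sigma> \<inter> \<tau>) face_of \<sigma> \<and> (\<sigma> \<inter> \<tau>) face_of \<tau>)"

definition complete_fan :: "nat \<Rightarrow> rvec set set \<Rightarrow> bool" where
  "complete_fan n \<Sigma> \<longleftrightarrow> fan n \<Sigma> \<and> \<Union>\<Sigma> = real_space n"

definition ray :: "rvec \<Rightarrow> rvec set" where
  "ray x = {t *\<^sub>R x | t. 0 \<le> t}"

text \<open>\<open>\<Sigma>(1)\<close>: the generators \<open>v\<close> of the monoids \<open>\<rho> \<inter> N\<close>, for \<open>\<rho>\<close> a one-dimensional cone.\<close>

definition primitive_generators :: "nat \<Rightarrow> rvec set set \<Rightarrow> lat set" where
  "primitive_generators n \<Sigma> =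
    {v \<in> int_lattice n. v \<noteq> 0 \<and> ray (of_lat v) \<in> \<Sigma> \<and>
       (\<forall>w \<in> int_lattice n. of_lat w \<in> ray (of_lat v) \<longrightarrow> (\<exists>k::nat. w = frag_cmul (int k) v))}"

definition int_span :: "lat set \<Rightarrow> lat set" where
  "int_span B = {\<Sum>v\<in>T. frag_cmul (c v) v | T c. finite T \<and> T \<subseteq> B}"

definition lin_indep :: "lat set \<Rightarrow> bool" where
  "lin_indep B \<longleftrightarrow> independent (of_lat ` B)"

definition unimodular :: "nat \<Rightarrow> lat set \<Rightarrow> bool" where
  "unimodular n S \<longleftrightarrow>
    (\<forall>B. B \<subseteq> S \<and> lin_indep B \<and> (\<forall>B'. B \<subseteq> B' \<and> B' \<subseteq> S \<and> lin_indep B' \<longrightarrow> B' = B)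
      \<longrightarrow> int_span B = int_lattice n)"


section \<open>Toric varieties\<close>

text \<open>
  \<open>X(\<Sigma>)\<close> is presented in the style of Chevalley: it is integral and separated, so its points are
  identified with their local rings inside the function field. The latter is contained in the field
  \<open>'k ratfun\<close> of rational functions over \<open>'k\<close> in variables indexed by all of \<open>nat\<close>. The chart of a
  cone \<open>\<sigma>\<close> is the spectrum of \<open>k[\<sigma>\<^sup>\<or> \<inter> M]\<close>, and the prime \<open>P\<close> is the point whose local ring is
  the localisation at \<open>P\<close>; gluing charts is identifying equal local rings.
\<close>

type_synonym 'k laurent = "lat \<Rightarrow>\<^sub>0 'k"
type_synonym 'k ratfun = "'k laurent fract"

definition dual_monoid :: "nat \<Rightarrow> rvec set \<Rightarrow> lat set" where
  "dual_monoid n \<sigma> = {u \<in> int_lattice n. \<forall>x\<in>\<sigma>. 0 \<le> pairing u x}"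

definition chart_ring :: "nat \<Rightarrow> rvec set \<Rightarrow> 'k::field laurent ring" where
  "chart_ring n \<sigma> =
    \<lparr>carrier = {f. Poly_Mapping.keys f \<subseteq> dual_monoid n \<sigma>}, mult = (*), one = 1, zero = 0, add = (+)\<rparr>"

lemma dual_monoid_zero: "0 \<in> dual_monoid n \<sigma>"
  by (simp add: dual_monoid_def int_lattice_def pairing_def)

lemma pairing_add: "pairing (u + v) x = pairing u x + pairing v x"
proof -
  have *: "pairing w x = (\<Sum>i\<in>T. real_of_int (Poly_Mapping.lookup w i) * Poly_Mapping.lookup x i)"
    if "finite T" "Poly_Mapping.keys w \<subseteq> T" for w T
    unfolding pairing_def using that by (intro sum.mono_neutral_left) (auto simp: in_keys_iff)
  let ?T = "Poly_Mapping.keys u \<union> Poly_Mapping.keys v"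
  have "Poly_Mapping.keys (u + v) \<subseteq> ?T" by (rule keys_add)
  then show ?thesis
    by (simp add: *[of ?T] lookup_add algebra_simps sum.distrib)
qed

lemma dual_monoid_add:
  assumes "u \<in> dual_monoid n \<sigma>" "v \<in> dual_monoid n \<sigma>"
  shows "u + v \<in> dual_monoid n \<sigma>"
  using assms keys_add[of u v] by (auto simp: dual_monoid_def int_lattice_def pairing_add)

lemma chart_ring_cring: "cring (chart_ring n \<sigma> :: 'k::field laurent ring)"
proof (rule cringI)
  let ?A = "{f :: 'k laurent. Poly_Mapping.keys f \<subseteq> dual_monoid n \<sigma>}"
  have add: "f + g \<in> ?A" if "f \<in> ?A" "g \<in> ?A" for f g
    using that keys_add[of f g] by blast
  have mult: "f * g \<in> ?A" if "f \<in> ?A" "g \<in> ?A" for f g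
    using that keys_mult[of f g] dual_monoid_add by blast
  show "abelian_group (chart_ring n \<sigma> :: 'k laurent ring)"
  proof (rule abelian_groupI)
    fix f :: "'k laurent" assume "f \<in> carrier (chart_ring n \<sigma>)"
    then show "\<exists>g\<in>carrier (chart_ring n \<sigma>). g \<oplus>\<^bsub>chart_ring n \<sigma>\<^esub> f = \<zero>\<^bsub>chart_ring n \<sigma>\<^esub>"
      by (intro bexI[of _ "- f"]) (auto simp: chart_ring_def)
  qed (use add in \<open>auto simp: chart_ring_def add_ac\<close>)
  show "comm_monoid (chart_ring n \<sigma> :: 'k laurent ring)"
    using mult dual_monoid_zero[of n \<sigma>]
    by (intro comm_monoidI) (auto simp: chart_ring_def mult_ac)
qed (auto simp: chart_ring_def algebra_simps)

definition localisation :: "'k::field laurent ring \<Rightarrow> 'k laurent set \<Rightarrow> 'k ratfun set" where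
  "localisation A P = {Fract f g | f g. f \<in> carrier A \<and> g \<in> carrier A - P}"

definition points :: "nat \<Rightarrow> rvec set set \<Rightarrow> 'k::field ratfun set set" where
  "points n \<Sigma> =
    {localisation (chart_ring n \<sigma>) P | \<sigma> P. \<sigma> \<in> \<Sigma> \<and> primeideal P (chart_ring n \<sigma>)}"

text \<open>A set of points is open if it is Zariski open in every chart.\<close>

definition zariski_open :: "nat \<Rightarrow> rvec set set \<Rightarrow> 'k::field ratfun set set \<Rightarrow> bool" where
  "zariski_open n \<Sigma> U \<longleftrightarrow>
    U \<subseteq> points n \<Sigma> \<and>
    (\<forall>\<sigma>\<in>\<Sigma>. \<exists>J \<subseteq> carrier (chart_ring n \<sigma>). \<forall>P. primeideal P (chart_ring n \<sigma>) \<longrightarrow>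
       (localisation (chart_ring n \<sigma>) P \<in> U \<longleftrightarrow> \<not> J \<subseteq> P))"

text \<open>
  The structure sheaf: \<open>\<O>(U)\<close> is the intersection of the local rings of the points of \<open>U\<close>, and the
  zero ring for empty \<open>U\<close>. Restriction maps are inclusions, except into \<open>\<O>({}) = 0\<close>.
\<close>

definition sections :: "'k::field ratfun set set \<Rightarrow> 'k ratfun set" where
  "sections U = (if U = {} then {0} else \<Inter>U)"

definition restr :: "'k::field ratfun set set \<Rightarrow> 'k ratfun \<Rightarrow> 'k ratfun" where
  "restr V s = (if V = {} then 0 else s)"

definition max_ideal :: "'k::field ratfun set \<Rightarrow> 'k ratfun set" where
  "max_ideal x = {s \<in> x. s = 0 \<or> inverse s \<notin> x}"

text \<open>The ideal sheaf of the reduced subvariety with underlying set of points \<open>Z\<close>.\<close>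

definition ideal_sections ::
    "'k::field ratfun set set \<Rightarrow> 'k ratfun set set \<Rightarrow> 'k ratfun set" where
  "ideal_sections Z U = {s \<in> sections U. \<forall>x \<in> U \<inter> Z. s \<in> max_ideal x}"

text \<open>
  The \<open>k\<close>-linear map with \<open>x\<^sup>u \<mapsto> x\<^bsup>h u\<^esup>\<close>. A homomorphism of lattices that maps each cone into a
  cone induces a toric morphism, given on charts by this map for the dual homomorphism \<open>h\<close>.
\<close>

definition monomial_map :: "(lat \<Rightarrow> lat) \<Rightarrow> 'k::field laurent \<Rightarrow> 'k laurent" where
  "monomial_map h f =
    (\<Sum>u\<in>Poly_Mapping.keys f. Poly_Mapping.single (h u) (Poly_Mapping.lookup f u))"

lemma monomial_map_superset:
  assumes "finite T" "Poly_Mapping.keys f \<subseteq> T"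
  shows "monomial_map h f = (\<Sum>u\<in>T. Poly_Mapping.single (h u) (Poly_Mapping.lookup f u))"
  unfolding monomial_map_def using assms
  by (intro sum.mono_neutral_left) (auto simp: in_keys_iff)

lemma monomial_map_add: "monomial_map h (f + g) = monomial_map h f + monomial_map h g"
proof -
  let ?T = "Poly_Mapping.keys f \<union> Poly_Mapping.keys g"
  have "Poly_Mapping.keys (f + g) \<subseteq> ?T" by (rule keys_add)
  then show ?thesis
    by (simp add: monomial_map_superset[of ?T] lookup_add single_add sum.distrib)
qed

lemma monomial_map_single [simp]: "monomial_map h (Poly_Mapping.single u c) = Poly_Mapping.single (h u) c"
  by (cases "c = 0") (simp_all add: monomial_map_def)

lemma monomial_map_sum: "monomial_map h (\<Sum>i\<in>I. f i) = (\<Sum>i\<in>I. monomial_map h (f i))"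
proof (induction I rule: infinite_finite_induct)
  case (insert i I)
  then show ?case by (simp add: monomial_map_add)
qed (simp_all add: monomial_map_def)

lemma laurent_sum: "f = (\<Sum>u\<in>Poly_Mapping.keys f. Poly_Mapping.single u (Poly_Mapping.lookup f u))"
  for f :: "'k::field laurent"
  by (rule poly_mapping_eqI) (simp add: lookup_sum lookup_single when_def in_keys_iff)

lemma monomial_map_mult:
  assumes "\<And>u v. h (u + v) = h u + h v"
  shows "monomial_map h (f * g) = monomial_map h f * monomial_map h g"
proof -
  let ?c = "\<lambda>f u. Poly_Mapping.single u (Poly_Mapping.lookup f u)"
  have "f * g = (\<Sum>u\<in>Poly_Mapping.keys f. ?c f u) * (\<Sum>v\<in>Poly_Mapping.keys g. ?c g v)"
    by (simp flip: laurent_sum)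
  also have "\<dots> = (\<Sum>u\<in>Poly_Mapping.keys f. \<Sum>v\<in>Poly_Mapping.keys g.
      Poly_Mapping.single (u + v) (Poly_Mapping.lookup f u * Poly_Mapping.lookup g v))"
    by (simp add: sum_product mult_single)
  finally have "monomial_map h (f * g) = (\<Sum>u\<in>Poly_Mapping.keys f. \<Sum>v\<in>Poly_Mapping.keys g.
      Poly_Mapping.single (h u + h v) (Poly_Mapping.lookup f u * Poly_Mapping.lookup g v))"
    by (simp add: monomial_map_sum assms)
  also have "\<dots> = monomial_map h f * monomial_map h g"
    by (simp add: monomial_map_def sum_product mult_single)
  finally show ?thesis .
qed

text \<open>
  The morphism \<open>F\<close> induced by multiplication by \<open>q\<close>. As every cone is mapped to itself, \<open>F\<close> takes the
  point \<open>P\<close> of a chart to the contraction of \<open>P\<close> along \<open>x\<^sup>u \<mapsto> x\<^bsup>q u\<^esup>\<close>.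
\<close>

definition power_map :: "nat \<Rightarrow> 'k::field laurent \<Rightarrow> 'k laurent" where
  "power_map q = monomial_map (frag_cmul (int q))"

definition power_preimage ::
    "nat \<Rightarrow> rvec set set \<Rightarrow> nat \<Rightarrow> 'k::field ratfun set set \<Rightarrow> 'k ratfun set set" where
  "power_preimage n \<Sigma> q U =
    {localisation (chart_ring n \<sigma>) P | \<sigma> P. \<sigma> \<in> \<Sigma> \<and> primeideal P (chart_ring n \<sigma>) \<and>
       localisation (chart_ring n \<sigma>) {f \<in> carrier (chart_ring n \<sigma>). power_map q f \<in> P} \<in> U}"

text \<open>
  The induced endomorphism of the function field, which restricts to
  \<open>\<O>(U) \<rightarrow> \<O>(F\<^bsup>-1\<^esup> U) = (F\<^sub>* \<O>)(U)\<close>; see the lemma \<open>power_pullback_Fract\<close> below.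
\<close>

definition power_pullback :: "nat \<Rightarrow> 'k::field ratfun \<Rightarrow> 'k ratfun" where
  "power_pullback q z =
    (THE w. \<forall>f g. g \<noteq> 0 \<and> z = Fract f g \<longrightarrow> w = Fract (power_map q f) (power_map q g))"

lemma power_map_mult: "power_map q (f * g) = power_map q f * power_map q g"
  unfolding power_map_def by (rule monomial_map_mult) (simp add: frag_cmul_distrib2)

lemma lookup_power_map:
  assumes "q > 0"
  shows "Poly_Mapping.lookup (power_map q f) (frag_cmul (int q) u) = Poly_Mapping.lookup f u"
proof -
  have inj: "frag_cmul (int q) v = frag_cmul (int q) u \<longleftrightarrow> v = u" for v
    using assms by (auto simp: poly_mapping_eq_iff fun_eq_iff)
  show ?thesis
    unfolding power_map_def monomial_map_def
    by (simp add: lookup_sum lookup_single inj when_def in_keys_iff)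
qed

lemma power_map_nonzero:
  assumes "q > 0" "f \<noteq> 0"
  shows "power_map q f \<noteq> 0"
  using assms lookup_power_map[OF assms(1), of f]
  by (metis lookup_zero poly_mapping_eqI)

lemma power_pullback_Fract:
  assumes "q > 0" "g \<noteq> 0"
  shows "power_pullback q (Fract f g) = Fract (power_map q f) (power_map q g)"
  unfolding power_pullback_def
proof (rule the_equality)
  show "\<forall>f' g'. g' \<noteq> 0 \<and> Fract f g = Fract f' g' \<longrightarrow>
      Fract (power_map q f) (power_map q g) = Fract (power_map q f') (power_map q g')"
  proof (intro allI impI, elim conjE)
    fix f' g' :: "'a laurent"
    assume "g' \<noteq> 0" and "Fract f g = Fract f' g'"
    with assms have "f * g' = f' * g" by (simp add: eq_fract)
    then have "power_map q f * power_map q g' = power_map q f' * power_map q g"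
      by (simp flip: power_map_mult)
    with assms \<open>g' \<noteq> 0\<close> show "Fract (power_map q f) (power_map q g) = Fract (power_map q f') (power_map q g')"
      by (simp add: eq_fract power_map_nonzero)
  qed
next
  fix w assume "\<forall>f' g'. g' \<noteq> 0 \<and> Fract f g = Fract f' g' \<longrightarrow> w = Fract (power_map q f') (power_map q g')"
  with assms show "w = Fract (power_map q f) (power_map q g)" by blast
qed


section \<open>Splittings\<close>

text \<open>
  Homomorphisms of \<open>\<O>\<close>-modules \<open>\<pi> : F\<^sub>* \<O> \<rightarrow> \<O>\<close>, given by their components \<open>\<pi> U\<close> on open sets.
\<close>

definition pushforward_hom ::
    "nat \<Rightarrow> rvec set set \<Rightarrow> nat \<Rightarrow>
     ('k::field ratfun set set \<Rightarrow> 'k ratfun \<Rightarrow> 'k ratfun) \<Rightarrow> bool" where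
  "pushforward_hom n \<Sigma> q \<pi> \<longleftrightarrow>
    (\<forall>U. zariski_open n \<Sigma> U \<longrightarrow>
      (\<forall>s \<in> sections (power_preimage n \<Sigma> q U). \<pi> U s \<in> sections U) \<and>
      (\<forall>s \<in> sections (power_preimage n \<Sigma> q U). \<forall>t \<in> sections (power_preimage n \<Sigma> q U).
         \<pi> U (s + t) = \<pi> U s + \<pi> U t) \<and>
      (\<forall>a \<in> sections U. \<forall>s \<in> sections (power_preimage n \<Sigma> q U).
         \<pi> U (power_pullback q a * s) = a * \<pi> U s)) \<and>
    (\<forall>U V. zariski_open n \<Sigma> U \<and> zariski_open n \<Sigma> V \<and> V \<subseteq> U \<longrightarrow>
      (\<forall>s \<in> sections (power_preimage n \<Sigma> q U).
         \<pi> V (restr (power_preimage n \<Sigma> q V) s) = restr V (\<pi> U s)))"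

definition splitting ::
    "nat \<Rightarrow> rvec set set \<Rightarrow> nat \<Rightarrow>
     ('k::field ratfun set set \<Rightarrow> 'k ratfun \<Rightarrow> 'k ratfun) \<Rightarrow> bool" where
  "splitting n \<Sigma> q \<pi> \<longleftrightarrow>
    pushforward_hom n \<Sigma> q \<pi> \<and>
    (\<forall>U. zariski_open n \<Sigma> U \<longrightarrow> (\<forall>a \<in> sections U. \<pi> U (power_pullback q a) = a))"

definition compatible_with ::
    "nat \<Rightarrow> rvec set set \<Rightarrow> nat \<Rightarrow>
     ('k::field ratfun set set \<Rightarrow> 'k ratfun \<Rightarrow> 'k ratfun) \<Rightarrow> 'k ratfun set set \<Rightarrow> bool" where
  "compatible_with n \<Sigma> q \<pi> Z \<longleftrightarrow>
    (\<forall>U. zariski_open n \<Sigma> U \<longrightarrow>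
      (\<forall>s \<in> ideal_sections Z (power_preimage n \<Sigma> q U). \<pi> U s \<in> ideal_sections Z U))"

text \<open>
  The product \<open>X \<times> X\<close> is the toric variety of the fan \<open>\<Sigma> \<times> \<Sigma>\<close> in \<open>N \<times> N\<close>. The latter is identified
  with the lattice of rank \<open>2 n\<close> by taking the even-numbered coordinates for the first factor and the
  odd-numbered ones for the second.
\<close>

definition first_part :: "(nat \<Rightarrow>\<^sub>0 'a::zero) \<Rightarrow> (nat \<Rightarrow>\<^sub>0 'a)" where
  "first_part z = Poly_Mapping.map_key (\<lambda>i. 2 * i) z"

definition second_part :: "(nat \<Rightarrow>\<^sub>0 'a::zero) \<Rightarrow> (nat \<Rightarrow>\<^sub>0 'a)" where
  "second_part z = Poly_Mapping.map_key (\<lambda>i. 2 * i + 1) z"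

definition cone_product :: "rvec set \<Rightarrow> rvec set \<Rightarrow> rvec set" where
  "cone_product \<sigma> \<tau> = {z. first_part z \<in> \<sigma> \<and> second_part z \<in> \<tau>}"

definition fan_product :: "rvec set set \<Rightarrow> rvec set set \<Rightarrow> rvec set set" where
  "fan_product \<Sigma> \<Sigma>' = {cone_product \<sigma> \<tau> | \<sigma> \<tau>. \<sigma> \<in> \<Sigma> \<and> \<tau> \<in> \<Sigma>'}"

text \<open>
  The diagonal morphism \<open>X \<rightarrow> X \<times> X\<close> is induced by \<open>v \<mapsto> (v, v)\<close>, whose dual is
  \<open>(u, u') \<mapsto> u + u'\<close>; it maps the chart of \<open>\<sigma>\<close> to the chart of \<open>\<sigma> \<times> \<sigma>\<close>. The diagonal is its image.
\<close>

definition diagonal_map :: "'k::field laurent \<Rightarrow> 'k laurent" where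
  "diagonal_map = monomial_map (\<lambda>w. first_part w + second_part w)"

definition diagonal :: "nat \<Rightarrow> rvec set set \<Rightarrow> 'k::field ratfun set set" where
  "diagonal n \<Sigma> =
    {localisation (chart_ring (2 * n) (cone_product \<sigma> \<sigma>))
       {f \<in> carrier (chart_ring (2 * n) (cone_product \<sigma> \<sigma>)). diagonal_map f \<in> P} | \<sigma> P.
     \<sigma> \<in> \<Sigma> \<and> primeideal P (chart_ring n \<sigma>)}"

definition diagonally_split :: "'k::field itself \<Rightarrow> nat \<Rightarrow> rvec set set \<Rightarrow> nat \<Rightarrow> bool" where
  "diagonally_split TYPE('k) n \<Sigma> q \<longleftrightarrow>
    (\<exists>\<pi> :: 'k ratfun set set \<Rightarrow> 'k ratfun \<Rightarrow> 'k ratfun.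
       splitting (2 * n) (fan_product \<Sigma> \<Sigma>) q \<pi> \<and>
       compatible_with (2 * n) (fan_product \<Sigma> \<Sigma>) q \<pi> (diagonal n \<Sigma>))"

end

theory Submission
  imports Defs
begin

text \<open>
  Both properties are compared with Payne's condition: every class of \<open>M\<close> modulo \<open>q\<close> contains some \<open>w\<close>
  with \<open>|\<langle>w, v\<rangle>| < q\<close> for all \<open>v \<in> \<Sigma>(1)\<close>.

  Unimodularity gives the condition for every \<open>q\<close>, because a vertex of the polytope
  \<open>\<lfloor>\<langle>c, v\<rangle>\<rfloor> \<le> \<langle>m, v\<rangle> \<le> \<lceil>\<langle>c, v\<rangle>\<rceil>\<close> is integral on a maximal independent subset of \<open>\<Sigma>(1)\<close>, hence on \<open>N\<close>. For
  even \<open>q\<close> the condition at \<open>q\<close> implies the one at \<open>2\<close>. There, for a maximal independent set \<open>B\<close>, the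
  parities on \<open>B\<close> of the representatives realise all \<open>2\<^sup>n\<close> subsets of \<open>B\<close>; those of the singletons show
  that the dual basis of \<open>B\<close> lies in \<open>M\<close>, so \<open>B\<close> generates \<open>N\<close>.

  If \<open>W\<close> is a set of such representatives, then \<open>x\<^sup>u y\<^bsup>u'\<^esup> \<mapsto> \<Sum>w\<in>W. x\<^bsup>(u+w)/q\<^esup> y\<^bsup>(u'-w)/q\<^esup>\<close>, where terms with
  fractional exponents are dropped, is a splitting of \<open>X \<times> X\<close> that restricts to one of the diagonal.
  It extends to sections over arbitrary open sets since charts are integral over the image of \<open>F\<close>.
  Conversely, a splitting \<open>\<pi>\<close> compatible with the diagonal maps \<open>x\<^sup>u y\<^bsup>-u\<^esup> - 1\<close> into the ideal of the
  diagonal, so some \<open>x\<^sup>m y\<^bsup>-m\<^esup>\<close> occurs in \<open>\<pi>(x\<^sup>u y\<^bsup>-u\<^esup>)\<close>; as \<open>\<pi>\<close> is regular along the divisors of both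
  factors, \<open>u - q m\<close> is the required representative.
\<close>

section \<open>Lattices, pairings and cones\<close>

text \<open>The delicate point is that \<open>\<pi>\<close> must act on every Zariski open set,
  while the monomial formula makes sense on chart rings. It extends to fractions whose denominator
  is a pullback along \<open>F\<close>, so every section of the pushforward must locally have such a
  denominator. A section regular at all primes over \<open>P\<close> has an ideal of denominators
  contained in none of them. Were this ideal disjoint from the pullbacks of elements outside
  \<open>P\<close>, it would lie in a prime maximal with that property, and Nakayama's lemma forces
  such a prime to lie over \<open>P\<close>. The twists by \<open>w\<close> repair a defect of the
  untwisted map, which sends \<open>x^u y^{-u} - 1\<close> to \<open>-1\<close> unless
  \<open>q\<close> divides \<open>u\<close>. The strict bound by \<open>q\<close> keeps them
  regular: an integer that exceeds \<open>-q\<close> and is divisible by \<open>q\<close> is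
  nonnegative. Modulo 2 the bound leaves the values -1, 0, 1, so parity decides vanishing; this
  makes the passage from classes to subsets of \<open>B\<close> injective, and
  \<open>|B| \<le> n\<close> makes it onto.\<close>

lemma lookup_of_lat [simp]: "Poly_Mapping.lookup (of_lat v) i = real_of_int (Poly_Mapping.lookup v i)"
  by (simp add: of_lat_def map.rep_eq when_def)

lemma lookup_scaleR [simp]: "Poly_Mapping.lookup (c *\<^sub>R x) i = c *\<^sub>R Poly_Mapping.lookup x i"
proof -
  have "finite {i. c *\<^sub>R Poly_Mapping.lookup x i \<noteq> 0}"
    by (rule finite_subset[OF _ finite_keys[of x]]) (auto simp: in_keys_iff)
  then show ?thesis by (simp add: scaleR_poly_mapping_def)
qed

lemma of_lat_zero [simp]: "of_lat 0 = 0"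
  and of_lat_add: "of_lat (v + w) = of_lat v + of_lat w"
  and of_lat_diff: "of_lat (v - w) = of_lat v - of_lat w"
  and of_lat_frag_cmul: "of_lat (frag_cmul k v) = real_of_int k *\<^sub>R of_lat v"
  by (simp_all add: poly_mapping_eq_iff fun_eq_iff lookup_add lookup_minus)

lemma of_lat_sum: "of_lat (\<Sum>i\<in>I. f i) = (\<Sum>i\<in>I. of_lat (f i))"
  by (induction I rule: infinite_finite_induct) (auto simp: of_lat_add)

lemma of_lat_eq_iff [simp]: "of_lat v = of_lat w \<longleftrightarrow> v = w"
  by (simp add: poly_mapping_eq_iff fun_eq_iff)

lemma of_lat_eq_0_iff [simp]: "of_lat v = 0 \<longleftrightarrow> v = 0"
  by (simp add: poly_mapping_eq_iff fun_eq_iff)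

lemma int_lattice_iff: "v \<in> int_lattice n \<longleftrightarrow> (\<forall>i\<ge>n. Poly_Mapping.lookup v i = 0)"
  by (auto simp: int_lattice_def in_keys_iff subset_iff not_less[symmetric])

lemma real_space_iff: "x \<in> real_space n \<longleftrightarrow> (\<forall>i\<ge>n. Poly_Mapping.lookup x i = 0)"
  by (auto simp: real_space_def in_keys_iff subset_iff not_less[symmetric])

lemma int_lattice_zero [simp]: "0 \<in> int_lattice n"
  and int_lattice_add: "v \<in> int_lattice n \<Longrightarrow> w \<in> int_lattice n \<Longrightarrow> v + w \<in> int_lattice n"
  and int_lattice_diff: "v \<in> int_lattice n \<Longrightarrow> w \<in> int_lattice n \<Longrightarrow> v - w \<in> int_lattice n"
  and int_lattice_uminus: "v \<in> int_lattice n \<Longrightarrow> - v \<in> int_lattice n"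
  and int_lattice_frag_cmul: "v \<in> int_lattice n \<Longrightarrow> frag_cmul k v \<in> int_lattice n"
  by (simp_all add: int_lattice_iff lookup_add lookup_minus)

lemma int_lattice_frag_cmulD: "frag_cmul k v \<in> int_lattice n \<Longrightarrow> k \<noteq> 0 \<Longrightarrow> v \<in> int_lattice n"
  by (auto simp: int_lattice_iff)

lemma int_lattice_sum: "(\<And>i. i \<in> I \<Longrightarrow> f i \<in> int_lattice n) \<Longrightarrow> (\<Sum>i\<in>I. f i) \<in> int_lattice n"
  by (induction I rule: infinite_finite_induct) (auto intro: int_lattice_add)

lemma int_lattice_frag_of: "i < n \<Longrightarrow> frag_of i \<in> int_lattice n"
  by (auto simp: int_lattice_def keys_frag_of)

lemma of_lat_real_space_iff [simp]: "of_lat v \<in> real_space n \<longleftrightarrow> v \<in> int_lattice n"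
  by (simp add: real_space_iff int_lattice_iff)

lemma pairing_superset:
  assumes "finite T" "Poly_Mapping.keys u \<subseteq> T"
  shows "pairing u x = (\<Sum>i\<in>T. real_of_int (Poly_Mapping.lookup u i) * Poly_Mapping.lookup x i)"
  unfolding pairing_def using assms by (intro sum.mono_neutral_left) (auto simp: in_keys_iff)

lemma pairing_int_lattice:
  "u \<in> int_lattice n \<Longrightarrow>
    pairing u x = (\<Sum>i<n. real_of_int (Poly_Mapping.lookup u i) * Poly_Mapping.lookup x i)"
  by (rule pairing_superset) (auto simp: int_lattice_def)

lemma linear_pairing: "linear (pairing u)"
  by (rule linearI)
     (simp_all add: pairing_def lookup_add algebra_simps sum.distrib sum_distrib_left)

lemma pairing_zero_right [simp]: "pairing u 0 = 0"
  by (simp add: pairing_def)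

lemma pairing_frag_cmul: "pairing (frag_cmul k u) x = real_of_int k * pairing u x"
proof -
  have "Poly_Mapping.keys (frag_cmul k u) \<subseteq> Poly_Mapping.keys u" by (rule keys_cmul)
  then show ?thesis
    by (simp add: pairing_superset[of "Poly_Mapping.keys u"] sum_distrib_left mult.assoc)
qed

lemma pairing_uminus: "pairing (- u) x = - pairing u x"
  using pairing_frag_cmul[of "-1" u x] by simp

lemma pairing_diff: "pairing (u - v) x = pairing u x - pairing v x"
  using pairing_add[of "u - v" v x] by simp

definition int_pairing :: "lat \<Rightarrow> lat \<Rightarrow> int" where
  "int_pairing u v = (\<Sum>i\<in>Poly_Mapping.keys u. Poly_Mapping.lookup u i * Poly_Mapping.lookup v i)"

lemma pairing_of_lat: "pairing u (of_lat v) = real_of_int (int_pairing u v)"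
  by (simp add: pairing_def int_pairing_def)

lemma int_pairing_add: "int_pairing (u + v) w = int_pairing u w + int_pairing v w"
  and int_pairing_diff: "int_pairing (u - v) w = int_pairing u w - int_pairing v w"
  and int_pairing_uminus: "int_pairing (- u) w = - int_pairing u w"
  and int_pairing_frag_cmul: "int_pairing (frag_cmul k u) w = k * int_pairing u w"
  using pairing_add[of u v "of_lat w"] pairing_diff[of u v "of_lat w"] pairing_uminus[of u "of_lat w"]
    pairing_frag_cmul[of k u "of_lat w"]
  by (simp_all add: pairing_of_lat flip: of_int_add of_int_diff of_int_minus of_int_mult)

lemma int_pairing_zero_left [simp]: "int_pairing 0 w = 0"
  by (simp add: int_pairing_def)

lemma int_pairing_frag_of [simp]: "int_pairing (frag_of i) v = Poly_Mapping.lookup v i"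
  by (simp add: int_pairing_def keys_frag_of)

lemma pairing_scaleR: "pairing u (c *\<^sub>R x) = c * pairing u x"
  using linear_scale[OF linear_pairing] by simp

section \<open>Generators of rational cones\<close>

lemma convex_cone_hull_finiteE:
  assumes "finite S" "x \<in> convex_cone hull S"
  obtains c where "\<And>s. 0 \<le> c s" "x = (\<Sum>s\<in>S. c s *\<^sub>R s)"
proof -
  let ?C = "{\<Sum>s\<in>S. c s *\<^sub>R s | c. \<forall>s. 0 \<le> (c s :: real)}"
  have "convex_cone hull S \<subseteq> ?C"
  proof (rule hull_minimal)
    show "S \<subseteq> ?C"
    proof
      fix s assume "s \<in> S"
      with assms(1) have "s = (\<Sum>r\<in>S. (if r = s then 1 else 0) *\<^sub>R r)"
        by (simp add: if_distrib[of "\<lambda>c. c *\<^sub>R _"] cong: if_cong)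
      then show "s \<in> ?C" by force
    qed
    show "convex_cone ?C"
      unfolding convex_cone_iff
    proof (intro conjI ballI allI impI)
      show "0 \<in> ?C" by (intro CollectI exI[of _ "\<lambda>_. 0"]) auto
      fix x assume "x \<in> ?C"
      then obtain a where a: "x = (\<Sum>s\<in>S. a s *\<^sub>R s)" "\<forall>s. 0 \<le> a s" by blast
      { fix y assume "y \<in> ?C"
        then obtain b where b: "y = (\<Sum>s\<in>S. b s *\<^sub>R s)" "\<forall>s. 0 \<le> b s" by blast
        show "x + y \<in> ?C"
          using a b by (intro CollectI exI[of _ "\<lambda>s. a s + b s"])
            (auto simp: scaleR_add_left sum.distrib) }
      { fix c :: real assume "0 \<le> c"
        then show "c *\<^sub>R x \<in> ?C"
          using a by (intro CollectI exI[of _ "\<lambda>s. c * a s"]) (auto simp: scaleR_sum_right) }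
    qed
  qed
  then show thesis using assms(2) that by blast
qed

lemma convex_cone_hull_sum:
  assumes "\<And>s. s \<in> T \<Longrightarrow> s \<in> convex_cone hull S" "\<And>s. s \<in> T \<Longrightarrow> 0 \<le> c s"
  shows "(\<Sum>s\<in>T. c s *\<^sub>R s) \<in> convex_cone hull S"
  using assms
  by (induction T rule: infinite_finite_induct)
     (auto simp: convex_cone_hull_contains_0 intro!: convex_cone_hull_add convex_cone_hull_mul)

text \<open>
  If \<open>s\<close> does not lie in the cone spanned by the other generators, a combination of the generators
  that lies on the ray of \<open>s\<close> involves no other generator.
\<close>

lemma ray_face_of_hull:
  fixes S :: "rvec set"
  assumes "finite S" "0 \<notin> S" "s \<in> S" and s: "s \<notin> convex_cone hull (S - {s})"
    and pointed: "\<And>x. x \<in> convex_cone hull S \<Longrightarrow> - x \<in> convex_cone hull S \<Longrightarrow> x = 0"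
  shows "ray s face_of (convex_cone hull S)"
  unfolding face_of_def
proof (intro conjI ballI impI)
  let ?C = "convex_cone hull S"
  have "s \<in> ?C" using \<open>s \<in> S\<close> by (rule hull_inc)
  then show "ray s \<subseteq> ?C" by (auto simp: ray_def intro: convex_cone_hull_mul)
  show "convex (ray s)"
  proof (rule convexI)
    fix x y and a b :: real
    assume "x \<in> ray s" "y \<in> ray s" "0 \<le> a" "0 \<le> b"
    then obtain c d where cd: "x = c *\<^sub>R s" "y = d *\<^sub>R s" "0 \<le> c" "0 \<le> d" by (auto simp: ray_def)
    show "a *\<^sub>R x + b *\<^sub>R y \<in> ray s"
      using cd \<open>0 \<le> a\<close> \<open>0 \<le> b\<close> unfolding ray_def
      by (intro CollectI exI[of _ "a * c + b * d"]) (auto simp: scaleR_add_left)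
  qed
  fix a b x
  assume a: "a \<in> ?C" and b: "b \<in> ?C" and x: "x \<in> ray s" and seg: "x \<in> open_segment a b"
  obtain t where t: "x = t *\<^sub>R s" "0 \<le> t" using x by (auto simp: ray_def)
  obtain l where l: "0 < l" "l < 1" "x = (1 - l) *\<^sub>R a + l *\<^sub>R b"
    using seg by (auto simp: in_segment)
  obtain \<alpha> where \<alpha>: "\<And>s. 0 \<le> \<alpha> s" "a = (\<Sum>s\<in>S. \<alpha> s *\<^sub>R s)"
    using convex_cone_hull_finiteE[OF assms(1) a] by metis
  obtain \<beta> where \<beta>: "\<And>s. 0 \<le> \<beta> s" "b = (\<Sum>s\<in>S. \<beta> s *\<^sub>R s)"
    using convex_cone_hull_finiteE[OF assms(1) b] by metis
  define \<gamma> where "\<gamma> = (\<lambda>s. (1 - l) * \<alpha> s + l * \<beta> s)"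
  have \<gamma>: "0 \<le> \<gamma> s" for s using l \<alpha>(1) \<beta>(1) by (simp add: \<gamma>_def)
  have "x = (\<Sum>s\<in>S. \<gamma> s *\<^sub>R s)"
    unfolding l(3) \<alpha>(2) \<beta>(2) \<gamma>_def scaleR_sum_right by (simp add: scaleR_add_left sum.distrib)
  also have "\<dots> = \<gamma> s *\<^sub>R s + (\<Sum>r\<in>S - {s}. \<gamma> r *\<^sub>R r)"
    using assms(1) \<open>s \<in> S\<close> by (simp add: sum.remove)
  finally have eq: "(t - \<gamma> s) *\<^sub>R s = (\<Sum>r\<in>S - {s}. \<gamma> r *\<^sub>R r)"
    using t by (simp add: scaleR_diff_left algebra_simps)
  have rest: "(\<Sum>r\<in>S - {s}. \<gamma> r *\<^sub>R r) \<in> convex_cone hull (S - {s})"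
    using \<gamma> by (intro convex_cone_hull_sum) (auto intro: hull_inc)
  \<comment> \<open>If \<open>t\<close> exceeded the coefficient of \<open>s\<close>, the remaining
    terms would produce \<open>s\<close> itself, against irredundancy.\<close>
  have le: "t \<le> \<gamma> s"
  proof (rule ccontr)
    assume "\<not> t \<le> \<gamma> s"
    then have "s = inverse (t - \<gamma> s) *\<^sub>R (\<Sum>r\<in>S - {s}. \<gamma> r *\<^sub>R r)"
      by (simp flip: eq)
    also have "\<dots> \<in> convex_cone hull (S - {s})"
      using \<open>\<not> t \<le> \<gamma> s\<close> by (intro convex_cone_hull_mul rest) simp
    finally show False using s by simp
  qed
  \<comment> \<open>Each remaining term lies in the cone together with its negative, so pointedness
    kills it.\<close>
  have zero: "\<gamma> r = 0" if r: "r \<in> S - {s}" for r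
  proof -
    have "- (\<gamma> r *\<^sub>R r) = (\<gamma> s - t) *\<^sub>R s + (\<Sum>r\<in>S - {s} - {r}. \<gamma> r *\<^sub>R r)"
      using eq r assms(1) by (simp add: sum.remove[of "S - {s}" r] algebra_simps)
    also have "\<dots> \<in> ?C"
      using le \<gamma> \<open>s \<in> ?C\<close>
      by (intro convex_cone_hull_add convex_cone_hull_mul convex_cone_hull_sum) (auto intro: hull_inc)
    finally have "- (\<gamma> r *\<^sub>R r) \<in> ?C" .
    moreover have "\<gamma> r *\<^sub>R r \<in> ?C" using r \<gamma> by (intro convex_cone_hull_mul) (auto intro: hull_inc)
    ultimately have "\<gamma> r *\<^sub>R r = 0" by (rule pointed[rotated])
    then show ?thesis using r assms(2) by auto
  qed
  have ab: "\<alpha> r = 0 \<and> \<beta> r = 0" if "r \<in> S - {s}" for r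
    using zero[OF that] l \<alpha>(1)[of r] \<beta>(1)[of r] unfolding \<gamma>_def
    by (metis add_nonneg_eq_0_iff diff_gt_0_iff_gt less_eq_real_def mult_eq_0_iff mult_nonneg_nonneg
        order_less_irrefl)
  have "a = \<alpha> s *\<^sub>R s" "b = \<beta> s *\<^sub>R s"
    unfolding \<alpha>(2) \<beta>(2) using ab assms(1) \<open>s \<in> S\<close> by (simp_all add: sum.remove[of S s])
  then show "a \<in> ray s" "b \<in> ray s" using \<alpha>(1) \<beta>(1) by (auto simp: ray_def)
qed

lemma ray_scaleR: "0 < c \<Longrightarrow> ray (c *\<^sub>R x) = ray x"
  unfolding ray_def
proof safe
  fix t :: real assume "0 < c" "0 \<le> t"
  then show "\<exists>t'. t *\<^sub>R c *\<^sub>R x = t' *\<^sub>R x \<and> 0 \<le> t'" by (intro exI[of _ "t * c"]) simp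
  show "\<exists>t'. t *\<^sub>R x = t' *\<^sub>R c *\<^sub>R x \<and> 0 \<le> t'"
    using \<open>0 < c\<close> \<open>0 \<le> t\<close> by (intro exI[of _ "t / c"]) simp
qed

text \<open>Among the nonzero lattice points of the ray, take one whose \<open>i\<close>-th
  coordinate is smallest in absolute value, where \<open>s\<close> has a nonzero \<open>i\<close>-th
  coordinate. Removing the integral part of a multiple leaves a smaller lattice point, which must be
  0.\<close>

lemma primitive_exists:
  assumes "s \<in> int_lattice n" "s \<noteq> 0"
  obtains v where "v \<in> int_lattice n" "v \<noteq> 0" "ray (of_lat v) = ray (of_lat s)"
    "\<And>w. w \<in> int_lattice n \<Longrightarrow> of_lat w \<in> ray (of_lat v) \<Longrightarrow> \<exists>k::nat. w = frag_cmul (int k) v"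
proof -
  let ?P = "\<lambda>v. v \<in> int_lattice n \<and> v \<noteq> 0 \<and> of_lat v \<in> ray (of_lat s)"
  obtain i where i: "Poly_Mapping.lookup s i \<noteq> 0"
    using assms(2) by (auto simp: poly_mapping_eq_iff fun_eq_iff)
  let ?m = "\<lambda>v. nat \<bar>Poly_Mapping.lookup v i\<bar>"
  have "of_lat s \<in> ray (of_lat s)" by (auto simp: ray_def intro: exI[of _ 1])
  then have "?P s" using assms by simp
  then obtain v where v: "?P v" and min: "\<And>w. ?P w \<Longrightarrow> ?m v \<le> ?m w"
    using ex_has_least_nat[of ?P s ?m] by blast
  obtain c where c: "of_lat v = c *\<^sub>R of_lat s" "0 \<le> c" using v by (auto simp: ray_def)
  have "c > 0" using c v by (cases "c = 0") auto
  have vs: "ray (of_lat v) = ray (of_lat s)" using ray_scaleR[OF \<open>c > 0\<close>] c by simp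
  have vi: "Poly_Mapping.lookup v i \<noteq> 0"
  proof -
    have "real_of_int (Poly_Mapping.lookup v i) = c * real_of_int (Poly_Mapping.lookup s i)"
      using arg_cong[OF c(1), of "\<lambda>x. Poly_Mapping.lookup x i"] by simp
    then show ?thesis using i \<open>c > 0\<close> by auto
  qed
  have "\<exists>k::nat. w = frag_cmul (int k) v" if w: "w \<in> int_lattice n" "of_lat w \<in> ray (of_lat v)" for w
  proof -
    obtain t where t: "of_lat w = t *\<^sub>R of_lat v" "0 \<le> t" using w by (auto simp: ray_def)
    define r where "r = w - frag_cmul \<lfloor>t\<rfloor> v"
    have r: "of_lat r = (t - \<lfloor>t\<rfloor>) *\<^sub>R of_lat v"
      using t by (simp add: r_def of_lat_diff of_lat_frag_cmul scaleR_diff_left)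
    have "r = 0"
    proof (rule ccontr)
      assume "r \<noteq> 0"
      have "of_lat r \<in> ray (of_lat v)" unfolding r ray_def by auto
      then have "?P r" using \<open>r \<noteq> 0\<close> w v vs by (auto simp: r_def intro: int_lattice_diff int_lattice_frag_cmul)
      from min[OF this] have "\<bar>Poly_Mapping.lookup v i\<bar> \<le> \<bar>Poly_Mapping.lookup r i\<bar>" by simp
      moreover have "real_of_int (Poly_Mapping.lookup r i) = (t - \<lfloor>t\<rfloor>) * real_of_int (Poly_Mapping.lookup v i)"
        using arg_cong[OF r, of "\<lambda>x. Poly_Mapping.lookup x i"] by simp
      then have "real_of_int \<bar>Poly_Mapping.lookup r i\<bar> = (t - \<lfloor>t\<rfloor>) * \<bar>real_of_int (Poly_Mapping.lookup v i)\<bar>"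
        by (simp add: abs_mult)
      moreover have "(t - \<lfloor>t\<rfloor>) * \<bar>real_of_int (Poly_Mapping.lookup v i)\<bar> < 1 * \<bar>real_of_int (Poly_Mapping.lookup v i)\<bar>"
        using vi by (intro mult_strict_right_mono) (auto, linarith)
      ultimately show False by linarith
    qed
    then have "w = frag_cmul (int (nat \<lfloor>t\<rfloor>)) v" using t by (simp add: r_def)
    then show ?thesis ..
  qed
  with v vs that show thesis by blast
qed

lemma primitive_generators_in_lattice: "v \<in> primitive_generators n \<Sigma> \<Longrightarrow> v \<in> int_lattice n"
  by (simp add: primitive_generators_def)

text \<open>A generating set of least cardinality is irredundant, so each of its members spans an
  extreme ray. Such a ray is a face, hence a cone of the fan, and carries a primitive
  generator.\<close>

lemma fan_cone_generated:
  assumes "fan n \<Sigma>" "\<sigma> \<in> \<Sigma>" "x \<in> \<sigma>"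
  shows "x \<in> convex_cone hull (of_lat ` {v \<in> primitive_generators n \<Sigma>. of_lat v \<in> \<sigma>})"
proof -
  let ?P = "\<lambda>S. finite S \<and> S \<subseteq> int_lattice n \<and> \<sigma> = convex_cone hull (of_lat ` S)"
  have sc: "strongly_convex_rational_cone n \<sigma>" using assms by (auto simp: fan_def)
  then obtain S0 where "?P S0" unfolding strongly_convex_rational_cone_def by blast
  then obtain S where S: "?P S" and min: "\<And>T. ?P T \<Longrightarrow> card S \<le> card T"
    using ex_has_least_nat[of ?P S0 card] by blast
  have irred: "of_lat s \<notin> convex_cone hull (of_lat ` S - {of_lat s})" if "s \<in> S" for s
  proof
    assume "of_lat s \<in> convex_cone hull (of_lat ` S - {of_lat s})"
    then have "convex_cone hull (insert (of_lat s) (of_lat ` S - {of_lat s})) = convex_cone hull (of_lat ` S - {of_lat s})"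
      by (rule hull_redundant)
    moreover have "insert (of_lat s) (of_lat ` S - {of_lat s}) = of_lat ` S"
      and "of_lat ` S - {of_lat s} = of_lat ` (S - {s})" using that by auto
    ultimately have "?P (S - {s})" using S by auto
    from min[OF this] show False using that S by (meson card_Diff1_less leD)
  qed
  have "0 \<notin> of_lat ` S"
  proof
    assume "0 \<in> of_lat ` S"
    with irred show False using convex_cone_hull_contains_0 by fastforce
  qed
  have "of_lat s \<in> convex_cone hull (of_lat ` {v \<in> primitive_generators n \<Sigma>. of_lat v \<in> \<sigma>})"
    if s: "s \<in> S" for s
  proof -
    have "ray (of_lat s) face_of \<sigma>"
      using ray_face_of_hull[of "of_lat ` S" "of_lat s"] S s irred[OF s] sc \<open>0 \<notin> of_lat ` S\<close>
      unfolding strongly_convex_rational_cone_def by auto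
    moreover have self: "of_lat s \<in> ray (of_lat s)" by (auto simp: ray_def intro: exI[of _ 1])
    ultimately have ray: "ray (of_lat s) \<in> \<Sigma>" "ray (of_lat s) \<subseteq> \<sigma>"
      using assms by (auto simp: fan_def dest: face_of_imp_subset)
    have "s \<in> int_lattice n" "s \<noteq> 0" using s S \<open>0 \<notin> of_lat ` S\<close> by force+
    then obtain v where v: "v \<in> int_lattice n" "v \<noteq> 0" "ray (of_lat v) = ray (of_lat s)"
      "\<And>w. w \<in> int_lattice n \<Longrightarrow> of_lat w \<in> ray (of_lat v) \<Longrightarrow> \<exists>k::nat. w = frag_cmul (int k) v"
      using primitive_exists by metis
    have "of_lat v \<in> ray (of_lat v)" by (auto simp: ray_def intro: exI[of _ 1])
    then have "v \<in> {v \<in> primitive_generators n \<Sigma>. of_lat v \<in> \<sigma>}"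
      using v ray by (auto simp: primitive_generators_def)
    moreover obtain t where "of_lat s = t *\<^sub>R of_lat v" "0 \<le> t"
      using self v(3) by (auto simp: ray_def)
    ultimately show ?thesis by (simp add: convex_cone_hull_mul hull_inc)
  qed
  then have "convex_cone hull (of_lat ` S) \<subseteq> convex_cone hull (of_lat ` {v \<in> primitive_generators n \<Sigma>. of_lat v \<in> \<sigma>})"
    by (intro hull_minimal) (auto simp: convex_cone_convex_cone_hull)
  then show ?thesis using S assms(3) by auto
qed

text \<open>The half-space of \<open>u\<close> is a convex cone, so it contains a cone once it
  contains its generators. Regularity on a chart thereby becomes a condition on the rays.\<close>

lemma fan_pairing_nonneg:
  assumes "fan n \<Sigma>" "\<sigma> \<in> \<Sigma>" "x \<in> \<sigma>"
    and "\<And>v. v \<in> primitive_generators n \<Sigma> \<Longrightarrow> of_lat v \<in> \<sigma> \<Longrightarrow> 0 \<le> pairing u (of_lat v)"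
  shows "0 \<le> pairing u x"
proof -
  have "convex_cone hull (of_lat ` {v \<in> primitive_generators n \<Sigma>. of_lat v \<in> \<sigma>}) \<subseteq> {x. 0 \<le> pairing u x}"
    using assms(4)
    by (intro hull_minimal)
       (auto simp: convex_cone_iff linear_add[OF linear_pairing] pairing_scaleR)
  then show ?thesis using fan_cone_generated[OF assms(1-3)] by auto
qed

text \<open>Completeness enters here: every point lies in some cone, and each cone lies in the span
  of its rays.\<close>

lemma complete_fan_span:
  assumes "complete_fan n \<Sigma>"
  shows "span (of_lat ` primitive_generators n \<Sigma>) = real_space n"
proof
  have "subspace (real_space n)"
    by (auto simp: subspace_def real_space_iff lookup_add)
  then show "span (of_lat ` primitive_generators n \<Sigma>) \<subseteq> real_space n"
    by (intro span_minimal) (auto dest: primitive_generators_in_lattice)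
  show "real_space n \<subseteq> span (of_lat ` primitive_generators n \<Sigma>)"
  proof
    fix x assume "x \<in> real_space n"
    then obtain \<sigma> where "\<sigma> \<in> \<Sigma>" "x \<in> \<sigma>" "fan n \<Sigma>" using assms by (auto simp: complete_fan_def)
    then have "x \<in> convex_cone hull (of_lat ` {v \<in> primitive_generators n \<Sigma>. of_lat v \<in> \<sigma>})"
      by (intro fan_cone_generated)
    also have "\<dots> \<subseteq> span (of_lat ` primitive_generators n \<Sigma>)"
      by (intro hull_minimal) (auto simp: convex_cone_span intro: span_base)
    finally show "x \<in> span (of_lat ` primitive_generators n \<Sigma>)" .
  qed
qed

text \<open>Two primitive generators of one ray are natural multiples of each other, and the factors
  have product 1; so the generators inject into the cones.\<close>

lemma finite_primitive_generators:
  assumes "fan n \<Sigma>"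
  shows "finite (primitive_generators n \<Sigma>)"
proof (rule inj_on_finite)
  show "(\<lambda>v. ray (of_lat v)) ` primitive_generators n \<Sigma> \<subseteq> \<Sigma>"
    by (auto simp: primitive_generators_def)
  show "finite \<Sigma>" using assms by (simp add: fan_def)
  show "inj_on (\<lambda>v. ray (of_lat v)) (primitive_generators n \<Sigma>)"
  proof (rule inj_onI)
    fix v w assume *: "v \<in> primitive_generators n \<Sigma>" "w \<in> primitive_generators n \<Sigma>"
      "ray (of_lat v) = ray (of_lat w)"
    have self: "of_lat x \<in> ray (of_lat x)" for x by (auto simp: ray_def intro: exI[of _ 1])
    obtain k l :: nat where kl: "v = frag_cmul (int k) w" "w = frag_cmul (int l) v"
      using * self[of v] self[of w] unfolding primitive_generators_def by fastforce
    then have "frag_cmul (int k * int l - 1) v = 0"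
      by (metis frag_cmul_cmul frag_cmul_diff_distrib frag_cmul_one right_minus_eq)
    then have "int k * int l = 1" using * by (auto simp: primitive_generators_def)
    then have "k = 1" by (simp add: zmult_eq_1_iff)
    then show "v = w" using kl by simp
  qed
qed

text \<open>Strong convexity makes the apex a face: if 0 lies inside a segment of the cone, a
  positive multiple of one endpoint is minus one of the other. This cone supplies the torus
  chart.\<close>

lemma fan_zero_cone:
  assumes "fan n \<Sigma>"
  shows "{0} \<in> \<Sigma>"
proof -
  obtain \<sigma> where \<sigma>: "\<sigma> \<in> \<Sigma>" using assms by (auto simp: fan_def)
  then have sc: "strongly_convex_rational_cone n \<sigma>" using assms by (auto simp: fan_def)
  then obtain S where S: "\<sigma> = convex_cone hull S" unfolding strongly_convex_rational_cone_def by blast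
  have cone: "convex_cone \<sigma>" unfolding S by (rule convex_cone_convex_cone_hull)
  have "{0} face_of \<sigma>"
    unfolding face_of_def
  proof (intro conjI ballI impI)
    show "{0} \<subseteq> \<sigma>" using convex_cone_contains_0[OF cone] by simp
    fix a b x assume ab: "a \<in> \<sigma>" "b \<in> \<sigma>" and "x \<in> {0}" "x \<in> open_segment a b"
    then obtain l where l: "0 < l" "l < 1" "(1 - l) *\<^sub>R a = - (l *\<^sub>R b)" "a \<noteq> b"
      by (auto simp: in_segment eq_neg_iff_add_eq_0)
    have "l *\<^sub>R b \<in> \<sigma>" using ab l by (simp add: convex_cone_scaleR[OF cone])
    moreover have "(1 - l) *\<^sub>R a \<in> \<sigma>" using ab l(1,2) by (intro convex_cone_scaleR[OF cone]) auto
    ultimately have "l *\<^sub>R b = 0" using sc l(3) unfolding strongly_convex_rational_cone_def by metis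
    then show "a \<in> {0}" "b \<in> {0}" using l by auto
  qed auto
  then show ?thesis using assms \<sigma> by (auto simp: fan_def)
qed

lemma fan_zero_mem:
  assumes "fan n \<Sigma>" "\<sigma> \<in> \<Sigma>"
  shows "0 \<in> \<sigma>"
  using assms by (auto simp: fan_def strongly_convex_rational_cone_def convex_cone_hull_contains_0)

section \<open>Unimodularity and representatives modulo \<open>q\<close>\<close>

text \<open>Payne's condition on the polytope \<open>F\<^sub>\<Sigma>\<close>, scaled by \<open>q\<close>.\<close>

definition small_representatives :: "nat \<Rightarrow> lat set \<Rightarrow> nat \<Rightarrow> bool" where
  "small_representatives n S q \<longleftrightarrow>
    (\<forall>u\<in>int_lattice n. \<exists>k\<in>int_lattice n. \<forall>v\<in>S. \<bar>int_pairing (u + frag_cmul (int q) k) v\<bar> < int q)"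

lemma lat_expansion:
  assumes "x \<in> int_lattice n"
  shows "x = (\<Sum>i<n. frag_cmul (Poly_Mapping.lookup x i) (frag_of i))"
  by (rule poly_mapping_eqI)
     (use assms in \<open>auto simp: lookup_sum lookup_frag_of int_lattice_iff if_distrib cong: if_cong\<close>)

text \<open>
  The points \<open>m\<close> of the dual space with \<open>\<lfloor>c v\<rfloor> \<le> m v \<le> \<lceil>c v\<rceil>\<close> for all \<open>v \<in> S\<close> form a polytope, and at
  a vertex of it the \<open>v\<close> with \<open>m v\<close> integral span. A vertex is found as a point that is integral on as
  many \<open>v\<close> as possible.
\<close>

lemma integral_on_spanning_subset:
  fixes S :: "'a::real_vector set" and c :: "'a \<Rightarrow> real"
  assumes "finite S" "linear c"
  obtains m :: "'a \<Rightarrow> real" where "linear m" "\<And>v. v \<in> S \<Longrightarrow> of_int \<lfloor>c v\<rfloor> \<le> m v \<and> m v \<le> of_int \<lceil>c v\<rceil>"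
    "S \<subseteq> span {v \<in> S. m v \<in> \<int>}"
proof -
  let ?F = "\<lambda>m :: 'a \<Rightarrow> real. linear m \<and> (\<forall>v\<in>S. of_int \<lfloor>c v\<rfloor> \<le> m v \<and> m v \<le> of_int \<lceil>c v\<rceil>)"
  let ?T = "\<lambda>m :: 'a \<Rightarrow> real. {v \<in> S. m v \<in> \<int>}"
  have "?F c" using assms(2) by auto
  then obtain m where m: "?F m" and max: "\<And>m'. ?F m' \<Longrightarrow> card (S - ?T m) \<le> card (S - ?T m')"
    using ex_has_least_nat[of ?F c "\<lambda>m. card (S - ?T m)"] by blast
  have "S \<subseteq> span (?T m)"
  proof (rule ccontr)
    assume "\<not> S \<subseteq> span (?T m)"
    then obtain v0 where v0: "v0 \<in> S" "v0 \<notin> span (?T m)" by blast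
    obtain B where B: "B \<subseteq> ?T m" "independent B" "?T m \<subseteq> span B"
      using maximal_independent_subset by blast
    have "span B = span (?T m)"
      using B by (intro antisym span_mono span_minimal) auto
    then have "v0 \<notin> span B" using v0 by simp
    then have "independent (insert v0 B)" "v0 \<notin> B"
      using B(2) by (auto simp: independent_insert intro: span_base)
    \<comment> \<open>A direction that vanishes where \<open>m\<close> is already integral but not
      at \<open>v0\<close>, so moving along it loses no integral value.\<close>
    then obtain d where d: "linear d" "\<forall>x\<in>insert v0 B. d x = (if x = v0 then 1 else (0::real))"
      using linear_independent_extend[of "insert v0 B" "\<lambda>x. if x = v0 then 1 else (0::real)"] by blast
    have d0: "d v0 = 1" using d by simp
    have dT: "d v = 0" if "v \<in> ?T m" for v
    proof (rule linear_eq_0_on_span[OF d(1)])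
      show "v \<in> span B" using that B by auto
      show "d x = 0" if "x \<in> B" for x using d that \<open>v0 \<notin> B\<close> by auto
    qed
    define R where "R = {v \<in> S. d v \<noteq> 0}"
    have R: "finite R" "R \<noteq> {}" using assms(1) v0 d0 by (auto simp: R_def)
    \<comment> \<open>\<open>t v\<close> is the step length at which the value at \<open>v\<close>
      reaches the next integer in the direction of motion. The smallest such step gains an integral
      value before any value leaves its unit interval.\<close>
    define t where "t = (\<lambda>v. (if d v > 0 then of_int \<lceil>m v\<rceil> - m v else of_int \<lfloor>m v\<rfloor> - m v) / d v)"
    have nonint: "m v \<notin> \<int>" if "v \<in> R" for v using dT[of v] that by (auto simp: R_def)
    have tpos: "0 \<le> t v" if "v \<in> R" for v
      using that by (auto simp: t_def R_def intro!: divide_nonneg_nonneg divide_nonpos_nonpos)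
    define t0 where "t0 = Min (t ` R)"
    have t0: "0 \<le> t0" "\<And>v. v \<in> R \<Longrightarrow> t0 \<le> t v" using R tpos by (auto simp: t0_def)
    have "t0 \<in> t ` R" unfolding t0_def using R by (intro Min_in) auto
    then obtain v1 where v1: "v1 \<in> R" "t v1 = t0" by auto
    define m' where "m' = (\<lambda>x. m x + t0 * d x)"
    have between: "of_int \<lfloor>m v\<rfloor> \<le> m' v \<and> m' v \<le> of_int \<lceil>m v\<rceil>" if "v \<in> S" for v
    proof (cases "d v = 0")
      case False
      then have "v \<in> R" using that by (simp add: R_def)
      note le = t0(2)[OF this]
      show ?thesis
      proof (cases "d v > 0")
        case True
        then have "t0 * d v \<le> of_int \<lceil>m v\<rceil> - m v" "0 \<le> t0 * d v"
          using le t0(1) by (simp_all add: t_def field_simps)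
        then show ?thesis unfolding m'_def by linarith
      next
        case neg: False
        then have "of_int \<lfloor>m v\<rfloor> - m v \<le> t0 * d v" "t0 * d v \<le> 0"
          using le t0(1) False by (simp_all add: t_def field_simps mult_le_0_iff)
        then show ?thesis unfolding m'_def by linarith
      qed
    qed (simp add: m'_def)
    have "?F m'"
    proof (intro conjI ballI)
      show "linear m'"
        unfolding m'_def using m d(1) linear_compose_scale_right[of d t0]
        by (intro linear_compose_add) simp_all
      fix v assume v: "v \<in> S"
      have "\<lfloor>c v\<rfloor> \<le> \<lfloor>m v\<rfloor>" "\<lceil>m v\<rceil> \<le> \<lceil>c v\<rceil>" using m v by (auto simp: le_floor_iff ceiling_le_iff)
      then show "of_int \<lfloor>c v\<rfloor> \<le> m' v" "m' v \<le> of_int \<lceil>c v\<rceil>" using between[OF v] by linarith+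
    qed
    moreover have "?T m \<subset> ?T m'"
    proof
      show "?T m \<subseteq> ?T m'" using dT by (auto simp: m'_def)
      have "t0 * d v1 = (if d v1 > 0 then of_int \<lceil>m v1\<rceil> - m v1 else of_int \<lfloor>m v1\<rfloor> - m v1)"
        using v1 by (auto simp: t_def R_def)
      then have "m' v1 \<in> \<int>" by (auto simp: m'_def)
      then show "?T m \<noteq> ?T m'" using v1 nonint[OF v1(1)] by (auto simp: R_def)
    qed
    ultimately have "card (S - ?T m) \<le> card (S - ?T m')" "S - ?T m' \<subset> S - ?T m" using max by auto
    then show False using assms(1) psubset_card_mono[of "S - ?T m" "S - ?T m'"] by simp
  qed
  with m that show thesis by blast
qed

text \<open>Rounding \<open>c = -u/q\<close> changes each value on \<open>S\<close> by less than 1;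
  multiplied by \<open>q\<close>, this is the bound for \<open>u + q k\<close> with \<open>k\<close>
  the rounded functional. Unimodularity makes that functional a lattice point.\<close>

lemma unimodular_imp_small_representatives:
  assumes "finite S" "S \<subseteq> int_lattice n" "unimodular n S" "q > 0"
  shows "small_representatives n S q"
  unfolding small_representatives_def
proof
  fix u assume u: "u \<in> int_lattice n"
  define c where "c = (\<lambda>x. - (pairing u x) / real q)"
  have "linear c"
    by (rule linearI) (simp_all add: c_def linear_add[OF linear_pairing] pairing_scaleR add_divide_distrib)
  obtain m :: "rvec \<Rightarrow> real" where m: "linear m"
    "\<And>v. v \<in> of_lat ` S \<Longrightarrow> of_int \<lfloor>c v\<rfloor> \<le> m v \<and> m v \<le> of_int \<lceil>c v\<rceil>"
    "of_lat ` S \<subseteq> span {v \<in> of_lat ` S. m v \<in> \<int>}"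
    by (rule integral_on_spanning_subset[OF finite_imageI[OF assms(1), of of_lat] \<open>linear c\<close>]) blast
  obtain C where C: "C \<subseteq> {v \<in> of_lat ` S. m v \<in> \<int>}" "independent C" "{v \<in> of_lat ` S. m v \<in> \<int>} \<subseteq> span C"
    using maximal_independent_subset by blast
  define B where "B = {v \<in> S. of_lat v \<in> C}"
  have B_sub: "B \<subseteq> S" by (auto simp: B_def)
  have BC: "of_lat ` B = C" using C(1) by (auto simp: B_def)
  have SC: "of_lat ` S \<subseteq> span C"
    using m(3) C(3) by (meson order_trans span_minimal subspace_span)
  have "int_span B = int_lattice n"
  proof -
    have "lin_indep B" using C(2) BC by (simp add: lin_indep_def)
    moreover have "B' = B" if B': "B \<subseteq> B'" "B' \<subseteq> S" "lin_indep B'" for B'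
    proof (rule ccontr)
      assume "B' \<noteq> B"
      then obtain v where v: "v \<in> B'" "v \<notin> B" using B' by blast
      have "of_lat v \<in> span C" using v B' SC by blast
      also have "span C \<subseteq> span (of_lat ` B' - {of_lat v})"
        using v B' unfolding BC[symmetric] by (intro span_mono) auto
      finally have "dependent (of_lat ` B')" using v(1) unfolding dependent_def by blast
      then show False using B'(3) by (simp add: lin_indep_def)
    qed
    ultimately show ?thesis using assms(3) B_sub unfolding unimodular_def by metis
  qed
  have mB: "m (of_lat v) \<in> \<int>" if "v \<in> B" for v using that C(1) by (auto simp: B_def)
  have int: "m (of_lat x) \<in> \<int>" if x: "x \<in> int_lattice n" for x
  proof -
    obtain T e where "finite T" "T \<subseteq> B" "x = (\<Sum>v\<in>T. frag_cmul (e v) v)"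
      using x unfolding \<open>int_span B = int_lattice n\<close>[symmetric] int_span_def by blast
    then show ?thesis
      using mB by (auto simp: of_lat_sum of_lat_frag_cmul linear_sum[OF m(1)] linear_scale[OF m(1)] intro!: Ints_sum Ints_mult)
  qed
  \<comment> \<open>\<open>m\<close> is integral on the standard basis, so the floors are its exact
    coordinates.\<close>
  define k where "k = (\<Sum>i<n. frag_cmul \<lfloor>m (of_lat (frag_of i))\<rfloor> (frag_of i))"
  have kin: "k \<in> int_lattice n"
    by (auto simp: k_def intro!: int_lattice_sum int_lattice_frag_cmul int_lattice_frag_of)
  have lookup_k: "Poly_Mapping.lookup k i = \<lfloor>m (of_lat (frag_of i))\<rfloor>" if "i < n" for i
    using that by (simp add: k_def lookup_sum lookup_frag_of if_distrib cong: if_cong)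
  have km: "pairing k (of_lat x) = m (of_lat x)" if x: "x \<in> int_lattice n" for x
  proof -
    have "m (of_lat x) = (\<Sum>i<n. real_of_int (Poly_Mapping.lookup x i) * m (of_lat (frag_of i)))"
      by (subst lat_expansion[OF x])
         (simp add: of_lat_sum of_lat_frag_cmul linear_sum[OF m(1)] linear_scale[OF m(1)])
    also have "\<dots> = (\<Sum>i<n. real_of_int (Poly_Mapping.lookup k i) * real_of_int (Poly_Mapping.lookup x i))"
      using int by (intro sum.cong) (auto simp: lookup_k int_lattice_frag_of elim!: Ints_cases)
    also have "\<dots> = pairing k (of_lat x)" by (simp add: pairing_int_lattice[OF kin])
    finally show ?thesis ..
  qed
  show "\<exists>k\<in>int_lattice n. \<forall>v\<in>S. \<bar>int_pairing (u + frag_cmul (int q) k) v\<bar> < int q"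
  proof (intro bexI[OF _ kin] ballI)
    fix v assume v: "v \<in> S"
    have "\<bar>m (of_lat v) - c (of_lat v)\<bar> < 1" using m(2)[of "of_lat v"] v by (auto, linarith)
    then have "\<bar>real q * (m (of_lat v) - c (of_lat v))\<bar> < real q" using assms(4) by (simp add: abs_mult)
    also have "real q * (m (of_lat v) - c (of_lat v)) = pairing (u + frag_cmul (int q) k) (of_lat v)"
      using assms(2,4) v by (auto simp: c_def pairing_add pairing_frag_cmul km algebra_simps)
    finally show "\<bar>int_pairing (u + frag_cmul (int q) k) v\<bar> < int q"
      unfolding pairing_of_lat by linarith
  qed
qed

text \<open>With \<open>q = 2 h\<close>, apply the condition to \<open>h u\<close>: the
  representative \<open>h u + q k\<close> equals \<open>h (u + 2 k)\<close>, and \<open>h\<close>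
  cancels from the bound.\<close>

lemma small_representatives_2_if_even:
  assumes "small_representatives n S q" "even q" "q > 0"
  shows "small_representatives n S 2"
  unfolding small_representatives_def
proof
  fix u assume u: "u \<in> int_lattice n"
  obtain h where h: "q = 2 * h" "h > 0" using assms by auto
  obtain k where k: "k \<in> int_lattice n"
    "\<And>v. v \<in> S \<Longrightarrow> \<bar>int_pairing (frag_cmul (int h) u + frag_cmul (int q) k) v\<bar> < int q"
    using assms(1) int_lattice_frag_cmul[OF u] unfolding small_representatives_def by blast
  have "\<bar>int_pairing (u + frag_cmul (int 2) k) v\<bar> < int 2" if "v \<in> S" for v
  proof -
    have "int_pairing (frag_cmul (int h) u + frag_cmul (int q) k) v = int h * int_pairing (u + frag_cmul 2 k) v"
      by (simp add: int_pairing_add int_pairing_frag_cmul h algebra_simps)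
    then have "int h * \<bar>int_pairing (u + frag_cmul 2 k) v\<bar> < int h * 2"
      using k(2)[OF that] h by (simp add: abs_mult)
    then show ?thesis using h(2) by simp
  qed
  with k(1) show "\<exists>k\<in>int_lattice n. \<forall>v\<in>S. \<bar>int_pairing (u + frag_cmul (int 2) k) v\<bar> < int 2" by blast
qed

text \<open>Classes modulo 2 are compared with the supports of their representatives on
  \<open>B\<close>. There are \<open>2^n\<close> classes and at most \<open>2^n\<close> subsets of
  \<open>B\<close>, so injectivity already realises every subset.\<close>

lemma small_representatives_2_imp_unimodular:
  assumes S: "S \<subseteq> int_lattice n" "span (of_lat ` S) = real_space n" and "small_representatives n S 2"
  shows "unimodular n S"
  unfolding unimodular_def
proof (intro allI impI, elim conjE)
  fix B assume B: "B \<subseteq> S" "lin_indep B"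
    and max: "\<forall>B'. B \<subseteq> B' \<and> B' \<subseteq> S \<and> lin_indep B' \<longrightarrow> B' = B"
  have ind: "independent (of_lat ` B)" using B by (simp add: lin_indep_def)
  have "of_lat v \<in> span (of_lat ` B)" if v: "v \<in> S" for v
  proof (rule ccontr)
    assume notin: "of_lat v \<notin> span (of_lat ` B)"
    then have "lin_indep (insert v B)" using ind by (simp add: lin_indep_def independent_insert)
    then have "insert v B = B" using max B v by blast
    then show False using notin by (metis imageI insertI1 span_base)
  qed
  then have "span (of_lat ` S) \<subseteq> span (of_lat ` B)" by (intro span_minimal) auto
  then have spanB: "real_space n \<subseteq> span (of_lat ` B)" using S(2) by simp
  have BN: "B \<subseteq> int_lattice n" using B S by blast
  have card: "finite B \<and> card B \<le> n"
  proof -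
    have "of_lat v \<in> span (of_lat ` frag_of ` {..<n})" if "v \<in> B" for v
    proof -
      have "of_lat v = (\<Sum>i<n. real_of_int (Poly_Mapping.lookup v i) *\<^sub>R of_lat (frag_of i))"
        by (subst lat_expansion[of v n]) (use that BN in \<open>auto simp: of_lat_sum of_lat_frag_cmul\<close>)
      also have "\<dots> \<in> span (of_lat ` frag_of ` {..<n})"
        by (intro span_sum span_scale span_base) auto
      finally show ?thesis .
    qed
    then have "finite (of_lat ` B) \<and> card (of_lat ` B) \<le> card (of_lat ` frag_of ` {..<n})"
      using ind by (intro independent_span_bound) auto
    moreover have "card (of_lat ` frag_of ` {..<n}) \<le> n"
      by (metis card_image_le card_lessThan finite_imageI finite_lessThan order_trans)
    moreover have "inj_on of_lat B" by (simp add: inj_on_def)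
    ultimately show ?thesis by (auto simp: card_image dest: finite_imageD)
  qed
  have "\<exists>k. k \<in> int_lattice n \<and> (\<forall>v\<in>B. \<bar>int_pairing (u + frag_cmul 2 k) v\<bar> \<le> 1)"
    if "u \<in> int_lattice n" for u
    using assms(3) that B(1) unfolding small_representatives_def by (fastforce simp: subset_iff)
  then obtain K where K: "\<And>u. u \<in> int_lattice n \<Longrightarrow> K u \<in> int_lattice n"
    "\<And>u v. u \<in> int_lattice n \<Longrightarrow> v \<in> B \<Longrightarrow> \<bar>int_pairing (u + frag_cmul 2 (K u)) v\<bar> \<le> 1"
    by metis
  define r where "r = (\<lambda>u. u + frag_cmul 2 (K u))"
  have r: "r u \<in> int_lattice n" "v \<in> B \<Longrightarrow> int_pairing (r u) v \<in> {-1, 0, 1}"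
    if u: "u \<in> int_lattice n" for u v
  proof -
    show "r u \<in> int_lattice n"
      unfolding r_def using u by (intro int_lattice_add int_lattice_frag_cmul K)
    assume "v \<in> B"
    then have "\<bar>int_pairing (r u) v\<bar> \<le> 1" using K(2)[OF u] by (simp add: r_def)
    then show "int_pairing (r u) v \<in> {-1, 0, 1}" by auto
  qed
  have zero: "w = 0" if w: "w \<in> int_lattice n" "\<And>v. v \<in> B \<Longrightarrow> int_pairing w v = 0" for w
  proof (rule poly_mapping_eqI)
    fix i
    have "pairing w x = 0" if "x \<in> real_space n" for x
    proof (rule linear_eq_0_on_span[OF linear_pairing])
      show "x \<in> span (of_lat ` B)" using spanB that by blast
    qed (use w(2) in \<open>auto simp: pairing_of_lat\<close>)
    moreover have "pairing w (of_lat (frag_of i)) = real_of_int (Poly_Mapping.lookup w i)" if "i < n"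
      using that w(1) by (simp add: pairing_int_lattice lookup_frag_of if_distrib cong: if_cong)
    ultimately show "Poly_Mapping.lookup w i = Poly_Mapping.lookup 0 i"
      using w(1) by (cases "i < n") (auto simp: int_lattice_frag_of int_lattice_iff)
  qed
  \<comment> \<open>An even value of absolute value at most 1 is 0, so the representative of
    \<open>w\<close> vanishes on the spanning set \<open>B\<close>, hence everywhere.\<close>
  have even: "even (Poly_Mapping.lookup w i)"
    if w: "w \<in> int_lattice n" "\<And>v. v \<in> B \<Longrightarrow> even (int_pairing w v)" for w i
  proof -
    have "int_pairing (r w) v = 0" if "v \<in> B" for v
    proof -
      have "even (int_pairing (r w) v)"
        using w(2)[OF that] by (simp add: r_def int_pairing_add int_pairing_frag_cmul)
      then show ?thesis using r(2)[OF w(1) that] by auto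
    qed
    then have "r w = 0" using r(1)[OF w(1)] by (intro zero) auto
    then have "Poly_Mapping.lookup (r w) i = 0" by simp
    then have "Poly_Mapping.lookup w i = 2 * (- Poly_Mapping.lookup (K w) i)"
      by (simp add: r_def lookup_add)
    then show ?thesis by simp
  qed
  \<comment> \<open>The 0/1 vectors represent the classes modulo 2.\<close>
  define e where "e = (\<lambda>c::nat set. \<Sum>i\<in>c. frag_of i)"
  have e: "e c \<in> int_lattice n" if "c \<in> Pow {..<n}" for c
    using that by (auto simp: e_def intro!: int_lattice_sum int_lattice_frag_of)
  have lookup_e: "Poly_Mapping.lookup (e c) i = (if i \<in> c then 1 else 0)" if "c \<in> Pow {..<n}" for c i
    using that finite_subset[of c "{..<n}"] by (simp add: e_def lookup_sum lookup_frag_of)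
  define g where "g = (\<lambda>c. {b \<in> B. int_pairing (r (e c)) b \<noteq> 0})"
  have "inj_on g (Pow {..<n})"
  proof (rule inj_onI)
    fix c d assume c: "c \<in> Pow {..<n}" and d: "d \<in> Pow {..<n}" and eq: "g c = g d"
    have "even (int_pairing (r (e c) - r (e d)) v)" if v: "v \<in> B" for v
    proof -
      have "int_pairing (r (e c)) v \<noteq> 0 \<longleftrightarrow> int_pairing (r (e d)) v \<noteq> 0"
        using eq v by (auto simp: g_def)
      then show ?thesis
        using r(2)[OF e[OF c] v] r(2)[OF e[OF d] v] by (auto simp: int_pairing_diff)
    qed
    then have "even (Poly_Mapping.lookup (r (e c) - r (e d)) i)" for i
      using r(1) e c d by (intro even int_lattice_diff) auto
    then have ev: "even (Poly_Mapping.lookup (e c) i - Poly_Mapping.lookup (e d) i)" for i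
      by (simp add: r_def lookup_minus lookup_add)
    have "i \<in> c \<longleftrightarrow> i \<in> d" for i
      using lookup_e[OF c, of i] lookup_e[OF d, of i] ev[of i]
      by (cases "i \<in> c"; cases "i \<in> d") simp_all
    then show "c = d" by blast
  qed
  then have card_g: "card (g ` Pow {..<n}) = 2 ^ n" by (simp add: card_image card_Pow)
  have "g ` Pow {..<n} = Pow B"
  proof (rule card_seteq)
    show "finite (Pow B)" using card by simp
    show "g ` Pow {..<n} \<subseteq> Pow B" by (auto simp: g_def)
    show "card (Pow B) \<le> card (g ` Pow {..<n})" using card card_g by (simp add: card_Pow)
  qed
  \<comment> \<open>The representative with support \<open>{b}\<close> is, up to sign, the dual
    basis vector of \<open>b\<close>.\<close>
  then have dual: "\<exists>u\<in>int_lattice n. \<bar>int_pairing u b\<bar> = 1 \<and> (\<forall>b'\<in>B. b' \<noteq> b \<longrightarrow> int_pairing u b' = 0)" if b: "b \<in> B" for b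
  proof -
    have "{b} \<in> g ` Pow {..<n}" using \<open>g ` Pow {..<n} = Pow B\<close> b by simp
    then obtain c where c: "c \<in> Pow {..<n}" "g c = {b}" by (metis imageE)
    then have "int_pairing (r (e c)) b \<noteq> 0" "\<forall>b'\<in>B. b' \<noteq> b \<longrightarrow> int_pairing (r (e c)) b' = 0"
      by (auto simp: g_def)
    then show ?thesis using r(1)[OF e[OF c(1)]] r(2)[OF e[OF c(1)] b] by (intro bexI[of _ "r (e c)"]) auto
  qed
  show "int_span B = int_lattice n"
  proof
    show "int_span B \<subseteq> int_lattice n"
      using BN by (auto simp: int_span_def intro!: int_lattice_sum int_lattice_frag_cmul)
    show "int_lattice n \<subseteq> int_span B"
    proof
      fix x assume x: "x \<in> int_lattice n"
      then have "of_lat x \<in> span (of_lat ` B)" using spanB by auto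
      then obtain a where "of_lat x = (\<Sum>y\<in>of_lat ` B. a y *\<^sub>R y)"
        using card by (auto simp: span_finite)
      then have a: "of_lat x = (\<Sum>b\<in>B. a (of_lat b) *\<^sub>R of_lat b)"
        by (simp add: sum.reindex inj_on_def)
      have int: "a (of_lat b) \<in> \<int>" if b: "b \<in> B" for b
      proof -
        obtain u where u: "\<bar>int_pairing u b\<bar> = 1" "\<forall>b'\<in>B. b' \<noteq> b \<longrightarrow> int_pairing u b' = 0"
          using dual[OF b] by blast
        have "real_of_int (int_pairing u x) = (\<Sum>b'\<in>B. a (of_lat b') * real_of_int (int_pairing u b'))"
          by (simp add: a linear_sum[OF linear_pairing] pairing_scaleR flip: pairing_of_lat)
        also have "\<dots> = a (of_lat b) * real_of_int (int_pairing u b)"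
          using card b u(2) by (subst sum.remove[of B b]) auto
        finally have eq: "a (of_lat b) * real_of_int (int_pairing u b) = real_of_int (int_pairing u x)" ..
        have "int_pairing u b = 1 \<or> int_pairing u b = -1" using u(1) by linarith
        then have "a (of_lat b) = real_of_int (int_pairing u x) \<or> a (of_lat b) = real_of_int (- int_pairing u x)"
          using eq by auto
        then show ?thesis by (metis Ints_of_int)
      qed
      have "of_lat x = of_lat (\<Sum>b\<in>B. frag_cmul \<lfloor>a (of_lat b)\<rfloor> b)"
        unfolding a of_lat_sum of_lat_frag_cmul using int by (intro sum.cong) (auto elim!: Ints_cases)
      then show "x \<in> int_span B"
        using card unfolding of_lat_eq_iff int_span_def
        by (intro CollectI exI[of _ B] exI[of _ "\<lambda>b. \<lfloor>a (of_lat b)\<rfloor>"]) auto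
    qed
  qed
qed

section \<open>Prime ideals and localisations\<close>

text \<open>Ideals and primes as plain subsets of an ambient ring, so that calculations use its own
  operations; \<open>primeideal_chart_iff\<close> links this to the primes that define
  points.\<close>

definition ideal_in :: "'a::comm_ring_1 set \<Rightarrow> 'a set \<Rightarrow> bool" where
  "ideal_in A D \<longleftrightarrow> D \<subseteq> A \<and> 0 \<in> D \<and> (\<forall>x\<in>D. \<forall>y\<in>D. x + y \<in> D) \<and> (\<forall>a\<in>A. \<forall>x\<in>D. a * x \<in> D)"

definition prime_in :: "'a::comm_ring_1 set \<Rightarrow> 'a set \<Rightarrow> bool" where
  "prime_in A P \<longleftrightarrow> ideal_in A P \<and> 1 \<notin> P \<and> (\<forall>x\<in>A. \<forall>y\<in>A. x * y \<in> P \<longrightarrow> x \<in> P \<or> y \<in> P)"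

locale subring_of =
  fixes A :: "'a::comm_ring_1 set"
  assumes one: "1 \<in> A" and uminus: "x \<in> A \<Longrightarrow> - x \<in> A"
    and add: "x \<in> A \<Longrightarrow> y \<in> A \<Longrightarrow> x + y \<in> A" and mult: "x \<in> A \<Longrightarrow> y \<in> A \<Longrightarrow> x * y \<in> A"
begin

lemma zero: "0 \<in> A"
  using add[OF one uminus[OF one]] by simp

lemma diff: "x \<in> A \<Longrightarrow> y \<in> A \<Longrightarrow> x - y \<in> A"
  using add[of x "- y"] uminus by simp

lemma sum: "(\<And>i. i \<in> I \<Longrightarrow> f i \<in> A) \<Longrightarrow> sum f I \<in> A"
  by (induction I rule: infinite_finite_induct) (auto intro: add zero)

lemma ideal_diff:
  assumes "ideal_in A D" "x \<in> D" "y \<in> D"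
  shows "x - y \<in> D"
proof -
  have "(- 1) * y \<in> D" using assms uminus[OF one] unfolding ideal_in_def by blast
  then have "x + (- 1) * y \<in> D" using assms unfolding ideal_in_def by blast
  then show ?thesis by simp
qed

lemma ideal_sum:
  assumes "ideal_in A D" "\<And>i. i \<in> I \<Longrightarrow> f i \<in> D"
  shows "sum f I \<in> D"
  using assms(2) assms(1)
  by (induction I rule: infinite_finite_induct) (auto simp: ideal_in_def)

lemma prime_prod:
  assumes "prime_in A P" "finite I" "\<And>i. i \<in> I \<Longrightarrow> f i \<in> A - P"
  shows "prod f I \<in> A - P"
  using assms(2,3)
proof (induction I rule: finite_induct)
  case empty
  then show ?case using assms(1) one by (auto simp: prime_in_def)
next
  case (insert i I)
  then have "f i \<in> A - P" "prod f I \<in> A - P" by auto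
  then show ?case using insert.hyps assms(1) mult unfolding prime_in_def by auto
qed

text \<open>Krull's argument: an ideal maximal among those disjoint from a multiplicative set is
  prime. The last conclusion records maximality itself, which later identifies the contraction of
  \<open>Q\<close>.\<close>

lemma exists_prime_avoiding:
  assumes D: "ideal_in A D" and S: "S \<subseteq> A" "1 \<in> S" "\<And>x y. x \<in> S \<Longrightarrow> y \<in> S \<Longrightarrow> x * y \<in> S"
    and disj: "D \<inter> S = {}"
  obtains Q where "prime_in A Q" "D \<subseteq> Q" "Q \<inter> S = {}"
    "\<And>a. a \<in> A \<Longrightarrow> a \<notin> Q \<Longrightarrow> \<exists>d\<in>Q. \<exists>c\<in>A. d + c * a \<in> S"
proof -
  let ?F = "{Q. ideal_in A Q \<and> D \<subseteq> Q \<and> Q \<inter> S = {}}"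
  have "\<exists>M\<in>?F. \<forall>X\<in>?F. M \<subseteq> X \<longrightarrow> X = M"
  proof (rule subset_Zorn_nonempty)
    show "?F \<noteq> {}" using D disj by blast
    fix C assume C: "C \<noteq> {}" "subset.chain ?F C"
    then have sub: "\<And>X. X \<in> C \<Longrightarrow> ideal_in A X \<and> D \<subseteq> X \<and> X \<inter> S = {}"
      by (auto simp: subset.chain_def)
    have "ideal_in A (\<Union>C)"
      unfolding ideal_in_def
    proof (intro conjI ballI)
      show "\<Union>C \<subseteq> A" using sub unfolding ideal_in_def by blast
      show "0 \<in> \<Union>C" using sub C(1) unfolding ideal_in_def by blast
      fix x assume "x \<in> \<Union>C"
      then obtain X where X: "X \<in> C" "x \<in> X" by blast
      { fix y assume "y \<in> \<Union>C"
        then obtain Y where Y: "Y \<in> C" "y \<in> Y" by blast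
        then have "X \<subseteq> Y \<or> Y \<subseteq> X" using C(2) X by (auto simp: subset_chain_def)
        then show "x + y \<in> \<Union>C" using X Y sub unfolding ideal_in_def by blast }
      { fix a assume "a \<in> A" then show "a * x \<in> \<Union>C" using X sub unfolding ideal_in_def by blast }
    qed
    then show "\<Union>C \<in> ?F" using sub C(1) by blast
  qed
  then obtain Q where QF: "Q \<in> ?F" and Qmax: "\<forall>X\<in>?F. Q \<subseteq> X \<longrightarrow> X = Q" by (rule bexE)
  have Q: "ideal_in A Q" "D \<subseteq> Q" "Q \<inter> S = {}" using QF by simp_all
  have max: "X = Q" if "ideal_in A X" "D \<subseteq> X" "X \<inter> S = {}" "Q \<subseteq> X" for X
    using Qmax that by simp
  \<comment> \<open>The ideal generated by \<open>Q\<close> and \<open>a\<close> is strictly larger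
    than \<open>Q\<close>, so it must meet \<open>S\<close>.\<close>
  have meet: "\<exists>d\<in>Q. \<exists>c\<in>A. d + c * a \<in> S" if a: "a \<in> A" "a \<notin> Q" for a
  proof (rule ccontr)
    assume neg: "\<not> ?thesis"
    let ?X = "{d + c * a | d c. d \<in> Q \<and> c \<in> A}"
    have "ideal_in A ?X"
      unfolding ideal_in_def
    proof (intro conjI ballI)
      have QA: "Q \<subseteq> A" using Q(1) by (simp add: ideal_in_def)
      show "?X \<subseteq> A" using QA a by (auto intro: add mult)
      have "0 \<in> Q" using Q(1) by (simp add: ideal_in_def)
      then show "0 \<in> ?X" using zero by (intro CollectI exI[of _ 0]) simp
      fix x assume "x \<in> ?X"
      then obtain d c where x: "x = d + c * a" "d \<in> Q" "c \<in> A" by blast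
      { fix y assume "y \<in> ?X"
        then obtain d' c' where y: "y = d' + c' * a" "d' \<in> Q" "c' \<in> A" by blast
        show "x + y \<in> ?X" using x y Q(1) add unfolding ideal_in_def
          by (intro CollectI exI[of _ "d + d'"] exI[of _ "c + c'"]) (auto simp: algebra_simps) }
      { fix b assume "b \<in> A"
        then show "b * x \<in> ?X" using x Q(1) mult unfolding ideal_in_def
          by (intro CollectI exI[of _ "b * d"] exI[of _ "b * c"]) (auto simp: algebra_simps) }
    qed
    moreover have "Q \<subseteq> ?X" using zero by force
    moreover have "?X \<inter> S = {}" using neg by blast
    ultimately have "?X = Q" using Q(2) by (intro max) auto
    moreover have "a = 0 + 1 * a" by simp
    then have "a \<in> ?X" using one Q(1) unfolding ideal_in_def by blast
    ultimately show False using a by simp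
  qed
  have "prime_in A Q"
    unfolding prime_in_def
  proof (intro conjI ballI impI Q)
    show "1 \<notin> Q" using S Q by blast
    fix x y assume xy: "x \<in> A" "y \<in> A" "x * y \<in> Q"
    show "x \<in> Q \<or> y \<in> Q"
    proof (rule ccontr)
      assume "\<not> (x \<in> Q \<or> y \<in> Q)"
      then obtain d c d' c' where dc: "d \<in> Q" "c \<in> A" "d + c * x \<in> S" "d' \<in> Q" "c' \<in> A" "d' + c' * y \<in> S"
        using meet xy by blast
      have QA: "Q \<subseteq> A" using Q(1) by (simp add: ideal_in_def)
      have "(d + c * x) * (d' + c' * y) = (d' + c' * y) * d + (c * x) * d' + (c * c') * (x * y)"
        by (simp add: algebra_simps)
      also have "\<dots> \<in> Q"
      proof -
        have m: "a * z \<in> Q" if "a \<in> A" "z \<in> Q" for a z using that Q(1) by (simp add: ideal_in_def)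
        have p: "a + z \<in> Q" if "a \<in> Q" "z \<in> Q" for a z using that Q(1) by (simp add: ideal_in_def)
        show ?thesis by (rule p[OF p[OF m m] m]) (use dc xy QA in \<open>auto intro: mult add\<close>)
      qed
      finally show False using S(3)[OF dc(3) dc(6)] Q(3) by blast
    qed
  qed
  with Q meet that show thesis by blast
qed

text \<open>
  Nakayama's lemma for the module generated by the \<open>m i\<close> over the local ring of \<open>P\<close>, modulo \<open>Q\<close>,
  with denominators cleared; generators are eliminated one at a time.
\<close>

lemma nakayama:
  assumes Q: "ideal_in A Q" and P: "prime_in A P"
    and \<phi>: "\<And>x y. \<phi> (x + y) = \<phi> x + \<phi> y" "\<And>x y. \<phi> (x * y) = \<phi> x * \<phi> y" "\<And>x. x \<in> A \<Longrightarrow> \<phi> x \<in> A"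
    and "finite I" "\<And>i. i \<in> I \<Longrightarrow> m i \<in> A"
    and "\<And>i. i \<in> I \<Longrightarrow> \<exists>b\<in>A - P. \<exists>p. (\<forall>j\<in>I. p j \<in> P) \<and> \<phi> b * m i - (\<Sum>j\<in>I. \<phi> (p j) * m j) \<in> Q"
    and "i \<in> I"
  shows "\<exists>b\<in>A - P. \<phi> b * m i \<in> Q"
  using assms(6-9)
proof (induction I arbitrary: i rule: finite_induct)
  case (insert k I)
  have Qm: "a * x \<in> Q" if "a \<in> A" "x \<in> Q" for a x using that Q by (simp add: ideal_in_def)
  have Qa: "x + y \<in> Q" if "x \<in> Q" "y \<in> Q" for x y using that Q by (simp add: ideal_in_def)
  have Pm: "a * x \<in> P" if "a \<in> A" "x \<in> P" for a x using that P by (simp add: prime_in_def ideal_in_def)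
  have Pa: "x + y \<in> P" if "x \<in> P" "y \<in> P" for x y using that P by (simp add: prime_in_def ideal_in_def)
  have PA: "P \<subseteq> A" using P by (simp add: prime_in_def ideal_in_def)
  have AP: "x * y \<in> A - P" if "x \<in> A - P" "y \<in> A - P" for x y
    using that P mult by (auto simp: prime_in_def)
  obtain b\<^sub>k p\<^sub>k where k: "b\<^sub>k \<in> A - P" "\<forall>j\<in>insert k I. p\<^sub>k j \<in> P"
    "\<phi> b\<^sub>k * m k - (\<Sum>j\<in>insert k I. \<phi> (p\<^sub>k j) * m j) \<in> Q"
    using insert.prems(2)[of k] by auto
  \<comment> \<open>Moving the term \<open>j = k\<close> to the left changes the coefficient of
    \<open>m k\<close> by an element of \<open>P\<close>, so it stays outside
    \<open>P\<close>.\<close>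
  define b' where "b' = b\<^sub>k - p\<^sub>k k"
  have b'k: "b\<^sub>k = b' + p\<^sub>k k" by (simp add: b'_def)
  have b': "b' \<in> A - P"
  proof -
    have "b' \<in> A" using k(1,2) PA by (auto simp: b'_def intro: diff)
    moreover have "b' \<notin> P" using k(1,2) b'k Pa by auto
    ultimately show ?thesis by simp
  qed
  define r\<^sub>k where "r\<^sub>k = \<phi> b' * m k - (\<Sum>j\<in>I. \<phi> (p\<^sub>k j) * m j)"
  have "r\<^sub>k = \<phi> b\<^sub>k * m k - (\<Sum>j\<in>insert k I. \<phi> (p\<^sub>k j) * m j)"
    using insert.hyps by (simp add: r\<^sub>k_def b'k \<phi> algebra_simps)
  then have rk: "r\<^sub>k \<in> Q" using k(3) by simp
  have "\<exists>b\<in>A - P. \<exists>p. (\<forall>j\<in>I. p j \<in> P) \<and> \<phi> b * m i - (\<Sum>j\<in>I. \<phi> (p j) * m j) \<in> Q" if i: "i \<in> I" for i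
  proof -
    obtain b\<^sub>i p\<^sub>i where bi: "b\<^sub>i \<in> A - P" "\<forall>j\<in>insert k I. p\<^sub>i j \<in> P"
      "\<phi> b\<^sub>i * m i - (\<Sum>j\<in>insert k I. \<phi> (p\<^sub>i j) * m j) \<in> Q"
      using insert.prems(2)[of i] i by auto
    \<comment> \<open>Multiplying the relation for \<open>i\<close> by the coefficient in the
      relation for \<open>k\<close> eliminates \<open>m k\<close>; the coefficients on the right
      remain in \<open>P\<close>.\<close>
    have "\<phi> (b' * b\<^sub>i) * m i - (\<Sum>j\<in>I. \<phi> (b' * p\<^sub>i j + p\<^sub>i k * p\<^sub>k j) * m j)
        = \<phi> b' * (\<phi> b\<^sub>i * m i - (\<Sum>j\<in>insert k I. \<phi> (p\<^sub>i j) * m j)) + \<phi> (p\<^sub>i k) * r\<^sub>k"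
      using insert.hyps
      by (simp add: r\<^sub>k_def \<phi> algebra_simps sum.distrib sum_distrib_left)
    also have "\<dots> \<in> Q"
      using bi rk b' PA by (intro Qa Qm[OF \<phi>(3)]) auto
    finally show ?thesis
      using bi b' k(2) PA by (intro bexI[OF _ AP[OF b' bi(1)]] exI conjI) (auto intro!: Pa Pm)
  qed
  then have IH: "\<exists>b\<in>A - P. \<phi> b * m j \<in> Q" if "j \<in> I" for j
    using insert.IH insert.prems(1) that by simp
  show ?case
  proof (cases "i = k")
    case False
    then show ?thesis using IH insert.prems(3) by simp
  next
    case True
    obtain c where c: "\<And>j. j \<in> I \<Longrightarrow> c j \<in> A - P" "\<And>j. j \<in> I \<Longrightarrow> \<phi> (c j) * m j \<in> Q"
      using IH by metis
    \<comment> \<open>A common multiplier that sends all other generators into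
      \<open>Q\<close>.\<close>
    let ?c = "prod c I"
    have cA: "?c \<in> A - P" using prime_prod[OF P insert.hyps(1) c(1)] by simp
    have cm: "\<phi> ?c * m j \<in> Q" if j: "j \<in> I" for j
    proof -
      have "prod c (I - {j}) \<in> A - P"
        by (rule prime_prod[OF P]) (use c(1) insert.hyps(1) in auto)
      then have "\<phi> (prod c (I - {j})) * (\<phi> (c j) * m j) \<in> Q"
        using c(2)[OF j] Qm \<phi>(3) by blast
      then show ?thesis using insert.hyps(1) j by (simp add: prod.remove[of I j] \<phi>(2) mult_ac)
    qed
    have "\<phi> (?c * b') * m k = \<phi> ?c * r\<^sub>k + (\<Sum>j\<in>I. \<phi> (p\<^sub>k j) * (\<phi> ?c * m j))"
      by (simp add: r\<^sub>k_def \<phi> algebra_simps sum_distrib_left)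
    also have "\<dots> \<in> Q"
    proof (rule Qa)
      show "\<phi> ?c * r\<^sub>k \<in> Q" using cA rk by (intro Qm[OF \<phi>(3)]) auto
      show "(\<Sum>j\<in>I. \<phi> (p\<^sub>k j) * (\<phi> ?c * m j)) \<in> Q"
        using k(2) PA by (intro ideal_sum[OF Q] cm Qm[OF \<phi>(3)]) auto
    qed
    finally show ?thesis using True AP[OF cA b'] by blast
  qed
qed simp

end

section \<open>Chart rings as subrings of the Laurent polynomials\<close>

lemma carrier_chart_ring [simp]:
  "carrier (chart_ring n \<sigma>) = {f :: 'k::field laurent. Poly_Mapping.keys f \<subseteq> dual_monoid n \<sigma>}"
  by (simp add: chart_ring_def)

lemma subring_of_chart: "subring_of (carrier (chart_ring n \<sigma> :: 'k::field laurent ring))"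
proof -
  interpret cring "chart_ring n \<sigma> :: 'k laurent ring" by (rule chart_ring_cring)
  let ?R = "chart_ring n \<sigma> :: 'k laurent ring"
  show ?thesis
  proof
    fix x y :: "'k laurent" assume x: "x \<in> carrier ?R"
    then show "- x \<in> carrier ?R" by simp
    assume "y \<in> carrier ?R"
    then show "x + y \<in> carrier ?R" "x * y \<in> carrier ?R"
      using a_closed[OF x] m_closed[OF x] by (simp_all add: chart_ring_def)
  qed (use one_closed in \<open>simp add: chart_ring_def\<close>)
qed

lemma primeideal_chart_iff:
  "primeideal P (chart_ring n \<sigma> :: 'k::field laurent ring) \<longleftrightarrow>
    prime_in (carrier (chart_ring n \<sigma> :: 'k laurent ring)) P"
proof
  let ?R = "chart_ring n \<sigma> :: 'k laurent ring"
  interpret R: cring ?R by (rule chart_ring_cring)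
  interpret S: subring_of "carrier ?R" by (rule subring_of_chart)
  have ops: "x \<otimes>\<^bsub>?R\<^esub> y = x * y" "x \<oplus>\<^bsub>?R\<^esub> y = x + y" "\<zero>\<^bsub>?R\<^esub> = 0" "\<one>\<^bsub>?R\<^esub> = 1" for x y :: "'k laurent"
    by (simp_all add: chart_ring_def)
  show "prime_in (carrier ?R) P" if "primeideal P ?R"
  proof -
    interpret primeideal P ?R by fact
    have "1 \<notin> P" using one_imp_carrier I_notcarr by (auto simp: ops)
    then show ?thesis
      unfolding prime_in_def ideal_in_def
      using Icarr zero_closed a_closed I_l_closed I_prime by (auto simp: ops simp del: carrier_chart_ring)
  qed
  show "primeideal P ?R" if P: "prime_in (carrier ?R) P"
  proof (rule primeidealI)
    have id: "ideal_in (carrier ?R) P" using P by (simp add: prime_in_def)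
    show "ideal P ?R"
    proof (rule idealI)
      show "ring ?R" by (rule R.ring_axioms)
      show "subgroup P (add_monoid ?R)"
      proof
        show "P \<subseteq> carrier (add_monoid ?R)" using id by (simp add: ideal_in_def)
        show "x \<otimes>\<^bsub>add_monoid ?R\<^esub> y \<in> P" if "x \<in> P" "y \<in> P" for x y
          using that id by (simp add: ideal_in_def ops)
        show "\<one>\<^bsub>add_monoid ?R\<^esub> \<in> P" using id by (simp add: ideal_in_def ops)
        fix x assume x: "x \<in> P"
        then have "x \<in> carrier ?R" using id by (auto simp: ideal_in_def)
        moreover from this have "- x \<in> carrier ?R" by simp
        ultimately have "\<ominus>\<^bsub>?R\<^esub> x = - x" using R.minus_equality[of "- x" x] by (simp add: ops)
        moreover have "- x \<in> P"
          using S.ideal_diff[OF id, of 0 x] x id by (simp add: ideal_in_def)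
        ultimately show "inv\<^bsub>add_monoid ?R\<^esub> x \<in> P" by (simp add: a_inv_def)
      qed
      fix a x assume "a \<in> P" "x \<in> carrier ?R"
      then have "x * a \<in> P" using id by (simp add: ideal_in_def)
      then show "x \<otimes>\<^bsub>?R\<^esub> a \<in> P" "a \<otimes>\<^bsub>?R\<^esub> x \<in> P" by (simp_all add: ops mult.commute)
    qed
    show "cring ?R" by (rule R.is_cring)
    show "carrier ?R \<noteq> P" using P S.one by (auto simp: prime_in_def simp del: carrier_chart_ring)
    show "\<And>a b. a \<in> carrier ?R \<Longrightarrow> b \<in> carrier ?R \<Longrightarrow> a \<otimes>\<^bsub>?R\<^esub> b \<in> P \<Longrightarrow> a \<in> P \<or> b \<in> P"
      using P by (simp add: prime_in_def ops del: carrier_chart_ring)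
  qed
qed

lemma single_in_chart:
  "u \<in> dual_monoid n \<sigma> \<Longrightarrow> Poly_Mapping.single u c \<in> carrier (chart_ring n \<sigma> :: 'k::field laurent ring)"
  by simp

section \<open>The ring map of \<open>F\<close> and the primes over a given prime\<close>

lemma power_map_add: "power_map q (f + g) = power_map q f + power_map q g"
  by (simp add: power_map_def monomial_map_add)

lemma power_map_zero [simp]: "power_map q 0 = 0"
  by (simp add: power_map_def monomial_map_def)

lemma power_map_single [simp]:
  "power_map q (Poly_Mapping.single u c) = Poly_Mapping.single (frag_cmul (int q) u) c"
  by (simp add: power_map_def)

lemma power_map_one [simp]: "power_map q 1 = 1"
  using power_map_single[of q 0 1] by simp

lemma power_map_sum: "power_map q (\<Sum>i\<in>I. f i) = (\<Sum>i\<in>I. power_map q (f i))"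
  by (simp add: power_map_def monomial_map_sum)

lemma dual_monoid_sum: "(\<And>i. i \<in> I \<Longrightarrow> f i \<in> dual_monoid n \<sigma>) \<Longrightarrow> (\<Sum>i\<in>I. f i) \<in> dual_monoid n \<sigma>"
  by (induction I rule: infinite_finite_induct) (auto intro: dual_monoid_add dual_monoid_zero)

lemma dual_monoid_frag_cmul: "u \<in> dual_monoid n \<sigma> \<Longrightarrow> 0 \<le> k \<Longrightarrow> frag_cmul k u \<in> dual_monoid n \<sigma>"
  by (auto simp: dual_monoid_def pairing_frag_cmul int_lattice_frag_cmul)

lemma keys_monomial_map: "Poly_Mapping.keys (monomial_map h f) \<subseteq> h ` Poly_Mapping.keys f"
proof -
  have "Poly_Mapping.keys (monomial_map h f) \<subseteq>
      (\<Union>u\<in>Poly_Mapping.keys f. Poly_Mapping.keys (Poly_Mapping.single (h u) (Poly_Mapping.lookup f u)))"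
    unfolding monomial_map_def by (rule keys_sum)
  then show ?thesis by (auto split: if_splits)
qed

lemma power_map_chart:
  "f \<in> carrier (chart_ring n \<sigma>) \<Longrightarrow> power_map q f \<in> carrier (chart_ring n \<sigma> :: 'k::field laurent ring)"
proof -
  assume "f \<in> carrier (chart_ring n \<sigma>)"
  then have "frag_cmul (int q) ` Poly_Mapping.keys f \<subseteq> dual_monoid n \<sigma>"
    by (auto intro!: dual_monoid_frag_cmul)
  with keys_monomial_map[of "frag_cmul (int q)" f] show ?thesis
    by (simp add: power_map_def)
qed

text \<open>\<open>G\<close> consists of the combinations of elements of \<open>K\<close> with coefficients less than \<open>q\<close>.\<close>

lemma finite_remainders:
  fixes K :: "lat set"
  assumes "finite K" "K \<subseteq> dual_monoid n \<sigma>" "q > 0"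
  obtains G where "finite G" "0 \<in> G" "G \<subseteq> dual_monoid n \<sigma>"
    "\<And>u g. u \<in> K \<Longrightarrow> g \<in> G \<Longrightarrow> \<exists>t\<in>dual_monoid n \<sigma>. \<exists>g'\<in>G. u + g = frag_cmul (int q) t + g'"
proof
  let ?s = "\<lambda>e :: lat \<Rightarrow> nat. \<Sum>u\<in>K. frag_cmul (int (e u)) u"
  let ?E = "K \<rightarrow>\<^sub>E {..<q}"
  show "finite (?s ` ?E)" using assms(1) by (intro finite_imageI finite_PiE) auto
  show "0 \<in> ?s ` ?E"
    using assms(3) by (intro image_eqI[of _ _ "\<lambda>u. if u \<in> K then 0 else undefined"]) (auto intro!: sum.neutral[symmetric])
  show "?s ` ?E \<subseteq> dual_monoid n \<sigma>"
    using assms(2) by (auto intro!: dual_monoid_sum dual_monoid_frag_cmul)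
  fix u g assume u: "u \<in> K" and "g \<in> ?s ` ?E"
  then obtain e where e: "e \<in> ?E" "g = ?s e" by blast
  have g: "g = frag_cmul (int (e u)) u + (\<Sum>w\<in>K - {u}. frag_cmul (int (e w)) w)"
    unfolding e(2) using assms(1) u by (rule sum.remove)
  have upd: "?s (e(u := x)) = frag_cmul (int x) u + (\<Sum>w\<in>K - {u}. frag_cmul (int (e w)) w)" for x
    using assms(1) u by (simp add: sum.remove[of K u])
  have uD: "u \<in> dual_monoid n \<sigma>" using u assms(2) by blast
  \<comment> \<open>Adding \<open>u\<close> raises its coefficient by one; on reaching
    \<open>q\<close> the coefficient is reset to 0 and \<open>u\<close> is carried into the quotient
    \<open>t\<close>.\<close>
  show "\<exists>t\<in>dual_monoid n \<sigma>. \<exists>g'\<in>?s ` ?E. u + g = frag_cmul (int q) t + g'"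
  proof (cases "Suc (e u) < q")
    case True
    then have "e(u := Suc (e u)) \<in> ?E" using e(1) u by (auto simp: PiE_iff extensional_def)
    moreover have "u + g = frag_cmul (int q) 0 + ?s (e(u := Suc (e u)))"
      unfolding upd g by (simp add: frag_cmul_distrib add.assoc)
    ultimately show ?thesis using dual_monoid_zero by blast
  next
    case False
    have "e u < q" using e(1) u by (auto simp: PiE_iff)
    then have q: "int q = 1 + int (e u)" using False by simp
    have "e(u := 0) \<in> ?E" using e(1) u assms(3) by (auto simp: PiE_iff extensional_def)
    moreover have "u + g = frag_cmul (int q) u + ?s (e(u := 0))"
      unfolding upd g q by (simp add: frag_cmul_distrib add.assoc)
    ultimately show ?thesis using uD by blast
  qed
qed

lemma single_mult_sum:
  "f * Poly_Mapping.single g 1 = (\<Sum>u\<in>Poly_Mapping.keys f. Poly_Mapping.single (u + g) (Poly_Mapping.lookup f u))"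
  for f :: "'k::field laurent"
proof -
  have "f * Poly_Mapping.single g 1 =
      (\<Sum>u\<in>Poly_Mapping.keys f. Poly_Mapping.single u (Poly_Mapping.lookup f u)) * Poly_Mapping.single g 1"
    by (simp flip: laurent_sum)
  then show ?thesis by (simp add: sum_distrib_right mult_single)
qed

text \<open>\<open>c\<close> acts on the finite module generated by the monomials of \<open>finite_remainders\<close>.\<close>

lemma contraction_of_maximal:
  fixes \<sigma> :: "rvec set" and n :: nat
  defines "A \<equiv> carrier (chart_ring n \<sigma> :: 'k::field laurent ring)"
  assumes q: "q > 0" and P: "prime_in A P" and Q: "prime_in A Q"
    and disj: "Q \<inter> power_map q ` (A - P) = {}"
    and max: "\<And>a. a \<in> A \<Longrightarrow> a \<notin> Q \<Longrightarrow> \<exists>d\<in>Q. \<exists>c\<in>A. d + c * a \<in> power_map q ` (A - P)"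
  shows "{f \<in> A. power_map q f \<in> Q} = P"
proof (intro equalityI subsetI)
  interpret subring_of A unfolding A_def by (rule subring_of_chart)
  fix a assume "a \<in> {f \<in> A. power_map q f \<in> Q}"
  then show "a \<in> P" using disj by blast
next
  interpret subring_of A unfolding A_def by (rule subring_of_chart)
  have Qid: "ideal_in A Q" and Pid: "ideal_in A P" using Q P by (auto simp: prime_in_def)
  have power_map_A: "power_map q x \<in> A" if "x \<in> A" for x
    using that unfolding A_def by (rule power_map_chart)
  fix a assume a: "a \<in> P"
  then have aA: "a \<in> A" using Pid by (auto simp: ideal_in_def)
  have "power_map q a \<in> Q"
  proof (rule ccontr)
    assume "power_map q a \<notin> Q"
    \<comment> \<open>By maximality, the pullback of some \<open>b\<close> outside \<open>P\<close>
      is congruent modulo \<open>Q\<close> to \<open>c\<close> times the pullback of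
      \<open>a\<close>.\<close>
    then obtain d c b where d: "d \<in> Q" "c \<in> A" "b \<in> A - P" "d + c * power_map q a = power_map q b"
      using max[OF power_map_A[OF aA]] by blast
    have "Poly_Mapping.keys c \<subseteq> dual_monoid n \<sigma>" using d(2) by (simp add: A_def)
    then obtain G where G: "finite G" "0 \<in> G" "G \<subseteq> dual_monoid n \<sigma>"
      "\<And>u g. u \<in> Poly_Mapping.keys c \<Longrightarrow> g \<in> G \<Longrightarrow> \<exists>t\<in>dual_monoid n \<sigma>. \<exists>g'\<in>G. u + g = frag_cmul (int q) t + g'"
      using finite_remainders[OF finite_keys _ q] by metis
    let ?m = "\<lambda>g. Poly_Mapping.single g (1::'k)"
    \<comment> \<open>Multiplication by \<open>c\<close> keeps the span of the monomials of
      \<open>G\<close> over the pulled-back chart ring, and \<open>a\<close> puts the resulting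
      coefficients into \<open>P\<close>. At the generator 1 the conclusion places the pullback of
      an element outside \<open>P\<close> in \<open>Q\<close>, against disjointness.\<close>
    have "\<exists>b\<in>A - P. power_map q b * ?m 0 \<in> Q"
    proof (rule nakayama[OF Qid P power_map_add power_map_mult power_map_A G(1) _ _ G(2)])
      fix g assume g: "g \<in> G"
      then show "?m g \<in> A" using G(3) by (auto simp: A_def)
      obtain t h where th: "\<And>u. u \<in> Poly_Mapping.keys c \<Longrightarrow> t u \<in> dual_monoid n \<sigma>"
        "\<And>u. u \<in> Poly_Mapping.keys c \<Longrightarrow> h u \<in> G"
        "\<And>u. u \<in> Poly_Mapping.keys c \<Longrightarrow> u + g = frag_cmul (int q) (t u) + h u"
        using G(4)[OF _ g] by metis
      \<comment> \<open>The terms of \<open>c x^g\<close> are grouped by remainder: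
        \<open>r g'\<close> collects the quotients belonging to \<open>g'\<close>.\<close>
      define r where "r = (\<lambda>g'. \<Sum>u | u \<in> Poly_Mapping.keys c \<and> h u = g'. Poly_Mapping.single (t u) (Poly_Mapping.lookup c u))"
      define p where "p = (\<lambda>g'. r g' * a)"
      have "r g' \<in> A" for g'
        unfolding r_def using th(1) by (intro sum) (simp add: A_def)
      then have pP: "p g' \<in> P" for g' using a Pid by (simp add: p_def ideal_in_def)
      have "(\<Sum>g'\<in>G. power_map q (r g') * ?m g') =
          (\<Sum>g'\<in>G. \<Sum>u | u \<in> Poly_Mapping.keys c \<and> h u = g'. Poly_Mapping.single (frag_cmul (int q) (t u) + h u) (Poly_Mapping.lookup c u))"
        by (simp add: r_def power_map_sum sum_distrib_right mult_single)
      also have "\<dots> = (\<Sum>u\<in>Poly_Mapping.keys c. Poly_Mapping.single (frag_cmul (int q) (t u) + h u) (Poly_Mapping.lookup c u))"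
        using G(1) th(2) by (intro sum.group) auto
      also have "\<dots> = c * ?m g"
        using th(3) by (simp add: single_mult_sum)
      finally have cg: "(\<Sum>g'\<in>G. power_map q (r g') * ?m g') = c * ?m g" .
      have "(\<Sum>g'\<in>G. power_map q (p g') * ?m g') = power_map q a * (\<Sum>g'\<in>G. power_map q (r g') * ?m g')"
        unfolding sum_distrib_left by (simp add: p_def power_map_mult mult_ac)
      then have "power_map q b * ?m g - (\<Sum>g'\<in>G. power_map q (p g') * ?m g') = ?m g * d"
        unfolding cg d(4)[symmetric] by (simp add: algebra_simps)
      also have "\<dots> \<in> Q" using Qid d(1) g G(3) by (auto simp: ideal_in_def A_def)
      finally show "\<exists>b\<in>A - P. \<exists>p. (\<forall>g'\<in>G. p g' \<in> P) \<and> power_map q b * ?m g - (\<Sum>g'\<in>G. power_map q (p g') * ?m g') \<in> Q"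
        using d(3) pP by blast
    qed
    then show False using disj by auto
  qed
  then show "a \<in> {f \<in> A. power_map q f \<in> Q}" using aA by simp
qed

text \<open>A refined form of lying over: the prime above \<open>P\<close> can contain any
  prescribed ideal that avoids the pullbacks of elements outside \<open>P\<close>.\<close>

lemma exists_prime_over:
  fixes \<sigma> :: "rvec set" and n :: nat
  defines "A \<equiv> carrier (chart_ring n \<sigma> :: 'k::field laurent ring)"
  assumes q: "q > 0" and P: "prime_in A P" and D: "ideal_in A D"
    and disj: "D \<inter> power_map q ` (A - P) = {}"
  obtains Q where "prime_in A Q" "D \<subseteq> Q" "{f \<in> A. power_map q f \<in> Q} = P"
proof -
  interpret subring_of A unfolding A_def by (rule subring_of_chart)
  let ?S = "power_map q ` (A - P)"
  have S: "?S \<subseteq> A" unfolding A_def using power_map_chart[of _ n \<sigma> q] by blast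
  have "1 \<in> A - P" using P one by (auto simp: prime_in_def)
  then have S1: "1 \<in> ?S" by (metis image_eqI power_map_one)
  have Sm: "x * y \<in> ?S" if x: "x \<in> ?S" and y: "y \<in> ?S" for x y
  proof -
    obtain a b where ab: "a \<in> A - P" "b \<in> A - P" "x = power_map q a" "y = power_map q b" using x y by blast
    then have "a * b \<in> A - P" using P mult by (auto simp: prime_in_def)
    then show ?thesis using ab by (metis image_eqI power_map_mult)
  qed
  obtain Q where Q: "prime_in A Q" "D \<subseteq> Q" "Q \<inter> ?S = {}"
    "\<And>a. a \<in> A \<Longrightarrow> a \<notin> Q \<Longrightarrow> \<exists>d\<in>Q. \<exists>c\<in>A. d + c * a \<in> ?S"
    by (rule exists_prime_avoiding[OF D S S1 Sm disj]) blast+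
  have "{f \<in> A. power_map q f \<in> Q} = P"
    using contraction_of_maximal[OF q] P Q unfolding A_def by blast
  with Q that show thesis by blast
qed

text \<open>A prime of \<open>A\<close> fails to contain these denominators exactly when
  \<open>s\<close> lies in its local ring, so regularity becomes a statement about ideals.\<close>

lemma denominators_ideal:
  fixes s :: "'k::field ratfun"
  assumes "subring_of A"
  shows "ideal_in A {d \<in> A. \<exists>f\<in>A. Fract d 1 * s = Fract f 1}"
proof -
  interpret subring_of A by fact
  show ?thesis
    unfolding ideal_in_def
  proof (intro conjI ballI)
    show "0 \<in> {d \<in> A. \<exists>f\<in>A. Fract d 1 * s = Fract f 1}"
      using zero by (intro CollectI conjI bexI[of _ 0]) (simp_all flip: Zero_fract_def)
    fix x assume "x \<in> {d \<in> A. \<exists>f\<in>A. Fract d 1 * s = Fract f 1}"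
    then obtain f where f: "x \<in> A" "f \<in> A" "Fract x 1 * s = Fract f 1" by blast
    { fix y assume "y \<in> {d \<in> A. \<exists>f\<in>A. Fract d 1 * s = Fract f 1}"
      then obtain g where g: "y \<in> A" "g \<in> A" "Fract y 1 * s = Fract g 1" by blast
      have "Fract (x + y) 1 * s = Fract x 1 * s + Fract y 1 * s"
        by (simp flip: distrib_right)
      also have "\<dots> = Fract (f + g) 1" using f g by simp
      finally show "x + y \<in> {d \<in> A. \<exists>f\<in>A. Fract d 1 * s = Fract f 1}"
        using f g by (auto intro: add) }
    { fix a assume a: "a \<in> A"
      have "Fract (a * x) 1 * s = Fract a 1 * (Fract x 1 * s)" by (simp flip: mult.assoc)
      also have "\<dots> = Fract (a * f) 1" using f by simp
      finally show "a * x \<in> {d \<in> A. \<exists>f\<in>A. Fract d 1 * s = Fract f 1}"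
        using f a by (auto intro: mult) }
  qed auto
qed

lemma Fract_mult_denominator:
  "g \<noteq> 0 \<Longrightarrow> Fract g 1 * s = Fract f 1 \<longleftrightarrow> s = Fract f g"
  for f g :: "'k::field laurent"
  by (cases s) (auto simp: eq_fract mult_ac)

text \<open>Otherwise the ideal of denominators would lie in a prime over \<open>P\<close>, where
  \<open>s\<close> is regular. Germs of the pushforward at \<open>P\<close> thus have denominators
  pulled back from outside \<open>P\<close>.\<close>

lemma in_all_localisations_over:
  fixes \<sigma> :: "rvec set" and n :: nat and s :: "'k::field ratfun"
  defines "R \<equiv> chart_ring n \<sigma> :: 'k laurent ring"
  assumes q: "q > 0" and P: "primeideal P R"
    and s: "\<And>Q. primeideal Q R \<Longrightarrow> {f \<in> carrier R. power_map q f \<in> Q} = P \<Longrightarrow> s \<in> localisation R Q"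
  obtains f g where "f \<in> carrier R" "g \<in> carrier R - P" "s = Fract f (power_map q g)"
proof -
  let ?A = "carrier R"
  interpret subring_of ?A unfolding R_def by (rule subring_of_chart)
  let ?D = "{d \<in> ?A. \<exists>f\<in>?A. Fract d 1 * s = Fract f 1}"
  let ?S = "power_map q ` (?A - P)"
  have P': "prime_in ?A P" using P by (simp add: R_def primeideal_chart_iff)
  have nz: "g \<noteq> 0" if "g \<in> ?A - P" "prime_in ?A P" for g P
    using that by (auto simp: prime_in_def ideal_in_def)
  have "?D \<inter> ?S \<noteq> {}"
  proof
    assume disj: "?D \<inter> ?S = {}"
    obtain Q where Q: "prime_in ?A Q" "?D \<subseteq> Q" "{f \<in> ?A. power_map q f \<in> Q} = P"
      using exists_prime_over[OF q, of n \<sigma> P ?D] P' disj denominators_ideal[OF subring_of_axioms, of s]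
      unfolding R_def by blast
    then have "s \<in> localisation R Q" using s Q(1,3) by (simp add: R_def primeideal_chart_iff)
    then obtain f g where fg: "s = Fract f g" "f \<in> ?A" "g \<in> ?A - Q" unfolding localisation_def by blast
    then have "Fract g 1 * s = Fract f 1" using Fract_mult_denominator nz[OF fg(3) Q(1)] by blast
    then have "g \<in> ?D" using fg by blast
    then show False using fg(3) Q(2) by blast
  qed
  then obtain g f where g: "g \<in> ?A - P" "f \<in> ?A" "Fract (power_map q g) 1 * s = Fract f 1" by blast
  have "power_map q g \<noteq> 0" using nz[OF g(1) P'] q by (simp add: power_map_nonzero)
  then have "s = Fract f (power_map q g)" using Fract_mult_denominator g(3) by blast
  with g that show thesis by blast
qed

text \<open>A proper ideal of denominators would lie in a prime; avoiding \<open>{1}\<close>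
  supplies one.\<close>

lemma in_all_localisations:
  fixes \<sigma> :: "rvec set" and n :: nat and s :: "'k::field ratfun"
  defines "R \<equiv> chart_ring n \<sigma> :: 'k laurent ring"
  assumes s: "\<And>Q. primeideal Q R \<Longrightarrow> s \<in> localisation R Q"
  obtains f where "f \<in> carrier R" "s = Fract f 1"
proof -
  let ?A = "carrier R"
  interpret subring_of ?A unfolding R_def by (rule subring_of_chart)
  let ?D = "{d \<in> ?A. \<exists>f\<in>?A. Fract d 1 * s = Fract f 1}"
  have "1 \<in> ?D"
  proof (rule ccontr)
    assume disj: "1 \<notin> ?D"
    obtain Q where Q: "prime_in ?A Q" "?D \<subseteq> Q"
      by (rule exists_prime_avoiding[OF denominators_ideal[OF subring_of_axioms, of s], of "{1}"])
        (use disj one in auto)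
    then have "s \<in> localisation R Q" using s by (simp add: R_def primeideal_chart_iff)
    then obtain f g where fg: "s = Fract f g" "f \<in> ?A" "g \<in> ?A - Q" unfolding localisation_def by blast
    then have "g \<noteq> 0" using Q(1) by (auto simp: prime_in_def ideal_in_def)
    then have "Fract g 1 * s = Fract f 1" using Fract_mult_denominator fg(1) by blast
    then have "g \<in> ?D" using fg by blast
    then show False using fg(3) Q(2) by blast
  qed
  then show thesis using that by (auto simp flip: One_fract_def)
qed

section \<open>Products\<close>

lemma lookup_first_part [simp]: "Poly_Mapping.lookup (first_part z) i = Poly_Mapping.lookup z (2 * i)"
  by (simp add: first_part_def map_key.rep_eq inj_on_def)

lemma lookup_second_part [simp]: "Poly_Mapping.lookup (second_part z) i = Poly_Mapping.lookup z (2 * i + 1)"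
  by (simp add: second_part_def map_key.rep_eq inj_on_def)

definition pair :: "(nat \<Rightarrow>\<^sub>0 'a::zero) \<Rightarrow> (nat \<Rightarrow>\<^sub>0 'a) \<Rightarrow> (nat \<Rightarrow>\<^sub>0 'a)" where
  "pair u v = Abs_poly_mapping
    (\<lambda>i. if even i then Poly_Mapping.lookup u (i div 2) else Poly_Mapping.lookup v (i div 2))"

lemma lookup_pair:
  "Poly_Mapping.lookup (pair u v) i =
    (if even i then Poly_Mapping.lookup u (i div 2) else Poly_Mapping.lookup v (i div 2))"
proof -
  let ?f = "\<lambda>i. if even i then Poly_Mapping.lookup u (i div 2) else Poly_Mapping.lookup v (i div 2)"
  have "{i. ?f i \<noteq> 0} \<subseteq> (\<lambda>i. 2 * i) ` Poly_Mapping.keys u \<union> (\<lambda>i. 2 * i + 1) ` Poly_Mapping.keys v"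
  proof
    fix i assume "i \<in> {i. ?f i \<noteq> 0}"
    then show "i \<in> (\<lambda>i. 2 * i) ` Poly_Mapping.keys u \<union> (\<lambda>i. 2 * i + 1) ` Poly_Mapping.keys v"
      by (cases "even i") (auto simp: in_keys_iff elim!: evenE oddE)
  qed
  then have "finite {i. ?f i \<noteq> 0}" by (rule finite_subset) simp
  then show ?thesis by (simp add: pair_def)
qed

lemma first_part_pair [simp]: "first_part (pair u v) = u"
  and second_part_pair [simp]: "second_part (pair u v) = v"
  by (simp_all add: poly_mapping_eq_iff fun_eq_iff lookup_pair)

lemma pair_parts [simp]: "pair (first_part z) (second_part z) = z"
  by (rule poly_mapping_eqI) (auto simp: lookup_pair elim!: evenE oddE)

lemma parts_eqI: "first_part z = first_part z' \<Longrightarrow> second_part z = second_part z' \<Longrightarrow> z = z'"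
  by (metis pair_parts)

lemma first_part_zero [simp]: "first_part 0 = 0"
  and second_part_zero [simp]: "second_part 0 = 0"
  by (simp_all add: poly_mapping_eq_iff fun_eq_iff)

lemma first_part_add: "first_part (u + v) = first_part u + first_part v"
  and second_part_add: "second_part (u + v) = second_part u + second_part v"
  for u v :: "nat \<Rightarrow>\<^sub>0 'a::monoid_add"
  by (simp_all add: poly_mapping_eq_iff fun_eq_iff lookup_add)

lemma first_part_frag_cmul: "first_part (frag_cmul k u) = frag_cmul k (first_part u)"
  and second_part_frag_cmul: "second_part (frag_cmul k u) = frag_cmul k (second_part u)"
  by (simp_all add: poly_mapping_eq_iff fun_eq_iff)

lemma pair_zero [simp]: "pair 0 0 = 0"
  by (simp add: poly_mapping_eq_iff fun_eq_iff lookup_pair)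

lemma int_lattice_double_iff:
  "u \<in> int_lattice (2 * n) \<longleftrightarrow> first_part u \<in> int_lattice n \<and> second_part u \<in> int_lattice n"
proof
  assume *: "first_part u \<in> int_lattice n \<and> second_part u \<in> int_lattice n"
  show "u \<in> int_lattice (2 * n)"
    unfolding int_lattice_iff
  proof (intro allI impI)
    fix i assume i: "2 * n \<le> i"
    show "Poly_Mapping.lookup u i = 0"
    proof (cases "even i")
      case True
      then show ?thesis using i * by (auto simp: int_lattice_iff elim!: evenE)
    next
      case False
      then obtain j where j: "i = 2 * j + 1" by (elim oddE)
      then have "n \<le> j" using i by simp
      then have "Poly_Mapping.lookup (second_part u) j = 0" using * by (simp add: int_lattice_iff)
      then show ?thesis by (simp add: j)
    qed
  qed
qed (auto simp: int_lattice_iff)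

lemma pairing_parts:
  "pairing u z = pairing (first_part u) (first_part z) + pairing (second_part u) (second_part z)"
proof -
  let ?f = "\<lambda>i. real_of_int (Poly_Mapping.lookup u i) * Poly_Mapping.lookup z i"
  let ?K1 = "(\<lambda>i. 2 * i) ` Poly_Mapping.keys (first_part u)"
  let ?K2 = "(\<lambda>i. 2 * i + 1) ` Poly_Mapping.keys (second_part u)"
  have "Poly_Mapping.keys u \<subseteq> ?K1 \<union> ?K2"
  proof
    fix i assume "i \<in> Poly_Mapping.keys u"
    then show "i \<in> ?K1 \<union> ?K2"
      by (cases "even i") (auto simp: in_keys_iff elim!: evenE oddE)
  qed
  then have "pairing u z = sum ?f (?K1 \<union> ?K2)" by (intro pairing_superset) auto
  also have "?K1 \<inter> ?K2 = {}" by (auto, presburger)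
  then have "sum ?f (?K1 \<union> ?K2) = sum ?f ?K1 + sum ?f ?K2" by (intro sum.union_disjoint) auto
  also have "\<dots> = pairing (first_part u) (first_part z) + pairing (second_part u) (second_part z)"
    by (simp add: pairing_def sum.reindex inj_on_def)
  finally show ?thesis .
qed

text \<open>Testing on \<open>(x, 0)\<close> and \<open>(0, y)\<close> separates the conditions on
  the two factors.\<close>

lemma dual_monoid_product:
  assumes "0 \<in> \<sigma>" "0 \<in> \<tau>"
  shows "u \<in> dual_monoid (2 * n) (cone_product \<sigma> \<tau>) \<longleftrightarrow>
    first_part u \<in> dual_monoid n \<sigma> \<and> second_part u \<in> dual_monoid n \<tau>"
proof
  assume u: "u \<in> dual_monoid (2 * n) (cone_product \<sigma> \<tau>)"
  have "0 \<le> pairing (first_part u) x" if "x \<in> \<sigma>" for x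
  proof -
    have "pair x 0 \<in> cone_product \<sigma> \<tau>" using that assms by (simp add: cone_product_def)
    then have "0 \<le> pairing u (pair x 0)" using u by (simp add: dual_monoid_def)
    then show ?thesis by (simp add: pairing_parts[of u])
  qed
  moreover have "0 \<le> pairing (second_part u) x" if "x \<in> \<tau>" for x
  proof -
    have "pair 0 x \<in> cone_product \<sigma> \<tau>" using that assms by (simp add: cone_product_def)
    then have "0 \<le> pairing u (pair 0 x)" using u by (simp add: dual_monoid_def)
    then show ?thesis by (simp add: pairing_parts[of u])
  qed
  ultimately show "first_part u \<in> dual_monoid n \<sigma> \<and> second_part u \<in> dual_monoid n \<tau>"
    using u by (simp add: dual_monoid_def int_lattice_double_iff)
next
  assume "first_part u \<in> dual_monoid n \<sigma> \<and> second_part u \<in> dual_monoid n \<tau>"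
  then show "u \<in> dual_monoid (2 * n) (cone_product \<sigma> \<tau>)"
    by (auto simp: dual_monoid_def int_lattice_double_iff pairing_parts[of u] cone_product_def)
qed

section \<open>Restriction of functions to the diagonal\<close>

lemma diagonal_map_add: "diagonal_map (f + g) = diagonal_map f + diagonal_map g"
  by (simp add: diagonal_map_def monomial_map_add)

lemma diagonal_map_diff: "diagonal_map (f - g) = diagonal_map f - diagonal_map g"
  using diagonal_map_add[of "f - g" g] by simp

lemma diagonal_map_mult: "diagonal_map (f * g) = diagonal_map f * diagonal_map g"
  unfolding diagonal_map_def
  by (rule monomial_map_mult) (simp add: first_part_add second_part_add add_ac)

lemma diagonal_map_single [simp]:
  "diagonal_map (Poly_Mapping.single u c) = Poly_Mapping.single (first_part u + second_part u) c"
  by (simp add: diagonal_map_def)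

lemma diagonal_map_zero [simp]: "diagonal_map 0 = 0"
  by (simp add: diagonal_map_def monomial_map_def)

lemma diagonal_map_one [simp]: "diagonal_map 1 = 1"
  using diagonal_map_single[of 0 1] by simp

lemma diagonal_map_sum: "diagonal_map (\<Sum>i\<in>I. f i) = (\<Sum>i\<in>I. diagonal_map (f i))"
  by (simp add: diagonal_map_def monomial_map_sum)

lemma diagonal_map_chart:
  assumes "0 \<in> \<sigma>" "f \<in> carrier (chart_ring (2 * n) (cone_product \<sigma> \<sigma>))"
  shows "diagonal_map f \<in> carrier (chart_ring n \<sigma> :: 'k::field laurent ring)"
proof -
  have "(\<lambda>w. first_part w + second_part w) ` Poly_Mapping.keys f \<subseteq> dual_monoid n \<sigma>"
    using assms(2) dual_monoid_product[OF assms(1,1)] by (auto intro: dual_monoid_add)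
  with keys_monomial_map[of "\<lambda>w. first_part w + second_part w" f] show ?thesis
    by (simp add: diagonal_map_def)
qed

lemma laurent_induct [case_names add single]:
  fixes f :: "'k::field laurent"
  assumes "\<And>f g. P f \<Longrightarrow> P g \<Longrightarrow> P (f + g)"
    and "\<And>u c. P (Poly_Mapping.single u c)"
  shows "P f"
proof -
  have P0: "P 0" using assms(2)[of 0 0] by simp
  have "P (\<Sum>u\<in>T. Poly_Mapping.single u (Poly_Mapping.lookup f u))" for T
    by (induction T rule: infinite_finite_induct) (auto intro: assms P0)
  then show ?thesis by (subst laurent_sum)
qed

lemma diagonal_map_power_map: "diagonal_map (power_map q f) = power_map q (diagonal_map f)"
  by (induction f rule: laurent_induct)
     (simp_all add: power_map_add diagonal_map_add first_part_frag_cmul second_part_frag_cmul frag_cmul_distrib2)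

section \<open>Divisible exponents\<close>

lemma inj_frag_cmul: "k \<noteq> 0 \<Longrightarrow> inj (frag_cmul k)"
  by (auto simp: inj_on_def poly_mapping_eq_iff fun_eq_iff)

text \<open>The standard splitting of toric varieties: \<open>x^{q u}\<close> goes to
  \<open>x^u\<close>, and monomials with indivisible exponent go to 0.\<close>

definition root_map :: "nat \<Rightarrow> 'k::field laurent \<Rightarrow> 'k laurent" where
  "root_map q f = Poly_Mapping.map_key (frag_cmul (int q)) f"

lemma lookup_root_map:
  "q > 0 \<Longrightarrow> Poly_Mapping.lookup (root_map q f) u = Poly_Mapping.lookup f (frag_cmul (int q) u)"
  by (simp add: root_map_def map_key.rep_eq inj_frag_cmul)

lemma root_map_add: "q > 0 \<Longrightarrow> root_map q (f + g) = root_map q f + root_map q g"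
  by (simp add: root_map_def map_key_plus inj_frag_cmul)

lemma root_map_zero [simp]: "q > 0 \<Longrightarrow> root_map q 0 = 0"
  by (simp add: root_map_def inj_frag_cmul)

lemma root_map_single:
  "q > 0 \<Longrightarrow> root_map q (Poly_Mapping.single (frag_cmul (int q) u) c) = Poly_Mapping.single u c"
  by (simp add: root_map_def inj_frag_cmul)

lemma root_map_single_nondivisible:
  assumes "q > 0" "\<And>k. u \<noteq> frag_cmul (int q) k"
  shows "root_map q (Poly_Mapping.single u c) = 0"
  by (rule poly_mapping_eqI) (use assms in \<open>auto simp: lookup_root_map lookup_single when_def\<close>)

lemma frag_cmul_diff_distrib2: "frag_cmul k (u - v) = frag_cmul k u - frag_cmul k v"
  by (rule poly_mapping_eqI) (simp add: lookup_minus right_diff_distrib)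

text \<open>On monomials: adding a multiple of \<open>q\<close> to an exponent does not affect its
  divisibility by \<open>q\<close>. This is linearity over the structure sheaf acting through
  \<open>F\<close>.\<close>

lemma root_map_semilinear:
  assumes "q > 0"
  shows "root_map q (power_map q g * f) = g * root_map q f"
proof (induction f rule: laurent_induct)
  case (add f1 f2)
  then show ?case using assms by (simp add: distrib_left root_map_add)
next
  case (single u c)
  show ?case
  proof (induction g rule: laurent_induct)
    case (add g1 g2)
    then show ?case using assms by (simp add: distrib_right power_map_add root_map_add)
  next
    case (single k d)
    show ?case
    proof (cases "\<exists>w. u = frag_cmul (int q) w")
      case True
      then obtain w where "u = frag_cmul (int q) w" by blast
      then show ?thesis using assms
        by (simp add: mult_single root_map_single flip: frag_cmul_distrib2)
    next
      case False
      have "frag_cmul (int q) k + u \<noteq> frag_cmul (int q) w" for w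
      proof
        assume "frag_cmul (int q) k + u = frag_cmul (int q) w"
        then have "u = frag_cmul (int q) w - frag_cmul (int q) k" by (simp add: eq_diff_eq add.commute)
        then show False using False by (metis frag_cmul_diff_distrib2)
      qed
      then show ?thesis using assms False
        by (simp add: mult_single root_map_single_nondivisible)
    qed
  qed
qed

lemma frag_cmul_iff_dvd:
  "(\<exists>k. u = frag_cmul q k) \<longleftrightarrow> (\<forall>i. q dvd Poly_Mapping.lookup u i)"
proof
  assume dvd: "\<forall>i. q dvd Poly_Mapping.lookup u i"
  have "u = frag_cmul q (Poly_Mapping.map (\<lambda>x. x div q) u)"
    by (rule poly_mapping_eqI) (use dvd in \<open>simp add: map.rep_eq when_def\<close>)
  then show "\<exists>k. u = frag_cmul q k" ..
qed auto

text \<open>Turns existence of small representatives into a finite choice of one per class.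
  Uniqueness is stated through \<open>u + w\<close>, the exponent that the splitting tests for
  divisibility.\<close>

lemma small_transversal:
  assumes rep: "small_representatives n S q" and q: "q > 0"
  obtains W where "finite W" "W \<subseteq> int_lattice n" "0 \<in> W"
    "\<And>w v. w \<in> W \<Longrightarrow> v \<in> S \<Longrightarrow> \<bar>int_pairing w v\<bar> < int q"
    "\<And>u. u \<in> int_lattice n \<Longrightarrow> \<exists>!w. w \<in> W \<and> (\<exists>k. u + w = frag_cmul (int q) k)"
proof -
  obtain K where K: "\<And>u. u \<in> int_lattice n \<Longrightarrow> K u \<in> int_lattice n"
    "\<And>u v. u \<in> int_lattice n \<Longrightarrow> v \<in> S \<Longrightarrow> \<bar>int_pairing (u + frag_cmul (int q) (K u)) v\<bar> < int q"
    using rep unfolding small_representatives_def by metis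
  \<comment> \<open>Coordinatewise residues name the classes canonically, so the chosen
    representative depends on the class alone and there are finitely many.\<close>
  define res where "res = (\<lambda>u :: lat. Poly_Mapping.map (\<lambda>x. x mod int q) u)"
  have lookup_res: "Poly_Mapping.lookup (res u) i = Poly_Mapping.lookup u i mod int q" for u i
    by (simp add: res_def map.rep_eq when_def)
  \<comment> \<open>The class of 0 is represented by 0 itself, so that the splitting fixes
    1.\<close>
  define R where "R = (\<lambda>u. if u = 0 then 0 else u + frag_cmul (int q) (K u))"
  have R_cong: "int q dvd Poly_Mapping.lookup (R u) i - Poly_Mapping.lookup u i" for u i
    by (simp add: R_def lookup_add)
  have res_in: "res u \<in> int_lattice n" if "u \<in> int_lattice n" for u
    using that by (simp add: int_lattice_iff lookup_res)
  have R_in: "R u \<in> int_lattice n" if "u \<in> int_lattice n" for u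
    using that K by (auto simp: R_def intro: int_lattice_add int_lattice_frag_cmul)
  have R_res: "int q dvd Poly_Mapping.lookup (R (res u)) i - Poly_Mapping.lookup u i" for u i
  proof -
    have "int q dvd Poly_Mapping.lookup (res u) i - Poly_Mapping.lookup u i"
      unfolding lookup_res by (simp add: mod_eq_dvd_iff[symmetric])
    from dvd_add[OF R_cong[of "res u" i] this] show ?thesis by simp
  qed
  let ?W = "(R \<circ> res) ` int_lattice n"
  show thesis
  proof (rule that[of ?W])
    let ?B = "{f. \<forall>i. (i \<in> {..<n} \<longrightarrow> f i \<in> {0..<int q}) \<and> (i \<notin> {..<n} \<longrightarrow> f i = 0)}"
    have "Poly_Mapping.lookup ` res ` int_lattice n \<subseteq> ?B"
      using q by (auto simp: lookup_res int_lattice_iff)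
    moreover have "finite ?B" by (rule finite_set_of_finite_funs) auto
    ultimately have "finite (Poly_Mapping.lookup ` res ` int_lattice n)" by (rule finite_subset)
    then have "finite (res ` int_lattice n)"
      by (rule finite_imageD) (simp add: inj_on_def)
    then show "finite ?W" unfolding image_comp[symmetric] by (rule finite_imageI)
    show "?W \<subseteq> int_lattice n" using res_in R_in by auto
    have "res 0 = 0" by (simp add: poly_mapping_eq_iff fun_eq_iff lookup_res)
    then have "(R \<circ> res) 0 = 0" by (simp add: R_def)
    then show "0 \<in> ?W" using int_lattice_zero by (metis imageI)
    show "\<bar>int_pairing w v\<bar> < int q" if "w \<in> ?W" "v \<in> S" for w v
      using that K(2) res_in q by (auto simp: R_def)
    fix u assume u: "u \<in> int_lattice n"
    show "\<exists>!w. w \<in> ?W \<and> (\<exists>k. u + w = frag_cmul (int q) k)"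
      unfolding frag_cmul_iff_dvd
    proof (rule ex1I, rule conjI)
      show "(R \<circ> res) (- u) \<in> ?W" using int_lattice_uminus[OF u] by (rule imageI)
      show "\<forall>i. int q dvd Poly_Mapping.lookup (u + (R \<circ> res) (- u)) i"
        using R_res[of "- u"] by (simp add: lookup_add add.commute)
      fix w assume w: "w \<in> ?W \<and> (\<forall>i. int q dvd Poly_Mapping.lookup (u + w) i)"
      then obtain u' where u': "u' \<in> int_lattice n" "w = R (res u')" by auto
      have "res u' = res (- u)"
      proof (rule poly_mapping_eqI)
        fix i
        have "int q dvd Poly_Mapping.lookup (u + w) i" using w by blast
        moreover have "int q dvd Poly_Mapping.lookup w i - Poly_Mapping.lookup u' i"
          unfolding u'(2) by (rule R_res)
        ultimately have "int q dvd Poly_Mapping.lookup (u + w) i - (Poly_Mapping.lookup w i - Poly_Mapping.lookup u' i)"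
          by (rule dvd_diff)
        then have "int q dvd Poly_Mapping.lookup u' i - Poly_Mapping.lookup (- u) i"
          by (simp add: lookup_add algebra_simps)
        then show "Poly_Mapping.lookup (res u') i = Poly_Mapping.lookup (res (- u)) i"
          by (simp only: lookup_res mod_eq_dvd_iff)
      qed
      then show "w = (R \<circ> res) (- u)" using u' by simp
    qed
  qed
qed

section \<open>Points and maximal ideals\<close>

lemma power_map_eq_0_iff: "q > 0 \<Longrightarrow> power_map q f = 0 \<longleftrightarrow> f = 0"
  using power_map_nonzero[of q f] by auto

lemma prime_in_nonzero: "prime_in A P \<Longrightarrow> g \<notin> P \<Longrightarrow> g \<noteq> 0"
  by (auto simp: prime_in_def ideal_in_def)

lemma prime_in_mult_notin: "prime_in A P \<Longrightarrow> f \<in> A - P \<Longrightarrow> g \<in> A - P \<Longrightarrow> f * g \<notin> P"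
  by (auto simp: prime_in_def)

lemma prime_in_zero: "subring_of A \<Longrightarrow> prime_in A {0 :: 'a::idom}"
  unfolding prime_in_def ideal_in_def using subring_of.zero by auto

text \<open>An inverse \<open>a/b\<close> of \<open>f/g\<close> with \<open>f\<close> in
  \<open>P\<close> would give \<open>g b = a f\<close> in \<open>P\<close>, although
  \<open>g\<close> and \<open>b\<close> lie outside.\<close>

lemma max_ideal_Fract_iff:
  fixes f g :: "'k::field laurent" and n :: nat and \<sigma> :: "rvec set"
  defines "A \<equiv> carrier (chart_ring n \<sigma> :: 'k laurent ring)"
  assumes P: "prime_in A P" and fg: "f \<in> A" "g \<in> A - P"
  shows "Fract f g \<in> max_ideal (localisation (chart_ring n \<sigma>) P) \<longleftrightarrow> f \<in> P"
proof
  have g0: "g \<noteq> 0" using P fg(2) by (auto dest: prime_in_nonzero)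
  have loc: "Fract a b \<in> localisation (chart_ring n \<sigma>) P" if "a \<in> A" "b \<in> A - P" for a b
    using that unfolding localisation_def A_def by blast
  show "f \<in> P" if max: "Fract f g \<in> max_ideal (localisation (chart_ring n \<sigma>) P)"
  proof (rule ccontr)
    assume "f \<notin> P"
    then have "f \<noteq> 0" using P by (auto dest: prime_in_nonzero)
    then have "Fract f g \<noteq> 0" using g0 by (simp add: Zero_fract_def eq_fract)
    moreover have "inverse (Fract f g) \<in> localisation (chart_ring n \<sigma>) P"
      using fg \<open>f \<notin> P\<close> by (auto intro: loc)
    ultimately show False using max by (simp add: max_ideal_def)
  qed
  show "Fract f g \<in> max_ideal (localisation (chart_ring n \<sigma>) P)" if "f \<in> P"
    unfolding max_ideal_def
  proof (intro CollectI conjI)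
    show "Fract f g \<in> localisation (chart_ring n \<sigma>) P" using fg by (rule loc)
    have "inverse (Fract f g) \<notin> localisation (chart_ring n \<sigma>) P" if "f \<noteq> 0"
    proof
      assume "inverse (Fract f g) \<in> localisation (chart_ring n \<sigma>) P"
      then obtain a b where ab: "Fract g f = Fract a b" "a \<in> A" "b \<in> A - P"
        unfolding localisation_def A_def by auto
      have "b \<noteq> 0" using P ab(3) by (auto dest: prime_in_nonzero)
      then have "g * b = a * f" using ab(1) \<open>f \<noteq> 0\<close> by (simp add: eq_fract)
      also have "\<dots> \<in> P" using ab(2) \<open>f \<in> P\<close> P by (simp add: prime_in_def ideal_in_def)
      finally show False using prime_in_mult_notin[OF P fg(2) ab(3)] by simp
    qed
    then show "Fract f g = 0 \<or> inverse (Fract f g) \<notin> localisation (chart_ring n \<sigma>) P"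
      using g0 by (cases "f = 0") (simp_all add: Zero_fract_def eq_fract)
  qed
qed

lemma diagonal_prime:
  assumes "0 \<in> \<sigma>" and P: "prime_in (carrier (chart_ring n \<sigma> :: 'k::field laurent ring)) P"
  shows "prime_in (carrier (chart_ring (2 * n) (cone_product \<sigma> \<sigma>) :: 'k laurent ring))
    {f \<in> carrier (chart_ring (2 * n) (cone_product \<sigma> \<sigma>)). diagonal_map f \<in> P}"
proof -
  let ?A = "carrier (chart_ring n \<sigma> :: 'k laurent ring)"
  let ?B = "carrier (chart_ring (2 * n) (cone_product \<sigma> \<sigma>) :: 'k laurent ring)"
  interpret A: subring_of ?A by (rule subring_of_chart)
  interpret B: subring_of ?B by (rule subring_of_chart)
  have D: "diagonal_map f \<in> ?A" if "f \<in> ?B" for f using diagonal_map_chart[OF assms(1) that] .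
  show ?thesis
    unfolding prime_in_def ideal_in_def
    using P D B.zero B.add B.mult
    by (auto simp: prime_in_def ideal_in_def diagonal_map_add diagonal_map_mult simp del: carrier_chart_ring)
qed

text \<open>Stability of open sets under generisation, which allows passing to the generic point of
  the diagonal or of the whole variety.\<close>

lemma zariski_open_generalise:
  assumes "zariski_open n \<Sigma> U" "\<sigma> \<in> \<Sigma>"
    and "primeideal P (chart_ring n \<sigma> :: 'k::field laurent ring)" "primeideal Q (chart_ring n \<sigma> :: 'k laurent ring)"
    and "localisation (chart_ring n \<sigma>) P \<in> U" "Q \<subseteq> P"
  shows "localisation (chart_ring n \<sigma>) Q \<in> U"
proof -
  obtain J where J: "\<And>P. primeideal P (chart_ring n \<sigma>) \<Longrightarrow> localisation (chart_ring n \<sigma>) P \<in> U \<longleftrightarrow> \<not> J \<subseteq> P"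
    using assms(1,2) unfolding zariski_open_def by meson
  then show ?thesis using J[OF assms(3)] J[OF assms(4)] assms(5,6) by auto
qed

lemma zariski_openE:
  assumes "zariski_open n \<Sigma> U" "x \<in> U"
  obtains \<sigma> P where "\<sigma> \<in> \<Sigma>" "primeideal P (chart_ring n \<sigma> :: 'k::field laurent ring)"
    "x = localisation (chart_ring n \<sigma>) P"
  using assms unfolding zariski_open_def points_def by blast

lemma power_preimageI:
  assumes "\<sigma> \<in> \<Sigma>" "primeideal Q (chart_ring n \<sigma> :: 'k::field laurent ring)"
    "localisation (chart_ring n \<sigma>) {f \<in> carrier (chart_ring n \<sigma>). power_map q f \<in> Q} \<in> U"
  shows "localisation (chart_ring n \<sigma>) Q \<in> power_preimage n \<Sigma> q U"
  using assms unfolding power_preimage_def by blast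

lemma power_preimage_empty [simp]: "power_preimage n \<Sigma> q {} = {}"
  by (simp add: power_preimage_def)

text \<open>\<open>F\<close> fixes the generic point, which lies in every nonempty open set. This
  matters because restriction to the empty set is zero.\<close>

lemma power_preimage_eq_empty_iff:
  assumes "zariski_open n \<Sigma> (U :: 'k::field ratfun set set)" "q > 0"
  shows "power_preimage n \<Sigma> q U = {} \<longleftrightarrow> U = {}"
proof
  assume empty: "power_preimage n \<Sigma> q U = {}"
  show "U = {}"
  proof (rule ccontr)
    assume "U \<noteq> {}"
    then obtain x where "x \<in> U" by blast
    then obtain \<sigma> P where \<sigma>: "\<sigma> \<in> \<Sigma>" "primeideal P (chart_ring n \<sigma> :: 'k laurent ring)"
      "localisation (chart_ring n \<sigma>) P \<in> U"
      using zariski_openE[OF assms(1)] by metis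
    let ?A = "carrier (chart_ring n \<sigma> :: 'k laurent ring)"
    have P: "prime_in ?A P" using \<sigma>(2) by (simp add: primeideal_chart_iff)
    have z: "prime_in ?A {0}" by (intro prime_in_zero subring_of_chart)
    have "{f \<in> ?A. power_map q f \<in> {0}} = {0}"
      using assms(2) by (auto simp: power_map_eq_0_iff)
    moreover have "localisation (chart_ring n \<sigma>) {0} \<in> U"
      using P z by (intro zariski_open_generalise[OF assms(1) \<sigma>(1,2) _ \<sigma>(3)])
        (auto simp: primeideal_chart_iff prime_in_def ideal_in_def simp del: carrier_chart_ring)
    ultimately have "localisation (chart_ring n \<sigma>) {0} \<in> power_preimage n \<Sigma> q U"
      using z \<sigma>(1) by (intro power_preimageI) (simp_all add: primeideal_chart_iff)
    then show False using empty by blast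
  qed
qed simp

text \<open>All primes of the chart over \<open>P\<close> belong to the preimage of
  \<open>U\<close>, so the section is regular at each of them.\<close>

lemma preimage_section:
  fixes U :: "'k::field ratfun set set"
  assumes q: "q > 0" and s: "s \<in> sections (power_preimage n \<Sigma> q U)"
    and \<sigma>: "\<sigma> \<in> \<Sigma>" "primeideal P (chart_ring n \<sigma> :: 'k laurent ring)" "localisation (chart_ring n \<sigma>) P \<in> U"
  obtains f g where "f \<in> carrier (chart_ring n \<sigma>)" "g \<in> carrier (chart_ring n \<sigma>) - P"
    "s = Fract f (power_map q g)"
proof (rule in_all_localisations_over[OF q \<sigma>(2)])
  fix Q assume Q: "primeideal Q (chart_ring n \<sigma> :: 'k laurent ring)"
    and eq: "{f \<in> carrier (chart_ring n \<sigma>). power_map q f \<in> Q} = P"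
  have "localisation (chart_ring n \<sigma>) Q \<in> power_preimage n \<Sigma> q U"
    using \<sigma> Q unfolding eq[symmetric] by (intro power_preimageI)
  then show "s \<in> localisation (chart_ring n \<sigma>) Q"
    using s unfolding sections_def by (auto split: if_splits)
qed (rule that)

section \<open>The splitting given by small representatives\<close>

text \<open>The algebra of the splitting rests on \<open>W\<close> meeting each class once; the
  bound on its elements enters with regularity on charts.\<close>

locale transversal =
  fixes n q :: nat and W :: "lat set"
  assumes q: "q > 0" and finite_W: "finite W" and W_lattice: "W \<subseteq> int_lattice n" and W_zero: "0 \<in> W"
    and W_unique: "u \<in> int_lattice n \<Longrightarrow> \<exists>!w. w \<in> W \<and> (\<exists>k. u + w = frag_cmul (int q) k)"
begin

text \<open>Multiplication by the monomial with exponent \<open>(w, -w)\<close> is invisible on the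
  diagonal but changes which exponents survive \<open>root_map\<close>.\<close>

definition split_map :: "'k::field laurent \<Rightarrow> 'k laurent" where
  "split_map f = (\<Sum>w\<in>W. root_map q (Poly_Mapping.single (pair w (- w)) 1 * f))"

lemma split_map_add: "split_map (f + g) = split_map f + split_map g"
  by (simp add: split_map_def distrib_left root_map_add[OF q] sum.distrib)

lemma split_map_zero [simp]: "split_map 0 = 0"
  using q by (simp add: split_map_def)

lemma split_map_semilinear: "split_map (power_map q g * f) = g * split_map f"
proof -
  have "root_map q (Poly_Mapping.single (pair w (- w)) 1 * (power_map q g * f)) =
      g * root_map q (Poly_Mapping.single (pair w (- w)) 1 * f)" for w
    unfolding mult.left_commute[of _ "power_map q g"] by (rule root_map_semilinear[OF q])
  then show ?thesis by (simp add: split_map_def sum_distrib_left)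
qed

lemma split_map_one: "split_map (1 :: 'k::field laurent) = 1"
proof -
  have "root_map q (Poly_Mapping.single (pair w (- w)) (1::'k)) = (if w = 0 then 1 else 0)" if w: "w \<in> W" for w
  proof (cases "w = 0")
    case True
    then show ?thesis using root_map_single[OF q, of 0 1] by (simp add: lookup_zero)
  next
    case False
    have "pair w (- w) \<noteq> frag_cmul (int q) k" for k
    proof
      assume "pair w (- w) = frag_cmul (int q) k"
      then have "0 + w = frag_cmul (int q) (first_part k)" by (metis add_0 first_part_frag_cmul first_part_pair)
      moreover have "0 + 0 = frag_cmul (int q) 0" by simp
      ultimately have "w = 0" using W_unique[OF int_lattice_zero] w W_zero by blast
      then show False using False by simp
    qed
    then show ?thesis using False by (simp add: root_map_single_nondivisible[OF q])
  qed
  then have "split_map (1::'k laurent) = (\<Sum>w\<in>W. if w = 0 then 1 else 0)" by (simp add: split_map_def)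
  then show ?thesis using finite_W W_zero by simp
qed

lemma split_map_power_map [simp]: "split_map (power_map q g) = g"
  using split_map_semilinear[of g 1] by (simp add: split_map_one)

text \<open>
  For each exponent \<open>(u, u')\<close> exactly one summand survives if \<open>q\<close> divides \<open>u + u'\<close>, and none otherwise.
\<close>

lemma diagonal_split_map:
  assumes "Poly_Mapping.keys f \<subseteq> int_lattice (2 * n)"
  shows "diagonal_map (split_map f) = root_map q (diagonal_map f :: 'k::field laurent)"
proof -
  have single: "diagonal_map (split_map (Poly_Mapping.single u c)) = root_map q (diagonal_map (Poly_Mapping.single u (c::'k)))"
    if u: "u \<in> int_lattice (2 * n)" for u c
  proof -
    let ?r = "\<lambda>w. root_map q (Poly_Mapping.single (pair w (- w) + u) c)"
    have split: "split_map (Poly_Mapping.single u c) = (\<Sum>w\<in>W. ?r w)"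
      by (simp add: split_map_def mult_single)
    have sum: "first_part u + second_part u = frag_cmul (int q) (first_part k + second_part k)"
      if "pair w (- w) + u = frag_cmul (int q) k" for w k
    proof -
      have "w + first_part u = frag_cmul (int q) (first_part k)" "- w + second_part u = frag_cmul (int q) (second_part k)"
        using arg_cong[OF that, of first_part] arg_cong[OF that, of second_part]
        by (simp_all add: first_part_add second_part_add first_part_frag_cmul second_part_frag_cmul)
      then show ?thesis by (simp add: frag_cmul_distrib2 flip: \<open>w + first_part u = _\<close>) (metis add.commute add_diff_cancel_left' diff_add_eq uminus_add_conv_diff)
    qed
    show ?thesis
    proof (cases "\<exists>k. first_part u + second_part u = frag_cmul (int q) k")
      case False
      then have "?r w = 0" for w using sum by (intro root_map_single_nondivisible[OF q]) blast
      then show ?thesis using False q by (simp add: split root_map_single_nondivisible)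
    next
      case True
      then obtain k where k: "first_part u + second_part u = frag_cmul (int q) k" by blast
      have "first_part u \<in> int_lattice n" using u by (simp add: int_lattice_double_iff)
      then obtain w k1 where w: "w \<in> W" "first_part u + w = frag_cmul (int q) k1"
        and uniq: "\<And>w' k'. w' \<in> W \<Longrightarrow> first_part u + w' = frag_cmul (int q) k' \<Longrightarrow> w' = w"
        using W_unique by metis
      have "?r w' = 0" if "w' \<in> W - {w}" for w'
      proof (rule root_map_single_nondivisible[OF q])
        fix l show "pair w' (- w') + u \<noteq> frag_cmul (int q) l"
        proof
          assume "pair w' (- w') + u = frag_cmul (int q) l"
          then have "first_part u + w' = frag_cmul (int q) (first_part l)"
            by (metis add.commute first_part_add first_part_frag_cmul first_part_pair)
          then show False using uniq that by blast
        qed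
      qed
      then have "split_map (Poly_Mapping.single u c) = ?r w"
        unfolding split using finite_W w(1) by (simp add: sum.remove)
      \<comment> \<open>Divisibility of the first component and of the sum gives that of the second,
        with quotient \<open>k - k1\<close>.\<close>
      also have "pair w (- w) + u = frag_cmul (int q) (pair k1 (k - k1))"
      proof -
        have "- w + second_part u = frag_cmul (int q) (k - k1)"
          by (simp add: frag_cmul_diff_distrib2 flip: k w(2))
        moreover have "w + first_part u = frag_cmul (int q) k1" using w(2) by (simp only: add.commute)
        ultimately show ?thesis
          by - (rule parts_eqI, simp_all only: first_part_add second_part_add
            first_part_frag_cmul second_part_frag_cmul first_part_pair second_part_pair)
      qed
      finally have "split_map (Poly_Mapping.single u c) = Poly_Mapping.single (pair k1 (k - k1)) c"
        by (simp add: root_map_single[OF q])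
      then show ?thesis by (simp add: k root_map_single[OF q])
    qed
  qed
  have split_sum: "split_map (\<Sum>u\<in>T. g u) = (\<Sum>u\<in>T. split_map (g u :: 'k laurent))" for T g
    by (induction T rule: infinite_finite_induct) (simp_all add: split_map_add)
  have root_sum: "root_map q (\<Sum>u\<in>T. g u) = (\<Sum>u\<in>T. root_map q (g u :: 'k laurent))" for T g
    by (induction T rule: infinite_finite_induct) (simp_all add: root_map_add q)
  show ?thesis
    by (subst (1 2) laurent_sum[of f])
       (use assms single in \<open>auto simp: split_sum root_sum diagonal_map_sum simp del: diagonal_map_single intro!: sum.cong\<close>)
qed

text \<open>On a generator, \<open>q\<close> times the new value is a nonnegative number plus one
  larger than \<open>-q\<close>; so the value exceeds -1 and, being an integer, is nonnegative. The
  two factors use the bound for \<open>w\<close> and for \<open>-w\<close>.\<close>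

lemma split_map_chart:
  assumes fan: "fan n \<Sigma>" and \<sigma>: "\<sigma> \<in> \<Sigma>" "\<tau> \<in> \<Sigma>"
    and small: "\<And>w v. w \<in> W \<Longrightarrow> v \<in> primitive_generators n \<Sigma> \<Longrightarrow> \<bar>int_pairing w v\<bar> < int q"
    and f: "f \<in> carrier (chart_ring (2 * n) (cone_product \<sigma> \<tau>))"
  shows "split_map f \<in> carrier (chart_ring (2 * n) (cone_product \<sigma> \<tau>) :: 'k::field laurent ring)"
proof -
  have zero: "0 \<in> \<sigma>" "0 \<in> \<tau>" using fan_zero_mem[OF fan] \<sigma> by auto
  have part: "x \<in> dual_monoid n \<rho>"
    if \<rho>: "\<rho> \<in> \<Sigma>" and y: "y \<in> dual_monoid n \<rho>" and eq: "frag_cmul (int q) x = a + y"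
      and a: "a \<in> int_lattice n" "\<And>v. v \<in> primitive_generators n \<Sigma> \<Longrightarrow> - int q < int_pairing a v" for x y a \<rho>
  proof -
    have "frag_cmul (int q) x \<in> int_lattice n"
      unfolding eq using a(1) y by (auto simp: dual_monoid_def intro: int_lattice_add)
    then have xN: "x \<in> int_lattice n" using q int_lattice_frag_cmulD by auto
    have "0 \<le> pairing x (of_lat v)" if v: "v \<in> primitive_generators n \<Sigma>" "of_lat v \<in> \<rho>" for v
    proof -
      have "0 \<le> int_pairing y v" using y v(2) by (auto simp: dual_monoid_def pairing_of_lat)
      moreover have "int q * int_pairing x v = int_pairing a v + int_pairing y v"
        using arg_cong[OF eq, of "\<lambda>u. int_pairing u v"] by (simp add: int_pairing_add int_pairing_frag_cmul)
      ultimately have "int q * (- 1) < int q * int_pairing x v" using a(2)[OF v(1)] by linarith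
      then have "- 1 < int_pairing x v" using q by (subst (asm) mult_less_cancel_left_pos) auto
      then show ?thesis by (simp add: pairing_of_lat)
    qed
    then have "\<forall>z\<in>\<rho>. 0 \<le> pairing x z" using fan_pairing_nonneg[OF fan \<rho>] by blast
    then show ?thesis using xN by (simp add: dual_monoid_def)
  qed
  have "root_map q (Poly_Mapping.single (pair w (- w)) 1 * f) \<in> carrier (chart_ring (2 * n) (cone_product \<sigma> \<tau>))"
    if w: "w \<in> W" for w
    unfolding carrier_chart_ring
  proof (intro CollectI subsetI)
    fix x assume "x \<in> Poly_Mapping.keys (root_map q (Poly_Mapping.single (pair w (- w)) 1 * f))"
    then have "frag_cmul (int q) x \<in> Poly_Mapping.keys (Poly_Mapping.single (pair w (- w)) 1 * f)"
      using q by (simp add: in_keys_iff lookup_root_map)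
    then obtain u where u: "u \<in> Poly_Mapping.keys f" "frag_cmul (int q) x = pair w (- w) + u"
      using keys_mult[of "Poly_Mapping.single (pair w (- w)) 1" f] by (auto split: if_splits)
    have ud: "first_part u \<in> dual_monoid n \<sigma>" "second_part u \<in> dual_monoid n \<tau>"
      using u(1) f dual_monoid_product[OF zero, of u n] by auto
    have eqs: "frag_cmul (int q) (first_part x) = w + first_part u"
      "frag_cmul (int q) (second_part x) = - w + second_part u"
      using arg_cong[OF u(2), of first_part] arg_cong[OF u(2), of second_part]
      by (simp_all add: first_part_add second_part_add first_part_frag_cmul second_part_frag_cmul)
    have wN: "w \<in> int_lattice n" using w W_lattice by blast
    have bound: "- int q < int_pairing w v" "- int q < int_pairing (- w) v"
      if "v \<in> primitive_generators n \<Sigma>" for v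
      using small[OF w that] by (auto simp: int_pairing_uminus)
    have "first_part x \<in> dual_monoid n \<sigma>"
      using bound wN by (intro part[OF \<sigma>(1) ud(1) eqs(1)])
    moreover have "second_part x \<in> dual_monoid n \<tau>"
      using bound int_lattice_uminus[OF wN] by (intro part[OF \<sigma>(2) ud(2) eqs(2)])
    ultimately show "x \<in> dual_monoid (2 * n) (cone_product \<sigma> \<tau>)" by (simp add: dual_monoid_product[OF zero])
  qed
  then show ?thesis
    unfolding split_map_def by (intro subring_of.sum[OF subring_of_chart])
qed

text \<open>Semilinearity dictates the value on a fraction with pulled-back denominator,
  independently of how it is written. By \<open>preimage_section\<close>, sections of the
  pushforward over nonempty open sets have this form.\<close>

definition split_frac :: "'k::field ratfun \<Rightarrow> 'k ratfun" where
  "split_frac s = (THE w. \<forall>f g. g \<noteq> 0 \<and> s = Fract f (power_map q g) \<longrightarrow> w = Fract (split_map f) g)"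

lemma split_frac_Fract:
  assumes "g \<noteq> 0"
  shows "split_frac (Fract f (power_map q g)) = Fract (split_map f) g"
  unfolding split_frac_def
proof (rule the_equality)
  show "\<forall>f' g'. g' \<noteq> 0 \<and> Fract f (power_map q g) = Fract f' (power_map q g') \<longrightarrow>
      Fract (split_map f) g = Fract (split_map f') g'"
  proof (intro allI impI, elim conjE)
    fix f' g' :: "'a laurent"
    assume g': "g' \<noteq> 0" and eq: "Fract f (power_map q g) = Fract f' (power_map q g')"
    then have "f * power_map q g' = f' * power_map q g"
      using assms q by (simp add: eq_fract power_map_nonzero)
    then have "split_map (power_map q g' * f) = split_map (power_map q g * f')" by (simp add: mult.commute)
    then have "g' * split_map f = g * split_map f'" by (simp only: split_map_semilinear)
    then show "Fract (split_map f) g = Fract (split_map f') g'"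
      using assms g' by (simp add: eq_fract mult.commute)
  qed
qed (use assms in blast)

lemma split_frac_zero [simp]: "split_frac 0 = 0"
  using split_frac_Fract[of 1 0] by (simp add: Zero_fract_def)

lemma split_frac_power_pullback: "split_frac (power_pullback q a) = a"
proof (cases a)
  case (Fract f g)
  then show ?thesis using q by (simp add: power_pullback_Fract split_frac_Fract)
qed

lemma split_frac_add:
  assumes "s = Fract f (power_map q g)" "t = Fract f' (power_map q g')" "g \<noteq> 0" "g' \<noteq> 0"
  shows "split_frac (s + t) = split_frac s + split_frac t"
proof -
  have nz: "power_map q g \<noteq> 0" "power_map q g' \<noteq> 0" using assms q by (simp_all add: power_map_nonzero)
  then have "s + t = Fract (power_map q g' * f + power_map q g * f') (power_map q (g * g'))"
    using assms by (simp add: power_map_mult mult.commute)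
  then have "split_frac (s + t) = Fract (split_map (power_map q g' * f + power_map q g * f')) (g * g')"
    using assms by (simp add: split_frac_Fract)
  moreover have "split_map (power_map q g' * f + power_map q g * f') = split_map f * g' + split_map f' * g"
    unfolding split_map_add split_map_semilinear by (simp add: mult.commute)
  ultimately show ?thesis using assms by (simp add: split_frac_Fract)
qed

lemma split_frac_semilinear:
  assumes "s = Fract f (power_map q g)" "g \<noteq> 0"
  shows "split_frac (power_pullback q a * s) = a * split_frac s"
proof (cases a)
  case (Fract f' g')
  then have "power_pullback q a * s = Fract (power_map q f' * f) (power_map q (g' * g))"
    using assms q by (simp add: power_pullback_Fract power_map_mult)
  then show ?thesis
    using assms Fract by (simp add: split_frac_Fract split_map_semilinear)
qed

end

text \<open>The same \<open>split_frac\<close> serves all open sets, so regularity is checked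
  pointwise. For compatibility, vanishing of the numerator is read off at the generic point of the
  diagonal and transferred to the given diagonal point.\<close>

lemma small_representatives_imp_diagonally_split:
  assumes fan: "fan n \<Sigma>" and q: "q > 0"
    and rep: "small_representatives n (primitive_generators n \<Sigma>) q"
  shows "diagonally_split TYPE('k::field) n \<Sigma> q"
proof -
  obtain W where W: "finite W" "W \<subseteq> int_lattice n" "0 \<in> W"
    "\<And>w v. w \<in> W \<Longrightarrow> v \<in> primitive_generators n \<Sigma> \<Longrightarrow> \<bar>int_pairing w v\<bar> < int q"
    "\<And>u. u \<in> int_lattice n \<Longrightarrow> \<exists>!w. w \<in> W \<and> (\<exists>k. u + w = frag_cmul (int q) k)"
    using small_transversal[OF rep q] by blast
  interpret transversal n q W using q W(1-3,5) by unfold_locales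
  let ?\<Sigma> = "fan_product \<Sigma> \<Sigma>"
  let ?R = "\<lambda>\<sigma>. chart_ring (2 * n) \<sigma> :: 'k laurent ring"
  let ?F = "power_preimage (2 * n) ?\<Sigma> q :: 'k ratfun set set \<Rightarrow> _"
  define \<pi> :: "'k ratfun set set \<Rightarrow> 'k ratfun \<Rightarrow> 'k ratfun" where "\<pi> = (\<lambda>U. split_frac)"
  have chart: "split_map f \<in> carrier (?R \<sigma>)" if "\<sigma> \<in> ?\<Sigma>" "f \<in> carrier (?R \<sigma>)" for \<sigma> f
    using that split_map_chart[OF fan _ _ W(4)] unfolding fan_product_def by blast
  have local: "\<exists>f g. g \<noteq> 0 \<and> s = Fract f (power_map q g)"
    if U: "zariski_open (2 * n) ?\<Sigma> U" and s: "s \<in> sections (?F U)" for U s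
  proof (cases "U = {}")
    case True
    then have "s = Fract 0 (power_map q 1)" using s by (simp add: sections_def Zero_fract_def)
    then show ?thesis by (metis one_neq_zero)
  next
    case False
    then obtain x where "x \<in> U" by blast
    then obtain \<sigma> P where \<sigma>: "\<sigma> \<in> ?\<Sigma>" "primeideal P (?R \<sigma>)" "localisation (?R \<sigma>) P \<in> U"
      using zariski_openE[OF U] by metis
    obtain f g where fg: "g \<in> carrier (?R \<sigma>) - P" "s = Fract f (power_map q g)"
      using preimage_section[OF q s \<sigma>] by metis
    then have "g \<noteq> 0" using \<sigma>(2) prime_in_nonzero unfolding primeideal_chart_iff by blast
    then show ?thesis using fg by blast
  qed
  have closed: "\<pi> U s \<in> sections U" if U: "zariski_open (2 * n) ?\<Sigma> U" and s: "s \<in> sections (?F U)" for U s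
  proof (cases "U = {}")
    case True
    then show ?thesis using s by (simp add: sections_def \<pi>_def)
  next
    case False
    have "split_frac s \<in> x" if x: "x \<in> U" for x
    proof -
      obtain \<sigma> P where \<sigma>: "\<sigma> \<in> ?\<Sigma>" "primeideal P (?R \<sigma>)" "x = localisation (?R \<sigma>) P"
        using zariski_openE[OF U x] by metis
      obtain f g where fg: "f \<in> carrier (?R \<sigma>)" "g \<in> carrier (?R \<sigma>) - P" "s = Fract f (power_map q g)"
        using preimage_section[OF q s \<sigma>(1,2)] x \<sigma>(3) by metis
      then have "g \<noteq> 0" using \<sigma>(2) prime_in_nonzero unfolding primeideal_chart_iff by blast
      then have "split_frac s = Fract (split_map f) g" using fg by (simp add: split_frac_Fract)
      then show ?thesis using fg chart[OF \<sigma>(1) fg(1)] unfolding \<sigma>(3) localisation_def by blast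
    qed
    then show ?thesis using False by (simp add: sections_def \<pi>_def)
  qed
  have hom: "pushforward_hom (2 * n) ?\<Sigma> q \<pi>"
    unfolding pushforward_hom_def
  proof (intro conjI allI impI ballI)
    fix U s assume U: "zariski_open (2 * n) ?\<Sigma> U" and s: "s \<in> sections (?F U)"
    show "\<pi> U s \<in> sections U" by (rule closed[OF U s])
    show "\<pi> U (power_pullback q a * s) = a * \<pi> U s" for a
      using local[OF U s] split_frac_semilinear unfolding \<pi>_def by blast
    show "\<pi> U (s + t) = \<pi> U s + \<pi> U t" if t: "t \<in> sections (?F U)" for t
      using local[OF U s] local[OF U t] split_frac_add unfolding \<pi>_def by blast
  next
    fix U V s assume *: "zariski_open (2 * n) ?\<Sigma> U \<and> zariski_open (2 * n) ?\<Sigma> V \<and> V \<subseteq> U" "s \<in> sections (?F U)"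
    then show "\<pi> V (restr (?F V) s) = restr V (\<pi> U s)"
      using power_preimage_eq_empty_iff[OF _ q, of "2 * n" ?\<Sigma> V] by (simp add: restr_def \<pi>_def)
  qed
  have splitting: "splitting (2 * n) ?\<Sigma> q \<pi>"
    unfolding splitting_def using hom by (simp add: \<pi>_def split_frac_power_pullback)
  have compatible: "compatible_with (2 * n) ?\<Sigma> q \<pi> (diagonal n \<Sigma>)"
    unfolding compatible_with_def
  proof (intro allI impI ballI)
    fix U s assume U: "zariski_open (2 * n) ?\<Sigma> U" and sI: "s \<in> ideal_sections (diagonal n \<Sigma>) (?F U)"
    have s: "s \<in> sections (?F U)" using sI by (simp add: ideal_sections_def)
    have "\<pi> U s \<in> max_ideal y" if y: "y \<in> U" "y \<in> diagonal n \<Sigma>" for y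
    proof -
      obtain \<sigma> P where \<sigma>: "\<sigma> \<in> \<Sigma>" and P: "primeideal P (chart_ring n \<sigma> :: 'k laurent ring)"
        and y_eq: "y = localisation (?R (cone_product \<sigma> \<sigma>))
          {f \<in> carrier (?R (cone_product \<sigma> \<sigma>)). diagonal_map f \<in> P}"
        using y(2) unfolding diagonal_def by blast
      have zero: "0 \<in> \<sigma>" using fan_zero_mem[OF fan \<sigma>] .
      let ?A = "carrier (?R (cone_product \<sigma> \<sigma>))"
      define P' where "P' = {f \<in> ?A. diagonal_map f \<in> P}"
      \<comment> \<open>The generic point of the diagonal in this chart. Generisation puts it in
        \<open>U\<close>, and \<open>F\<close> fixes it, so it also lies in the preimage.\<close>
      define K where "K = {f \<in> ?A. diagonal_map f \<in> {0}}"
      have Pp: "prime_in (carrier (chart_ring n \<sigma> :: 'k laurent ring)) P"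
        using P by (simp add: primeideal_chart_iff)
      have zp: "prime_in (carrier (chart_ring n \<sigma> :: 'k laurent ring)) {0}"
        by (intro prime_in_zero subring_of_chart)
      have P': "prime_in ?A P'" unfolding P'_def by (rule diagonal_prime[OF zero Pp])
      have K: "prime_in ?A K" unfolding K_def by (rule diagonal_prime[OF zero zp])
      have "0 \<in> P" using Pp by (simp add: prime_in_def ideal_in_def)
      then have KP': "K \<subseteq> P'" by (auto simp: K_def P'_def)
      have \<sigma>2: "cone_product \<sigma> \<sigma> \<in> ?\<Sigma>" using \<sigma> by (auto simp: fan_product_def)
      have locP': "localisation (?R (cone_product \<sigma> \<sigma>)) P' \<in> U" using y(1) unfolding y_eq P'_def .
      have P'i: "primeideal P' (?R (cone_product \<sigma> \<sigma>))" "primeideal K (?R (cone_product \<sigma> \<sigma>))"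
        using P' K by (simp_all add: primeideal_chart_iff)
      obtain f g where fg: "f \<in> ?A" "g \<in> ?A - P'" "s = Fract f (power_map q g)"
        using preimage_section[OF q s \<sigma>2 P'i(1) locP'] by metis
      have "localisation (?R (cone_product \<sigma> \<sigma>)) K \<in> U"
        by (rule zariski_open_generalise[OF U \<sigma>2 P'i locP' KP'])
      moreover have "{f \<in> ?A. power_map q f \<in> K} = K"
        using q power_map_chart[of _ "2 * n" "cone_product \<sigma> \<sigma>" q]
        by (auto simp: K_def diagonal_map_power_map power_map_eq_0_iff simp del: carrier_chart_ring)
      ultimately have locK: "localisation (?R (cone_product \<sigma> \<sigma>)) K \<in> ?F U"
        using P'i \<sigma>2 by (intro power_preimageI) simp_all
      moreover have "localisation (?R (cone_product \<sigma> \<sigma>)) K \<in> diagonal n \<Sigma>"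
        using \<sigma> zp unfolding diagonal_def K_def primeideal_chart_iff by blast
      ultimately have "s \<in> max_ideal (localisation (?R (cone_product \<sigma> \<sigma>)) K)"
        using sI by (simp add: ideal_sections_def)
      moreover have "power_map q g \<in> ?A - K"
      proof -
        \<comment> \<open>\<open>g\<close> does not vanish at a point of the diagonal, so its
          restriction to the diagonal is not identically zero.\<close>
        have "diagonal_map g \<noteq> 0" using fg(2) \<open>0 \<in> P\<close> by (auto simp: P'_def)
        then have "diagonal_map (power_map q g) \<noteq> 0"
          using q by (simp add: diagonal_map_power_map power_map_nonzero)
        then show ?thesis using fg(2) power_map_chart[of g] by (auto simp: K_def simp del: carrier_chart_ring)
      qed
      ultimately have "f \<in> K" using max_ideal_Fract_iff[OF K fg(1)] fg(3) by blast
      then have "diagonal_map f = 0" by (simp add: K_def)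
      moreover have "Poly_Mapping.keys f \<subseteq> int_lattice (2 * n)" using fg(1) by (auto simp: dual_monoid_def)
      ultimately have "diagonal_map (split_map f) = 0" using diagonal_split_map[of f] q by simp
      then have "split_map f \<in> P'" using chart[OF \<sigma>2 fg(1)] \<open>0 \<in> P\<close> by (simp add: P'_def)
      then have "Fract (split_map f) g \<in> max_ideal (localisation (?R (cone_product \<sigma> \<sigma>)) P')"
        using max_ideal_Fract_iff[OF P' chart[OF \<sigma>2 fg(1)] fg(2)] by simp
      moreover have "g \<noteq> 0" using fg(2) P' by (auto dest: prime_in_nonzero)
      ultimately show ?thesis by (simp add: \<pi>_def fg(3) split_frac_Fract y_eq P'_def)
    qed
    then show "\<pi> U s \<in> ideal_sections (diagonal n \<Sigma>) U"
      using closed[OF U s] by (simp add: ideal_sections_def)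
  qed
  show ?thesis unfolding diagonally_split_def using splitting compatible by blast
qed

section \<open>Open sets defined by monomials\<close>

abbreviation monomial :: "lat \<Rightarrow> 'k::field ratfun" where
  "monomial u \<equiv> Fract (Poly_Mapping.single u 1) 1"

lemma monomial_add: "monomial (u + v) = monomial u * monomial v"
  by (simp add: mult_single)

lemma power_pullback_monomial: "q > 0 \<Longrightarrow> power_pullback q (monomial u) = monomial (frag_cmul (int q) u)"
  by (simp add: power_pullback_Fract)

lemma lookup_single_mult:
  "Poly_Mapping.lookup (Poly_Mapping.single h 1 * g) (h + m) = Poly_Mapping.lookup g m"
  for g :: "'k::field laurent"
proof -
  have "Poly_Mapping.single h 1 * g = (\<Sum>u\<in>Poly_Mapping.keys g. Poly_Mapping.single (u + h) (Poly_Mapping.lookup g u))"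
    by (subst mult.commute) (rule single_mult_sum)
  then have "Poly_Mapping.lookup (Poly_Mapping.single h 1 * g) (h + m) =
      (\<Sum>u\<in>Poly_Mapping.keys g. if u = m then Poly_Mapping.lookup g u else 0)"
    by (simp add: lookup_sum lookup_single when_def add.commute[of h m])
  then show ?thesis by (simp add: in_keys_iff)
qed

lemma subring_of_localisation:
  fixes n :: nat and \<sigma> :: "rvec set"
  assumes "primeideal P (chart_ring n \<sigma> :: 'k::field laurent ring)"
  shows "subring_of (localisation (chart_ring n \<sigma>) P)"
proof -
  let ?A = "carrier (chart_ring n \<sigma> :: 'k laurent ring)"
  have P: "prime_in ?A P" using assms by (simp add: primeideal_chart_iff)
  interpret A: subring_of ?A by (rule subring_of_chart)
  have loc: "x \<in> localisation (chart_ring n \<sigma>) P \<longleftrightarrow> (\<exists>f g. x = Fract f g \<and> f \<in> ?A \<and> g \<in> ?A - P)" for x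
    unfolding localisation_def by blast
  have m: "g * g' \<in> ?A - P" if "g \<in> ?A - P" "g' \<in> ?A - P" for g g'
    using that prime_in_mult_notin[OF P] A.mult by blast
  have nz: "g \<noteq> 0" if "g \<in> ?A - P" for g using that P prime_in_nonzero by blast
  show ?thesis
  proof
    have "1 \<in> ?A - P" using P A.one by (simp add: prime_in_def)
    then show "1 \<in> localisation (chart_ring n \<sigma>) P"
      unfolding loc One_fract_def using A.one by blast
    fix x y assume "x \<in> localisation (chart_ring n \<sigma>) P"
    then obtain f g where x: "x = Fract f g" "f \<in> ?A" "g \<in> ?A - P" unfolding loc by blast
    show "- x \<in> localisation (chart_ring n \<sigma>) P"
      unfolding loc x(1) minus_fract using x A.uminus by blast
    assume "y \<in> localisation (chart_ring n \<sigma>) P"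
    then obtain f' g' where y: "y = Fract f' g'" "f' \<in> ?A" "g' \<in> ?A - P" unfolding loc by blast
    have "x * y = Fract (f * f') (g * g')" using x y by simp
    then show "x * y \<in> localisation (chart_ring n \<sigma>) P"
      unfolding loc using m[OF x(3) y(3)] A.mult[OF x(2) y(2)] by blast
    have "x + y = Fract (f * g' + f' * g) (g * g')" using x y nz by simp
    moreover have "f * g' + f' * g \<in> ?A" using x y by (intro A.add A.mult) auto
    ultimately show "x + y \<in> localisation (chart_ring n \<sigma>) P"
      unfolding loc using m[OF x(3) y(3)] by blast
  qed
qed

lemma Fract_in_localisation:
  assumes "primeideal P (chart_ring n \<sigma> :: 'k::field laurent ring)" "f \<in> carrier (chart_ring n \<sigma>)"
  shows "Fract f 1 \<in> localisation (chart_ring n \<sigma>) P"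
proof -
  have "1 \<in> carrier (chart_ring n \<sigma>) - P"
    using assms(1) subring_of.one[OF subring_of_chart] unfolding primeideal_chart_iff prime_in_def by blast
  then show ?thesis using assms(2) unfolding localisation_def by blast
qed

text \<open>If \<open>x^h = f/g\<close> with \<open>g\<close> outside \<open>P\<close>, some
  monomial of \<open>g\<close> is outside \<open>P\<close>, and its shift by \<open>h\<close> occurs
  in \<open>f\<close>. So regularity of a monomial depends on \<open>P\<close> through the monomials
  it contains.\<close>

lemma monomial_in_localisation_iff:
  fixes n :: nat and \<sigma> :: "rvec set"
  assumes "primeideal P (chart_ring n \<sigma> :: 'k::field laurent ring)"
  shows "monomial h \<in> localisation (chart_ring n \<sigma>) P \<longleftrightarrow>
    (\<exists>m\<in>dual_monoid n \<sigma>. Poly_Mapping.single m 1 \<notin> P \<and> h + m \<in> dual_monoid n \<sigma>)"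
proof
  let ?A = "carrier (chart_ring n \<sigma> :: 'k laurent ring)"
  have P: "prime_in ?A P" using assms by (simp add: primeideal_chart_iff)
  interpret A: subring_of ?A by (rule subring_of_chart)
  assume "monomial h \<in> localisation (chart_ring n \<sigma>) P"
  then obtain f g where fg: "monomial h = Fract f g" "f \<in> ?A" "g \<in> ?A - P"
    unfolding localisation_def by blast
  have "g \<noteq> 0" using fg(3) P prime_in_nonzero by blast
  then have f: "f = Poly_Mapping.single h 1 * g" using fg(1) by (simp add: eq_fract)
  have "\<exists>m\<in>Poly_Mapping.keys g. Poly_Mapping.single m (1::'k) \<notin> P"
  proof (rule ccontr)
    assume neg: "\<not> ?thesis"
    have id: "ideal_in ?A P" using P by (simp add: prime_in_def)
    have "Poly_Mapping.single m c \<in> P" if m: "m \<in> Poly_Mapping.keys g" for m c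
    proof -
      have "Poly_Mapping.single 0 c \<in> ?A" using dual_monoid_zero by (rule single_in_chart)
      then have "Poly_Mapping.single 0 c * Poly_Mapping.single m 1 \<in> P"
        using id neg m unfolding ideal_in_def by blast
      then show ?thesis by (simp add: mult_single)
    qed
    then have "(\<Sum>m\<in>Poly_Mapping.keys g. Poly_Mapping.single m (Poly_Mapping.lookup g m)) \<in> P"
      by (intro A.ideal_sum[OF id])
    then have "g \<in> P" by (simp flip: laurent_sum)
    then show False using fg(3) by simp
  qed
  then obtain m where m: "m \<in> Poly_Mapping.keys g" "Poly_Mapping.single m (1::'k) \<notin> P" by blast
  have "h + m \<in> Poly_Mapping.keys f" using m(1) by (simp add: f in_keys_iff lookup_single_mult)
  then show "\<exists>m\<in>dual_monoid n \<sigma>. Poly_Mapping.single m 1 \<notin> P \<and> h + m \<in> dual_monoid n \<sigma>"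
    using m fg(2,3) by auto
next
  assume "\<exists>m\<in>dual_monoid n \<sigma>. Poly_Mapping.single m 1 \<notin> P \<and> h + m \<in> dual_monoid n \<sigma>"
  then obtain m where m: "m \<in> dual_monoid n \<sigma>" "Poly_Mapping.single m (1::'k) \<notin> P" "h + m \<in> dual_monoid n \<sigma>"
    by blast
  have "Poly_Mapping.single m (1::'k) \<noteq> 0" by (metis lookup_single_eq lookup_zero one_neq_zero)
  then have "monomial h = Fract (Poly_Mapping.single (h + m) 1) (Poly_Mapping.single m (1::'k))"
    by (simp add: eq_fract mult_single)
  then show "monomial h \<in> localisation (chart_ring n \<sigma>) P"
    using single_in_chart[OF m(1)] single_in_chart[OF m(3)] m(2) unfolding localisation_def by blast
qed

text \<open>Described through local rings, so that openness can be tested in each chart without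
  comparing charts. If \<open>H\<close> generates the dual monoid of \<open>\<tau>\<close>, this set
  plays the role of the chart of \<open>\<tau>\<close>.\<close>

definition monomial_open :: "nat \<Rightarrow> rvec set set \<Rightarrow> lat set \<Rightarrow> 'k::field ratfun set set" where
  "monomial_open n \<Sigma> H = {x \<in> points n \<Sigma>. \<forall>h\<in>H. monomial h \<in> x}"

lemma pointsI:
  "\<sigma> \<in> \<Sigma> \<Longrightarrow> primeideal P (chart_ring n \<sigma> :: 'k::field laurent ring) \<Longrightarrow> localisation (chart_ring n \<sigma>) P \<in> points n \<Sigma>"
  unfolding points_def by blast

text \<open>In each chart the complement is cut out by the common denominators of the monomials;
  finiteness of \<open>H\<close> allows multiplying individual denominators.\<close>

lemma zariski_open_monomial_open:
  assumes "finite H"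
  shows "zariski_open n \<Sigma> (monomial_open n \<Sigma> H :: 'k::field ratfun set set)"
  unfolding zariski_open_def
proof (intro conjI ballI)
  show "monomial_open n \<Sigma> H \<subseteq> points n \<Sigma>" by (auto simp: monomial_open_def)
  fix \<sigma> assume \<sigma>: "\<sigma> \<in> \<Sigma>"
  let ?A = "carrier (chart_ring n \<sigma> :: 'k laurent ring)"
  interpret A: subring_of ?A by (rule subring_of_chart)
  let ?J = "{g \<in> ?A. \<forall>h\<in>H. Poly_Mapping.single h 1 * g \<in> ?A}"
  have "localisation (chart_ring n \<sigma>) P \<in> monomial_open n \<Sigma> H \<longleftrightarrow> \<not> ?J \<subseteq> P"
    if Pi: "primeideal P (chart_ring n \<sigma> :: 'k laurent ring)" for P
  proof
    have P: "prime_in ?A P" using Pi by (simp add: primeideal_chart_iff)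
    show "\<not> ?J \<subseteq> P" if "localisation (chart_ring n \<sigma>) P \<in> monomial_open n \<Sigma> H"
    proof -
      have "\<exists>f g. f \<in> ?A \<and> g \<in> ?A - P \<and> Poly_Mapping.single h 1 * g = f" if h: "h \<in> H" for h
      proof -
        have "monomial h \<in> localisation (chart_ring n \<sigma>) P"
          using h \<open>localisation (chart_ring n \<sigma>) P \<in> monomial_open n \<Sigma> H\<close> by (simp add: monomial_open_def)
        then obtain f g where fg: "monomial h = Fract f g" "f \<in> ?A" "g \<in> ?A - P"
          unfolding localisation_def by blast
        have "g \<noteq> 0" using fg(3) P prime_in_nonzero by blast
        then have "Poly_Mapping.single h 1 * g = f" using fg(1) by (simp add: eq_fract)
        then show ?thesis using fg by blast
      qed
      then obtain g where g: "\<And>h. h \<in> H \<Longrightarrow> g h \<in> ?A - P" "\<And>h. h \<in> H \<Longrightarrow> Poly_Mapping.single h 1 * g h \<in> ?A"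
        by metis
      have prod: "prod g H \<in> ?A - P" using A.prime_prod[OF P assms g(1)] .
      have "Poly_Mapping.single h 1 * prod g H \<in> ?A" if h: "h \<in> H" for h
      proof -
        have "prod g (H - {h}) \<in> ?A - P"
          by (rule A.prime_prod[OF P]) (use assms g(1) in auto)
        then have "(Poly_Mapping.single h 1 * g h) * prod g (H - {h}) \<in> ?A"
          using g(2)[OF h] A.mult by blast
        then show ?thesis using assms h by (simp add: prod.remove[of H h] mult.assoc)
      qed
      then show ?thesis using prod by blast
    qed
    show "localisation (chart_ring n \<sigma>) P \<in> monomial_open n \<Sigma> H" if nonsub: "\<not> ?J \<subseteq> P"
    proof -
      obtain g where g: "g \<in> ?A - P" "\<forall>h\<in>H. Poly_Mapping.single h 1 * g \<in> ?A" using nonsub by blast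
      have "g \<noteq> 0" using g(1) P prime_in_nonzero by blast
      then have "monomial h = Fract (Poly_Mapping.single h 1 * g) g" for h by (simp add: eq_fract)
      then have "monomial h \<in> localisation (chart_ring n \<sigma>) P" if "h \<in> H" for h
        using g that unfolding localisation_def by blast
      then show ?thesis using pointsI[OF \<sigma> Pi] by (simp add: monomial_open_def)
    qed
  qed
  moreover have "?J \<subseteq> ?A" by blast
  ultimately show "\<exists>J\<subseteq>?A. \<forall>P. primeideal P (chart_ring n \<sigma>) \<longrightarrow>
      (localisation (chart_ring n \<sigma>) P \<in> monomial_open n \<Sigma> H \<longleftrightarrow> \<not> J \<subseteq> P)" by blast
qed

lemma power_map_contraction_prime:
  assumes "prime_in (carrier (chart_ring n \<sigma> :: 'k::field laurent ring)) P"
  shows "prime_in (carrier (chart_ring n \<sigma>)) {f \<in> carrier (chart_ring n \<sigma>). power_map q f \<in> P}"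
proof -
  interpret A: subring_of "carrier (chart_ring n \<sigma> :: 'k laurent ring)" by (rule subring_of_chart)
  have "power_map q f \<in> carrier (chart_ring n \<sigma>)" if "f \<in> carrier (chart_ring n \<sigma>)" for f :: "'k laurent"
    using that by (rule power_map_chart)
  then show ?thesis
    using assms A.zero A.add A.mult
    unfolding prime_in_def ideal_in_def
    by (auto simp: power_map_add power_map_mult simp del: carrier_chart_ring)
qed

text \<open>A prime contains \<open>x^{q m}\<close> exactly when it contains \<open>x^m\<close>, so
  a point and its image under \<open>F\<close> have the same regular monomials.\<close>

lemma power_preimage_monomial_open:
  assumes q: "q > 0"
  shows "power_preimage n \<Sigma> q (monomial_open n \<Sigma> H) = (monomial_open n \<Sigma> H :: 'k::field ratfun set set)"
proof -
  have iff: "localisation (chart_ring n \<sigma>) {f \<in> carrier (chart_ring n \<sigma>). power_map q f \<in> P} \<in> monomial_open n \<Sigma> H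
      \<longleftrightarrow> localisation (chart_ring n \<sigma>) P \<in> monomial_open n \<Sigma> H"
    if \<sigma>: "\<sigma> \<in> \<Sigma>" and Pi: "primeideal P (chart_ring n \<sigma> :: 'k laurent ring)" for \<sigma> P
  proof -
    let ?A = "carrier (chart_ring n \<sigma> :: 'k laurent ring)"
    let ?C = "{f \<in> ?A. power_map q f \<in> P}"
    interpret A: subring_of ?A by (rule subring_of_chart)
    have P: "prime_in ?A P" using Pi by (simp add: primeideal_chart_iff)
    have Ci: "primeideal ?C (chart_ring n \<sigma>)"
      using power_map_contraction_prime[OF P] by (simp add: primeideal_chart_iff)
    have "Poly_Mapping.single m 1 \<notin> ?C \<longleftrightarrow> Poly_Mapping.single m 1 \<notin> P" if m: "m \<in> dual_monoid n \<sigma>" for m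
    proof -
      let ?x = "Poly_Mapping.single m (1::'k)"
      have xA: "?x \<in> ?A" using m by (rule single_in_chart)
      have pow: "?x ^ k = Poly_Mapping.single (frag_cmul (int k) m) 1" for k
        by (induction k) (simp_all add: mult_single frag_cmul_distrib single_one[symmetric] del: single_one)
      have powA: "?x ^ k \<in> ?A" for k
        by (induction k) (use xA A.one A.mult in \<open>auto simp del: carrier_chart_ring\<close>)
      have "?x ^ k \<in> P \<longleftrightarrow> ?x \<in> P" if "k > 0" for k
        using that
      proof (induction k)
        case (Suc k)
        have "?x \<in> P \<or> ?x ^ k \<in> P" if "?x * ?x ^ k \<in> P"
          using P that xA powA by (simp add: prime_in_def del: carrier_chart_ring)
        moreover have "?x ^ k * ?x \<in> P" if "?x \<in> P"
          using P that powA[of k] by (simp add: prime_in_def ideal_in_def del: carrier_chart_ring)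
        moreover have "1 \<notin> P" using P by (simp add: prime_in_def)
        ultimately show ?case using Suc.IH by (cases k) (auto simp: mult.commute)
      qed simp
      from this[OF q] show ?thesis using xA by (simp add: pow)
    qed
    then have "monomial h \<in> localisation (chart_ring n \<sigma>) ?C \<longleftrightarrow> monomial h \<in> localisation (chart_ring n \<sigma>) P" for h
      unfolding monomial_in_localisation_iff[OF Ci] monomial_in_localisation_iff[OF Pi] by blast
    then show ?thesis using pointsI[OF \<sigma> Pi] pointsI[OF \<sigma> Ci] by (simp add: monomial_open_def)
  qed
  show ?thesis
  proof (intro equalityI subsetI)
    fix x :: "'k ratfun set" assume "x \<in> power_preimage n \<Sigma> q (monomial_open n \<Sigma> H)"
    then show "x \<in> monomial_open n \<Sigma> H" unfolding power_preimage_def using iff by blast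
  next
    fix x :: "'k ratfun set" assume x: "x \<in> monomial_open n \<Sigma> H"
    then obtain \<sigma> P where \<sigma>: "\<sigma> \<in> \<Sigma>" "primeideal P (chart_ring n \<sigma> :: 'k laurent ring)" "x = localisation (chart_ring n \<sigma>) P"
      unfolding monomial_open_def points_def by blast
    then show "x \<in> power_preimage n \<Sigma> q (monomial_open n \<Sigma> H)"
      using x iff[OF \<sigma>(1,2)] by (auto intro: power_preimageI)
  qed
qed

lemma frag_cmul_negative: "c < 0 \<Longrightarrow> frag_cmul (int (nat (- c))) (- x) = frag_cmul c x"
  by (rule poly_mapping_eqI) simp

definition generates_monoid :: "lat set \<Rightarrow> lat set \<Rightarrow> bool" where
  "generates_monoid H M \<longleftrightarrow> (\<forall>D. 0 \<in> D \<and> (\<forall>a\<in>D. \<forall>b\<in>D. a + b \<in> D) \<and> H \<subseteq> D \<longrightarrow> M \<subseteq> D)"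

lemma monomial_open_regular:
  assumes "generates_monoid H (dual_monoid n \<tau>)" "x \<in> monomial_open n \<Sigma> H"
    "f \<in> carrier (chart_ring n \<tau> :: 'k::field laurent ring)"
  shows "Fract f 1 \<in> x"
proof -
  obtain \<sigma> P where \<sigma>: "\<sigma> \<in> \<Sigma>" "primeideal P (chart_ring n \<sigma> :: 'k laurent ring)" "x = localisation (chart_ring n \<sigma>) P"
    using assms(2) unfolding monomial_open_def points_def by blast
  interpret subring_of x unfolding \<sigma>(3) by (rule subring_of_localisation[OF \<sigma>(2)])
  have "dual_monoid n \<tau> \<subseteq> {u. monomial u \<in> x}"
    using assms(1) unfolding generates_monoid_def
  proof (elim allE impE)
    show "0 \<in> {u. monomial u \<in> x} \<and> (\<forall>a\<in>{u. monomial u \<in> x}. \<forall>b\<in>{u. monomial u \<in> x}. a + b \<in> {u. monomial u \<in> x}) \<and> H \<subseteq> {u. monomial u \<in> x}"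
      using assms(2) one mult by (auto simp: monomial_add monomial_open_def simp del: mult_fract simp flip: One_fract_def)
  qed
  then have mono: "monomial u \<in> x" if "u \<in> Poly_Mapping.keys f" for u using that assms(3) by auto
  have const: "Fract (Poly_Mapping.single 0 c) 1 \<in> x" for c
    unfolding \<sigma>(3) by (intro Fract_in_localisation[OF \<sigma>(2)] single_in_chart dual_monoid_zero)
  have "Fract (\<Sum>u\<in>T. g u) 1 = (\<Sum>u\<in>T. Fract (g u) 1)" for g :: "lat \<Rightarrow> 'k laurent" and T
  proof (induction T rule: infinite_finite_induct)
    case (insert i T)
    then show ?case by (simp flip: insert.IH)
  qed (simp_all add: Zero_fract_def)
  then have "Fract f 1 = (\<Sum>u\<in>Poly_Mapping.keys f. Fract (Poly_Mapping.single u (Poly_Mapping.lookup f u)) 1)"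
    by (subst laurent_sum) blast
  also have "\<dots> = (\<Sum>u\<in>Poly_Mapping.keys f. Fract (Poly_Mapping.single 0 (Poly_Mapping.lookup f u)) 1 * monomial u)"
    by (simp add: mult_single)
  also have "\<dots> \<in> x" by (intro sum mult const mono)
  finally show ?thesis .
qed

text \<open>All points of the chart of \<open>\<tau>\<close> lie in this set, and the intersection
  of their local rings is the chart ring. Conversely the chart ring is regular at every point of the
  set.\<close>

lemma sections_monomial_open:
  assumes "\<tau> \<in> \<Sigma>" "H \<subseteq> dual_monoid n \<tau>" "generates_monoid H (dual_monoid n \<tau>)"
  shows "sections (monomial_open n \<Sigma> H) =
    (\<lambda>f. Fract f 1) ` carrier (chart_ring n \<tau> :: 'k::field laurent ring)"
    and "monomial_open n \<Sigma> H \<noteq> ({} :: 'k ratfun set set)"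
proof -
  let ?U = "monomial_open n \<Sigma> H :: 'k ratfun set set"
  have mem: "localisation (chart_ring n \<tau>) P \<in> ?U" if "primeideal P (chart_ring n \<tau> :: 'k laurent ring)" for P
    using pointsI[OF assms(1) that] Fract_in_localisation[OF that] assms(2)
    by (auto simp: monomial_open_def)
  have "primeideal {0} (chart_ring n \<tau> :: 'k laurent ring)"
    unfolding primeideal_chart_iff by (intro prime_in_zero subring_of_chart)
  from mem[OF this] show ne: "?U \<noteq> {}" by blast
  show "sections ?U = (\<lambda>f. Fract f 1) ` carrier (chart_ring n \<tau>)"
  proof (intro equalityI subsetI)
    fix s assume "s \<in> sections ?U"
    then have "s \<in> localisation (chart_ring n \<tau>) P" if "primeideal P (chart_ring n \<tau> :: 'k laurent ring)" for P
      using mem[OF that] ne by (simp add: sections_def)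
    then show "s \<in> (\<lambda>f. Fract f 1) ` carrier (chart_ring n \<tau>)"
      using in_all_localisations[of n \<tau> s] by blast
  next
    fix s assume "s \<in> (\<lambda>f. Fract f 1) ` carrier (chart_ring n \<tau> :: 'k laurent ring)"
    then show "s \<in> sections ?U"
      using ne monomial_open_regular[OF assms(3)] by (auto simp: sections_def simp del: carrier_chart_ring)
  qed
qed

section \<open>Representatives from a splitting\<close>

text \<open>Division with remainder shows that the least positive value \<open>d\<close> attained on
  \<open>v\<close> divides all its coordinates; then \<open>v / d\<close> is a lattice point of the
  ray, and primitivity gives \<open>d = 1\<close>.\<close>

lemma primitive_pairing_one:
  assumes "v \<in> primitive_generators n \<Sigma>"
  obtains k where "k \<in> int_lattice n" "int_pairing k v = 1"
proof -
  have v: "v \<in> int_lattice n" "v \<noteq> 0" using assms by (auto simp: primitive_generators_def)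
  obtain j where j: "Poly_Mapping.lookup v j \<noteq> 0"
    using v(2) by (auto simp: poly_mapping_eq_iff fun_eq_iff)
  then have "j < n" using v(1) by (auto simp: int_lattice_iff not_le[symmetric])
  define Q where "Q = (\<lambda>d::nat. d > 0 \<and> (\<exists>k\<in>int_lattice n. int_pairing k v = int d))"
  have "Q (nat \<bar>Poly_Mapping.lookup v j\<bar>)"
  proof -
    have "int_pairing (frag_cmul (sgn (Poly_Mapping.lookup v j)) (frag_of j)) v = \<bar>Poly_Mapping.lookup v j\<bar>"
      by (simp add: int_pairing_frag_cmul abs_sgn mult.commute)
    moreover have "frag_cmul (sgn (Poly_Mapping.lookup v j)) (frag_of j) \<in> int_lattice n"
      using \<open>j < n\<close> by (intro int_lattice_frag_cmul int_lattice_frag_of)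
    ultimately show ?thesis using j unfolding Q_def by auto
  qed
  then obtain d where d: "Q d" and min: "\<And>d'. Q d' \<Longrightarrow> d \<le> d'"
    by (metis LeastI_ex Least_le)
  then obtain k where k: "k \<in> int_lattice n" "int_pairing k v = int d" by (auto simp: Q_def)
  have d0: "d > 0" using d by (simp add: Q_def)
  have dvd: "int d dvd Poly_Mapping.lookup v i" for i
  proof (cases "i < n")
    case True
    define r where "r = frag_of i - frag_cmul (Poly_Mapping.lookup v i div int d) k"
    have r: "r \<in> int_lattice n" "int_pairing r v = Poly_Mapping.lookup v i mod int d"
      using k True by (auto simp: r_def int_pairing_diff int_pairing_frag_cmul minus_div_mult_eq_mod
          intro: int_lattice_diff int_lattice_frag_cmul int_lattice_frag_of)
    have "Poly_Mapping.lookup v i mod int d = 0"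
    proof (rule ccontr)
      assume nz: "Poly_Mapping.lookup v i mod int d \<noteq> 0"
      have ge: "0 \<le> Poly_Mapping.lookup v i mod int d" and lt: "Poly_Mapping.lookup v i mod int d < int d"
        using d0 by simp_all
      have "Q (nat (Poly_Mapping.lookup v i mod int d))"
        unfolding Q_def using r nz ge by (auto intro!: bexI[of _ r])
      from min[OF this] show False using ge lt by linarith
    qed
    then show ?thesis by (rule dvd_eq_mod_eq_0[THEN iffD2])
  next
    case False
    then show ?thesis using v(1) by (simp add: int_lattice_iff)
  qed
  then obtain v' where v': "v = frag_cmul (int d) v'" using frag_cmul_iff_dvd[of v "int d"] by blast
  then have v'N: "v' \<in> int_lattice n" using v(1) d0 int_lattice_frag_cmulD[of "int d" v' n] by simp
  have "of_lat v' = (1 / real d) *\<^sub>R of_lat v" using d0 by (simp add: v' of_lat_frag_cmul)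
  then have "of_lat v' \<in> ray (of_lat v)" unfolding ray_def by (intro CollectI exI[of _ "1 / real d"]) auto
  then obtain l :: nat where "v' = frag_cmul (int l) v" using assms v'N by (auto simp: primitive_generators_def)
  then have "frag_cmul (int d * int l) v = v" using v' by (metis frag_cmul_cmul)
  then have "frag_cmul (int d * int l - 1) v = 0" by (simp add: frag_cmul_diff_distrib)
  then have "int d * int l = 1" using v(2) by simp
  then have "d = 1" by (simp add: zmult_eq_1_iff)
  then show thesis using k that by simp
qed

text \<open>As \<open>l k = 1\<close>, the half-space is the kernel of \<open>l\<close> plus the
  natural multiples of \<open>k\<close>, and projecting the basis along \<open>k\<close> generates
  the kernel. Finiteness makes the associated \<open>monomial_open\<close> Zariski open.\<close>

lemma generates_monoid_half_space:
  fixes l :: "lat \<Rightarrow> int"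
  assumes l: "\<And>u v. l (u + v) = l u + l v" "\<And>c u. l (frag_cmul c u) = c * l u"
    and k: "k \<in> int_lattice n" "l k = 1"
  obtains H where "finite H" "H \<subseteq> {u \<in> int_lattice n. 0 \<le> l u}"
    "generates_monoid H {u \<in> int_lattice n. 0 \<le> l u}"
proof
  let ?e = "\<lambda>i. frag_of i - frag_cmul (l (frag_of i)) k :: lat"
  let ?H = "insert k (?e ` {..<n} \<union> (\<lambda>i. - ?e i) ` {..<n})"
  show "finite ?H" by simp
  have diff: "l (u - v) = l u - l v" for u v using l(1)[of "u - v" v] by simp
  have uminus: "l (- u) = - l u" for u using l(2)[of "-1" u] by simp
  have e0: "l (?e i) = 0" for i by (simp add: diff l(2) k)
  have eN: "?e i \<in> int_lattice n" if "i < n" for i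
    using that k(1) by (intro int_lattice_diff int_lattice_frag_cmul int_lattice_frag_of)
  show "?H \<subseteq> {u \<in> int_lattice n. 0 \<le> l u}"
    using k e0 eN int_lattice_uminus[OF eN] uminus[of "?e _"] by (auto simp del: minus_diff_eq)
  show "generates_monoid ?H {u \<in> int_lattice n. 0 \<le> l u}"
    unfolding generates_monoid_def
  proof (intro allI impI subsetI, elim conjE)
    fix D u assume D0: "0 \<in> D" and Da: "\<forall>a\<in>D. \<forall>b\<in>D. a + b \<in> D" and HD: "?H \<subseteq> D"
      and u: "u \<in> {u \<in> int_lattice n. 0 \<le> l u}"
    have nat: "frag_cmul (int c) a \<in> D" if "a \<in> D" for a c
      using that by (induction c) (auto simp: frag_cmul_distrib D0 Da)
    have int: "frag_cmul c (?e i) \<in> D" if i: "i < n" for c i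
    proof (cases "0 \<le> c")
      case True
      then show ?thesis using nat[of "?e i" "nat c"] HD i by auto
    next
      case False
      have "- ?e i \<in> D" using HD i by blast
      from nat[OF this, of "nat (- c)"] have "frag_cmul (int (nat (- c))) (- ?e i) \<in> D" .
      also have "frag_cmul (int (nat (- c))) (- ?e i) = frag_cmul c (?e i)"
        using False by (intro frag_cmul_negative) simp
      finally show ?thesis .
    qed
    have sum: "(\<Sum>i\<in>I. f i) \<in> D" if "\<And>i. i \<in> I \<Longrightarrow> f i \<in> D" for f :: "nat \<Rightarrow> lat" and I
      using that by (induction I rule: infinite_finite_induct) (auto simp: D0 Da)
    have lsum: "l (\<Sum>i\<in>I. f i) = (\<Sum>i\<in>I. l (f i))" for f :: "nat \<Rightarrow> lat" and I
      using l(2)[of 0 0] by (induction I rule: infinite_finite_induct) (auto simp: l(1))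
    let ?c = "Poly_Mapping.lookup u"
    have uN: "u \<in> int_lattice n" using u by simp
    have "l u = (\<Sum>i<n. ?c i * l (frag_of i))"
      by (subst lat_expansion[OF uN]) (simp add: lsum l(2))
    then have "frag_cmul (l u) k = (\<Sum>i<n. frag_cmul (?c i * l (frag_of i)) k)"
      by (simp add: poly_mapping_eq_iff fun_eq_iff lookup_sum sum_distrib_right)
    then have "(\<Sum>i<n. frag_cmul (?c i) (?e i)) + frag_cmul (l u) k = (\<Sum>i<n. frag_cmul (?c i) (frag_of i))"
      by (simp add: frag_cmul_diff_distrib2 sum_subtractf)
    also have "\<dots> = u" using lat_expansion[OF uN] by simp
    finally have eq: "(\<Sum>i<n. frag_cmul (?c i) (?e i)) + frag_cmul (l u) k = u" .
    have "(\<Sum>i<n. frag_cmul (?c i) (?e i)) \<in> D" using int by (intro sum) auto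
    moreover have "frag_cmul (l u) k \<in> D" using nat[of k "nat (l u)"] HD u by auto
    ultimately have "(\<Sum>i<n. frag_cmul (?c i) (?e i)) + frag_cmul (l u) k \<in> D" by (rule Da[rule_format])
    then show "u \<in> D" unfolding eq .
  qed
qed

lemma generates_monoid_lattice:
  obtains H where "finite H" "H \<subseteq> int_lattice n" "generates_monoid H (int_lattice n)"
proof
  let ?H = "frag_of ` {..<n} \<union> (\<lambda>i. - frag_of i) ` {..<n} :: lat set"
  show "finite ?H" by simp
  show "?H \<subseteq> int_lattice n" by (auto intro: int_lattice_frag_of int_lattice_uminus)
  show "generates_monoid ?H (int_lattice n)"
    unfolding generates_monoid_def
  proof (intro allI impI subsetI, elim conjE)
    fix D u assume D0: "0 \<in> D" and Da: "\<forall>a\<in>D. \<forall>b\<in>D. a + b \<in> D" and HD: "?H \<subseteq> D"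
      and u: "u \<in> int_lattice n"
    have nat: "frag_cmul (int c) a \<in> D" if "a \<in> D" for a c
      using that by (induction c) (auto simp: frag_cmul_distrib D0 Da)
    have int: "frag_cmul c (frag_of i) \<in> D" if i: "i < n" for c i
    proof (cases "0 \<le> c")
      case True
      then show ?thesis using nat[of "frag_of i" "nat c"] HD i by auto
    next
      case False
      have "- frag_of i \<in> D" using HD i by blast
      from nat[OF this, of "nat (- c)"] have "frag_cmul (int (nat (- c))) (- frag_of i) \<in> D" .
      also have "frag_cmul (int (nat (- c))) (- frag_of i) = frag_cmul c (frag_of i)"
        using False by (intro frag_cmul_negative) simp
      finally show ?thesis .
    qed
    have sum: "(\<Sum>i\<in>I. f i) \<in> D" if "\<And>i. i \<in> I \<Longrightarrow> f i \<in> D" for f :: "nat \<Rightarrow> lat" and I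
      using that by (induction I rule: infinite_finite_induct) (auto simp: D0 Da)
    have "(\<Sum>i<n. frag_cmul (Poly_Mapping.lookup u i) (frag_of i)) \<in> D" using int by (intro sum) auto
    then show "u \<in> D" using lat_expansion[OF u] by simp
  qed
qed

text \<open>
  The poles of a map \<open>\<pi>\<close> on the torus are bounded because \<open>\<pi>\<close> is also defined on the chart of the ray.
\<close>

lemma pushforward_pole_bound:
  fixes l :: "lat \<Rightarrow> int" and \<pi> :: "'k::field ratfun set set \<Rightarrow> 'k ratfun \<Rightarrow> 'k ratfun"
  assumes hom: "pushforward_hom n \<Sigma> q \<pi>" and q: "q > 0"
    and l: "\<And>u v. l (u + v) = l u + l v" "\<And>c u. l (frag_cmul c u) = c * l u"
    and k: "k \<in> int_lattice n" "l k = 1"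
    and \<tau>: "\<tau> \<in> \<Sigma>" "dual_monoid n \<tau> = {u \<in> int_lattice n. 0 \<le> l u}"
    and H0: "finite H0" "generates_monoid H0 (int_lattice n)" "monomial_open n \<Sigma> H0 \<noteq> ({} :: 'k ratfun set set)"
    and u: "u \<in> int_lattice n"
    and p: "\<pi> (monomial_open n \<Sigma> H0) (monomial u) = Fract p 1"
    and m: "m \<in> Poly_Mapping.keys p"
    and mono_sec: "\<And>u. u \<in> int_lattice n \<Longrightarrow> (monomial u :: 'k ratfun) \<in> sections (monomial_open n \<Sigma> H0)"
  shows "- int q < int q * l m - l u"
proof -
  let ?T = "monomial_open n \<Sigma> H0 :: 'k ratfun set set"
  obtain H where H: "finite H" "H \<subseteq> dual_monoid n \<tau>" "generates_monoid H (dual_monoid n \<tau>)"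
    using generates_monoid_half_space[of l k n] l k unfolding \<tau>(2) by blast
  let ?U = "monomial_open n \<Sigma> H :: 'k ratfun set set"
  have U: "zariski_open n \<Sigma> ?U" "zariski_open n \<Sigma> ?T"
    using zariski_open_monomial_open H0(1) H(1) by blast+
  have pre: "power_preimage n \<Sigma> q ?U = ?U" "power_preimage n \<Sigma> q ?T = ?T"
    using power_preimage_monomial_open[OF q] by blast+
  have secU: "sections ?U = (\<lambda>f. Fract f 1) ` carrier (chart_ring n \<tau> :: 'k laurent ring)"
    by (rule sections_monomial_open[OF \<tau>(1) H(2,3)])
  have sub: "?T \<subseteq> ?U"
  proof
    fix x assume x: "x \<in> ?T"
    have "monomial h \<in> x" if "h \<in> H" for h
    proof -
      have "h \<in> int_lattice n" using that H(2) by (auto simp: dual_monoid_def)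
      then have "monomial h \<in> sections ?T" using mono_sec by blast
      then show ?thesis using x H0(3) by (simp add: sections_def)
    qed
    then show "x \<in> ?U" using x by (simp add: monomial_open_def)
  qed
  \<comment> \<open>The twist by \<open>t\<close> moves \<open>u\<close> to the lowest admissible
    level, with \<open>l u'\<close> between 0 and \<open>q - 1\<close>. Regularity of its image
    gives \<open>j \<le> l m\<close>, and the rounding in \<open>j\<close> costs less than
    \<open>q\<close>.\<close>
  define j where "j = l u div int q"
  define t where "t = frag_cmul (- j) k"
  define u' where "u' = frag_cmul (int q) t + u"
  have t: "t \<in> int_lattice n" "l t = - j" using k by (auto simp: t_def l(2) intro: int_lattice_frag_cmul simp del: minus_frag_cmul)
  have lu': "l u' = l u mod int q"
    by (simp add: u'_def l t(2) j_def minus_mult_div_eq_mod[symmetric])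
  then have "u' \<in> dual_monoid n \<tau>"
    unfolding \<tau>(2) using q t(1) u by (auto simp: u'_def intro: int_lattice_add int_lattice_frag_cmul)
  then have "monomial u' \<in> sections ?U" unfolding secU by (intro imageI single_in_chart)
  then have sec: "monomial u' \<in> sections (power_preimage n \<Sigma> q ?U)" by (simp only: pre)
  have "\<pi> ?U (monomial u') \<in> sections ?U"
    using hom U(1) sec unfolding pushforward_hom_def by blast
  moreover have "\<pi> ?T (restr (power_preimage n \<Sigma> q ?T) (monomial u')) = restr ?T (\<pi> ?U (monomial u'))"
    using hom U sub sec unfolding pushforward_hom_def by blast
  then have "\<pi> ?T (monomial u') = \<pi> ?U (monomial u')" using H0(3) by (simp only: pre restr_def if_False)
  ultimately have "\<pi> ?T (monomial u') \<in> sections ?U" by simp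
  then obtain f where f: "f \<in> carrier (chart_ring n \<tau> :: 'k laurent ring)" "\<pi> ?T (monomial u') = Fract f 1"
    unfolding secU by auto
  have "monomial u' = power_pullback q (monomial t) * monomial u"
    using q by (simp add: u'_def monomial_add power_pullback_monomial del: mult_fract)
  moreover have "\<pi> ?T (power_pullback q (monomial t) * monomial u) = monomial t * \<pi> ?T (monomial u)"
    using hom U mono_sec[OF u] mono_sec[OF t(1)] unfolding pushforward_hom_def by (simp add: pre)
  ultimately have "Fract f 1 = monomial t * Fract p 1" using f(2) p by metis
  then have "f = Poly_Mapping.single t 1 * p" by (simp add: eq_fract)
  then have "t + m \<in> Poly_Mapping.keys f" using m by (simp add: in_keys_iff lookup_single_mult)
  then have "t + m \<in> dual_monoid n \<tau>" using f(1) by auto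
  then have "j \<le> l m" unfolding \<tau>(2) by (simp add: l(1) t(2))
  then have "int q * j \<le> int q * l m" using q by simp
  moreover have "l u = int q * j + l u mod int q" by (simp add: j_def)
  moreover have "l u mod int q < int q" using q by simp
  ultimately show ?thesis by linarith
qed

lemma dual_monoid_zero_cone [simp]: "dual_monoid n {0} = int_lattice n"
  by (auto simp: dual_monoid_def)

lemma dual_monoid_ray:
  "dual_monoid n (ray (of_lat v)) = {u \<in> int_lattice n. 0 \<le> int_pairing u v}"
proof (intro equalityI subsetI)
  fix u assume u: "u \<in> dual_monoid n (ray (of_lat v))"
  have "of_lat v \<in> ray (of_lat v)" by (auto simp: ray_def intro: exI[of _ 1])
  then have "0 \<le> pairing u (of_lat v)" using u unfolding dual_monoid_def by blast
  then show "u \<in> {u \<in> int_lattice n. 0 \<le> int_pairing u v}"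
    using u by (simp add: dual_monoid_def pairing_of_lat)
next
  fix u assume "u \<in> {u \<in> int_lattice n. 0 \<le> int_pairing u v}"
  then show "u \<in> dual_monoid n (ray (of_lat v))"
    by (auto simp: dual_monoid_def ray_def pairing_scaleR pairing_of_lat)
qed

text \<open>The splitting is evaluated over the torus of the product, where images are Laurent
  polynomials whose exponents can be inspected.\<close>

lemma diagonally_split_imp_small_representatives:
  assumes fan: "fan n \<Sigma>" and q: "q > 0" and split: "diagonally_split TYPE('k::field) n \<Sigma> q"
  shows "small_representatives n (primitive_generators n \<Sigma>) q"
  unfolding small_representatives_def
proof
  let ?\<Sigma> = "fan_product \<Sigma> \<Sigma>"
  let ?R = "\<lambda>\<sigma>. chart_ring (2 * n) \<sigma> :: 'k laurent ring"
  let ?N = "int_lattice (2 * n)"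
  obtain \<pi> :: "'k ratfun set set \<Rightarrow> 'k ratfun \<Rightarrow> 'k ratfun" where
    splitting: "splitting (2 * n) ?\<Sigma> q \<pi>" and compatible: "compatible_with (2 * n) ?\<Sigma> q \<pi> (diagonal n \<Sigma>)"
    using split unfolding diagonally_split_def by blast
  have hom: "pushforward_hom (2 * n) ?\<Sigma> q \<pi>" using splitting by (simp add: splitting_def)
  have zero: "{0} \<in> \<Sigma>" by (rule fan_zero_cone[OF fan])
  let ?O = "cone_product {0} {0} :: rvec set"
  have O: "?O \<in> ?\<Sigma>" using zero by (auto simp: fan_product_def)
  have dualO: "dual_monoid (2 * n) ?O = ?N"
    by (auto simp: dual_monoid_product int_lattice_double_iff)
  obtain H where H: "finite H" "H \<subseteq> ?N" "generates_monoid H ?N" by (rule generates_monoid_lattice)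
  let ?T = "monomial_open (2 * n) ?\<Sigma> H :: 'k ratfun set set"
  have T: "zariski_open (2 * n) ?\<Sigma> ?T" by (rule zariski_open_monomial_open[OF H(1)])
  have secT: "sections ?T = (\<lambda>f. Fract f 1) ` carrier (?R ?O)" and neT: "?T \<noteq> {}"
    using sections_monomial_open[OF O, of H "2 * n"] H unfolding dualO by blast+
  have pre: "power_preimage (2 * n) ?\<Sigma> q ?T = ?T" by (rule power_preimage_monomial_open[OF q])
  have carrO: "carrier (?R ?O) = {f. Poly_Mapping.keys f \<subseteq> ?N}" by (simp add: dualO)
  have mono_sec: "monomial u \<in> sections ?T" if "u \<in> ?N" for u
    unfolding secT carrO using that by simp
  fix u assume u: "u \<in> int_lattice n"
  define w where "w = pair u (- u)"
  have wN: "w \<in> ?N" using u by (simp add: w_def int_lattice_double_iff int_lattice_uminus)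
  have "\<pi> ?T (monomial w) \<in> sections ?T"
    using hom T mono_sec[OF wN] unfolding pushforward_hom_def by (simp add: pre)
  then obtain p where p: "p \<in> carrier (?R ?O)" "\<pi> ?T (monomial w) = Fract p 1" unfolding secT by blast
  \<comment> \<open>This function vanishes on the diagonal, and its image differs from that of the
    monomial by \<open>\<pi>(1) = 1\<close>.\<close>
  let ?s = "Fract (Poly_Mapping.single w 1 - 1) 1 :: 'k ratfun"
  have single_w: "Poly_Mapping.single w (1::'k) - 1 \<in> carrier (?R ?O)"
    using subring_of.diff[OF subring_of_chart single_in_chart subring_of.one[OF subring_of_chart]] wN dualO by blast
  have s: "?s \<in> sections ?T" unfolding secT using single_w by blast
  have one_sec: "1 \<in> sections ?T" using mono_sec[OF int_lattice_zero] by (simp flip: One_fract_def)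
  have "\<pi> ?T (power_pullback q 1) = 1" using splitting T one_sec by (simp add: splitting_def)
  moreover have "power_pullback q 1 = (1 :: 'k ratfun)"
    using power_pullback_monomial[OF q, of 0] by (simp flip: One_fract_def)
  ultimately have pi_one: "\<pi> ?T 1 = 1" by simp
  have "?s + 1 = monomial w" by (simp add: One_fract_def)
  moreover have "\<pi> ?T (?s + 1) = \<pi> ?T ?s + \<pi> ?T 1"
    using hom T s one_sec unfolding pushforward_hom_def by (simp add: pre)
  ultimately have "\<pi> ?T ?s = Fract p 1 - 1" using p(2) pi_one by (simp add: eq_diff_eq)
  then have pi_s: "\<pi> ?T ?s = Fract (p - 1) 1" by (simp add: One_fract_def)
  have diag_w: "diagonal_map (Poly_Mapping.single w (1::'k) - 1) = 0"
    by (simp add: diagonal_map_diff w_def)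
  have "?s \<in> ideal_sections (diagonal n \<Sigma>) ?T"
    unfolding ideal_sections_def
  proof (intro CollectI conjI ballI s)
    fix x assume x: "x \<in> ?T \<inter> diagonal n \<Sigma>"
    then obtain \<sigma> P where \<sigma>: "\<sigma> \<in> \<Sigma>" and P: "primeideal P (chart_ring n \<sigma> :: 'k laurent ring)"
      and x_eq: "x = localisation (?R (cone_product \<sigma> \<sigma>)) {f \<in> carrier (?R (cone_product \<sigma> \<sigma>)). diagonal_map f \<in> P}"
      unfolding diagonal_def by blast
    let ?P = "{f \<in> carrier (?R (cone_product \<sigma> \<sigma>)). diagonal_map f \<in> P}"
    have "?s \<in> x" using s x neT by (simp add: sections_def)
    \<comment> \<open>The denominator of an inverse would be divisible by a function vanishing on
      the diagonal, hence lie in the prime of the point.\<close>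
    moreover have "inverse ?s \<notin> x" if "?s \<noteq> 0"
    proof
      assume "inverse ?s \<in> x"
      then obtain f g where fg: "inverse ?s = Fract f g" "g \<in> carrier (?R (cone_product \<sigma> \<sigma>)) - ?P"
        unfolding x_eq localisation_def by blast
      have Pp: "prime_in (carrier (chart_ring n \<sigma> :: 'k laurent ring)) P" using P by (simp add: primeideal_chart_iff)
      then have "0 \<in> P" by (simp add: prime_in_def ideal_in_def)
      then have "g \<noteq> 0" using fg(2) by auto
      moreover have "Poly_Mapping.single w (1::'k) - 1 \<noteq> 0" using that by (auto simp: Zero_fract_def)
      ultimately have "g = f * (Poly_Mapping.single w 1 - 1)" using fg(1) by (simp add: eq_fract)
      then have "diagonal_map g = 0" using diag_w by (simp add: diagonal_map_mult)
      then show False using fg(2) \<open>0 \<in> P\<close> by auto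
    qed
    ultimately show "?s \<in> max_ideal x" by (auto simp: max_ideal_def)
  qed
  then have "\<pi> ?T ?s \<in> ideal_sections (diagonal n \<Sigma>) ?T"
    using compatible T unfolding compatible_with_def by (simp add: pre)
  then have max: "Fract (p - 1) 1 \<in> max_ideal y" if "y \<in> ?T" "y \<in> diagonal n \<Sigma>" for y
    using that unfolding pi_s ideal_sections_def by blast
  \<comment> \<open>At the generic point of the diagonal, vanishing of \<open>p - 1\<close> means
    that \<open>p\<close> restricts to exactly 1.\<close>
  let ?K = "{f \<in> carrier (?R ?O). diagonal_map f \<in> {0}}"
  have zp: "prime_in (carrier (chart_ring n {0} :: 'k laurent ring)) {0}"
    by (intro prime_in_zero subring_of_chart)
  have K: "prime_in (carrier (?R ?O)) ?K" by (rule diagonal_prime[OF _ zp]) simp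
  then have Ki: "primeideal ?K (?R ?O)" by (simp add: primeideal_chart_iff)
  have "localisation (?R ?O) ?K \<in> ?T"
    using pointsI[OF O Ki] Fract_in_localisation[OF Ki single_in_chart] H(2) dualO
    by (auto simp: monomial_open_def simp del: carrier_chart_ring)
  moreover have "localisation (?R ?O) ?K \<in> diagonal n \<Sigma>"
    using zero zp unfolding diagonal_def primeideal_chart_iff by blast
  ultimately have "Fract (p - 1) 1 \<in> max_ideal (localisation (?R ?O) ?K)" by (rule max)
  moreover have "p - 1 \<in> carrier (?R ?O)"
    using p(1) by (intro subring_of.diff[OF subring_of_chart] subring_of.one[OF subring_of_chart])
  moreover have "1 \<in> carrier (?R ?O) - ?K"
    using K subring_of.one[OF subring_of_chart] unfolding prime_in_def by blast
  ultimately have "p - 1 \<in> ?K" using max_ideal_Fract_iff[OF K] by blast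
  then have "diagonal_map p = 1" by (simp add: diagonal_map_diff)
  \<comment> \<open>The constant term of the restriction collects the terms of \<open>p\<close> with
    antidiagonal exponents, so at least one occurs.\<close>
  then have "0 \<in> Poly_Mapping.keys (diagonal_map p)" by simp
  then have "0 \<in> (\<lambda>w. first_part w + second_part w) ` Poly_Mapping.keys p"
    unfolding diagonal_map_def by (rule keys_monomial_map[THEN subsetD])
  then obtain m where m: "m \<in> Poly_Mapping.keys p" "first_part m + second_part m = 0" by auto
  have mN: "m \<in> ?N" using m(1) p(1) carrO by blast
  have m2: "second_part m = - first_part m" using m(2) by (simp add: eq_neg_iff_add_eq_0 add.commute)
  have w_parts: "first_part w = u" "second_part w = - u" by (simp_all add: w_def)
  have "\<bar>int_pairing (u + frag_cmul (int q) (- first_part m)) v\<bar> < int q"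
    if v: "v \<in> primitive_generators n \<Sigma>" for v
  proof -
    obtain k where k: "k \<in> int_lattice n" "int_pairing k v = 1" using primitive_pairing_one[OF v] .
    have ray: "ray (of_lat v) \<in> \<Sigma>" using v by (simp add: primitive_generators_def)
    have ray0: "0 \<in> ray (of_lat v)" using fan_zero_mem[OF fan ray] .
    \<comment> \<open>The divisor of \<open>v\<close> in the first factor bounds the pairing from
      above; the one in the second factor, where both exponents change sign, bounds it from
      below.\<close>
    have "- int q < int q * int_pairing (first_part m) v - int_pairing (first_part w) v"
    proof (rule pushforward_pole_bound[OF hom q, where l = "\<lambda>u. int_pairing (first_part u) v" and k = "pair k 0" and \<tau> = "cone_product (ray (of_lat v)) {0}"])
      show "cone_product (ray (of_lat v)) {0} \<in> ?\<Sigma>" using ray zero by (auto simp: fan_product_def)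
      show "dual_monoid (2 * n) (cone_product (ray (of_lat v)) {0}) = {u \<in> ?N. 0 \<le> int_pairing (first_part u) v}"
        using ray0 by (auto simp: dual_monoid_product dual_monoid_ray int_lattice_double_iff)
    qed (use k H(1,3) neT wN p(2) m(1) mono_sec in
        \<open>auto simp: first_part_add first_part_frag_cmul int_pairing_add int_pairing_frag_cmul int_lattice_double_iff\<close>)
    moreover have "- int q < int q * int_pairing (second_part m) v - int_pairing (second_part w) v"
    proof (rule pushforward_pole_bound[OF hom q, where l = "\<lambda>u. int_pairing (second_part u) v" and k = "pair 0 k" and \<tau> = "cone_product {0} (ray (of_lat v))"])
      show "cone_product {0} (ray (of_lat v)) \<in> ?\<Sigma>" using ray zero by (auto simp: fan_product_def)
      show "dual_monoid (2 * n) (cone_product {0} (ray (of_lat v))) = {u \<in> ?N. 0 \<le> int_pairing (second_part u) v}"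
        using ray0 by (auto simp: dual_monoid_product dual_monoid_ray int_lattice_double_iff)
    qed (use k H(1,3) neT wN p(2) m(1) mono_sec in
        \<open>auto simp: second_part_add second_part_frag_cmul int_pairing_add int_pairing_frag_cmul int_lattice_double_iff\<close>)
    ultimately show ?thesis
      unfolding m2 w_parts int_pairing_add int_pairing_frag_cmul int_pairing_uminus by (simp add: abs_less_iff algebra_simps)
  qed
  moreover have "- first_part m \<in> int_lattice n" using mN by (simp add: int_lattice_double_iff int_lattice_uminus)
  ultimately show "\<exists>k\<in>int_lattice n. \<forall>v\<in>primitive_generators n \<Sigma>. \<bar>int_pairing (u + frag_cmul (int q) k) v\<bar> < int q"
    by blast
qed

theorem corollary1p4:
  fixes n :: nat and \<Sigma> :: "(nat \<Rightarrow>\<^sub>0 real) set set"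
  assumes "complete_fan n \<Sigma>"
  shows "(unimodular n (primitive_generators n \<Sigma>)
            \<longleftrightarrow> (\<forall>q::nat. q \<ge> 2 \<longrightarrow> diagonally_split TYPE('k::field) n \<Sigma> q))
       \<and> ((\<forall>q::nat. q \<ge> 2 \<longrightarrow> diagonally_split TYPE('k) n \<Sigma> q)
            \<longleftrightarrow> (\<exists>q::nat. even q \<and> q \<ge> 2 \<and> diagonally_split TYPE('k) n \<Sigma> q))
       \<and> ((\<exists>q::nat. even q \<and> q \<ge> 2 \<and> diagonally_split TYPE('k) n \<Sigma> q)
            \<longleftrightarrow> diagonally_split TYPE('k) n \<Sigma> 2)"
proof -
  let ?S = "primitive_generators n \<Sigma>"
  let ?split = "diagonally_split TYPE('k) n \<Sigma>"
  have fan: "fan n \<Sigma>" using assms by (simp add: complete_fan_def)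
  have S: "finite ?S" "?S \<subseteq> int_lattice n"
    using finite_primitive_generators[OF fan] by (auto dest: primitive_generators_in_lattice)
  have split_if: "?split q" if "unimodular n ?S" "q \<ge> 2" for q
  proof (rule small_representatives_imp_diagonally_split[OF fan])
    show "q > 0" using that by simp
    then show "small_representatives n ?S q"
      by (rule unimodular_imp_small_representatives[OF S that(1)])
  qed
  have unimodular_if: "unimodular n ?S" if "even q" "q \<ge> 2" "?split q" for q
  proof -
    have "q > 0" using that by simp
    from diagonally_split_imp_small_representatives[OF fan this that(3)]
    have "small_representatives n ?S 2"
      by (rule small_representatives_2_if_even[OF _ that(1) \<open>q > 0\<close>])
    then show ?thesis
      by (rule small_representatives_2_imp_unimodular[OF S(2) complete_fan_span[OF assms]])
  qed
  \<comment> \<open>The value 2 closes the cycle: it is among all \<open>q\<close>, and it is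
    even.\<close>
  have two: "even (2 :: nat)" "(2 :: nat) \<ge> 2" by simp_all
  show ?thesis using split_if unimodular_if two by blast
qed

end
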